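(* Consider the SUDA--Muon algorithm described in the context, under the network/communication assumption, the smoothness and lower-boundedness assumption, the stochastic oracle assumption and the stability condition stated there, with initialization $\mathbf Y^0=0$, $\mathbf M^0=\mathbf G^0$, $\mathbf H^0=\mathbf M^0$. Let $\gamma\in(0,1)$, $v_1\ge 1$, $v_2\ge 1$, $\lambda_a\ge 0$ be SUDA constants as defined in the context. Fix constants $\alpha_0>0$ and $b_0\in(0,1]$, fix a horizon $K\ge 1$, and run the algorithm with $$\alpha=\frac{\alpha_0}{K^{3/4}},\qquad 1-\beta=\frac{b_0}{\sqrt K}.$$ Let $r_{\max}=\min\{m,n\}$, $\Delta_0=\mathbb E[f(\bar X^0)]-f_{\inf}$, $\lambda=\rho(W-J)\in(0,1)$, and $E_{\rm gt}^k=\bar H^k-\nabla f(\bar X^k)$. Then $$\begin{aligned} \frac1K\sum_{k=0}^{K-1}\mathbb E\|\nabla f(\bar X^k)\|_* \le{}&\Big(\frac{\Delta_0}{\alpha_0}+\frac{2\sigma\sqrt{r_{\max}}}{\sqrt N}\sqrt{b_0}+\frac{2L_*\alpha_0r_{\max}}{b_0}\Big)K^{-1/4}\\ &+\Big(\frac52L_*\alpha_0+\frac{4L_*\alpha_0v_1v_2\lambda_a}{1-\gamma}r_{\max}+\frac{2\lambda}{1-\lambda}L_*\alpha_0r_{\max}+\frac{8\lambda}{1-\lambda}\,\frac{L_*\alpha_0v_1v_2\lambda_a}{1-\gamma}r_{\max}\Big)K^{-3/4}\\ &+\Big(\frac{2\sqrt{r_{\max}}}{b_0}\mathbb E\|E_{\rm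 gt}^0\|_F+\frac{4\lambda}{1-\lambda}b_0\sigma\sqrt{r_{\max}}\Big)K^{-1/2}\\ &+\Big(\frac{2L_*v_1v_2(1+\|B^2\|)}{(1-\gamma)\sqrt N}\sqrt{r_{\max}}\|\tilde{\mathbf X}^0\|_F+\frac{4\lambda}{1-\lambda}\,\frac{L_*v_1v_2(1+\|B^2\|)}{(1-\gamma)\sqrt N}\sqrt{r_{\max}}\|\tilde{\mathbf X}^0\|_F\\ &\qquad+\frac{2\lambda}{1-\lambda}\,\frac{L_*v_1v_2(1+\|B^2\|)}{\sqrt N}\sqrt{r_{\max}}\|\tilde{\mathbf X}^0\|_F+\frac{2\lambda}{1-\lambda}\sqrt{\frac{r_{\max}}N}\,\mathbb E\|\widetilde{\nabla\mathbf f}(\mathbf X^0)-\tilde{\mathbf M}^0\|_F\\ &\qquad+\frac{2\lambda}{1-\lambda}\sqrt{\frac{r_{\max}}N}\,\mathbb E\|\tilde{\mathbf H}^0\|_F\Big)K^{-1}\\ &+\frac{4\lambda}{1-\lambda}\,\frac{L_*\alpha_0v_1v_2\lambda_a}{1-\gamma}r_{\max}K^{-7/4}. \end{aligned}$$ In particular (for the family of runs indexed by the horizon $K$, where the run with horizon $K$ uses $\alpha=\alpha_0K^{-3/4}$ and $1-\beta=b_0K^{-1/2}$, and everything else is fixed), $$\lim_{K\to\infty}\frac1K\sum_{k=0}^{K-1}\mathbb E\|\nabla f(\bar X^k)\|_*=0.$$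
   Context: Notation. $\|\cdot\|$, $\|\cdot\|_F$, $\|\cdot\|_*$ are the operator (spectral), Frobenius and nuclear norms. A stacked variable is $\mathbf Z=\mathrm{col}\{Z_1,\dots,Z_N\}$ with blocks $Z_i\in\mathbb R^{m\times n}$; $\|\mathbf Z\|_F^2=\sum_i\|Z_i\|_F^2$; an $N\times N$ matrix $P$ acts by $(P\mathbf Z)_i=\sum_jP_{ij}Z_j$. $\bar Z=\frac1N\sum_iZ_i$, $J=\frac1N\mathbf 1\mathbf 1^\top$, $\tilde{\mathbf Z}=(I-J)\mathbf Z$. For $H\in\mathbb R^{m\times n}$ with reduced SVD $H=U\Sigma V^\top$, $\operatorname{msgn}(H)=UV^\top$, and $\operatorname{msgn}(0)=0$; on stacked variables it acts blockwise. $\nabla\mathbf f(\mathbf X)=\mathrm{col}\{\nabla f_1(X_1),\dots,\nabla f_N(X_N)\}$ and $\widetilde{\nabla\mathbf f}(\mathbf X)=(I-J)\nabla\mathbf f(\mathbf X)$. Network/communication assumption. $W\in\mathbb R^{N\times N}$ is symmetric, doubly stochastic and primitive, with $\lambda=\rho(W-J)\in(0,1)$ ($\rho$ = spectral radius). $A,B,C\in\mathbb R^{N\times N}$ satisfy: $A,C$ are doubly stochastic; $B\mathbf Z=0$ iff $Z_1=\dots=Z_N$; $A$, $B^2$, $C$ are polynomials in $W$. Smoothness and lower boundedness. $f_i:\mathbb R^{m\times n}\to\mathbb R$ are differentiable with $\|\nabla f_i(X)-\nabla f_i(Y)\|_*\le L_*\|X-Y\|$ for all $X,Y$ and $i\in[N]$;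 $f=\frac1N\sum_if_i\ge f_{\inf}>-\infty$. Algorithm. Stepsize $\alpha>0$, EMA parameter $\beta\in[0,1)$. Start from a chosen (deterministic) $\mathbf X^0$, $\mathbf Y^0=0$, stochastic gradients $\mathbf G^0$ at $\mathbf X^0$, $\mathbf M^0=\mathbf G^0$, $\mathbf H^0=\mathbf M^0$. For $k\ge0$, with $\mathbf G^k$ the stacked stochastic gradients at $\mathbf X^k$ (the same $\mathbf G^0$ is used at $k=0$): $\mathbf M^{k+1}=\beta\mathbf M^k+(1-\beta)\mathbf G^k$; $\mathbf H^{k+1}=W(\mathbf H^k+\mathbf M^{k+1}-\mathbf M^k)$; $\mathbf X^{k+1}=A(C\mathbf X^k-\alpha\operatorname{msgn}(\mathbf H^{k+1}))-B\mathbf Y^k$; $\mathbf Y^{k+1}=\mathbf Y^k+B\mathbf X^{k+1}$. Stochastic oracle. With $\mathcal F^k$ the natural filtration of the algorithm (all randomness used to form $\mathbf X^k$), $\mathbb E[G_i^k\mid\mathcal F^k]=\nabla f_i(X_i^k)$ and $\mathbb E[\|G_i^k-\nabla f_i(X_i^k)\|_F^2\mid\mathcal F^k]\le\sigma^2$; stochastic gradients are conditionally independent across agents and time given $\mathcal F^k$. Stability condition. Write $W=Q\,\mathrm{diag}(1,\hat\Lambda)Q^\top$ with $Q$ orthogonal and first column $\mathbf 1/\sqrt N$; then $A=Q\,\mathrm{diag}(1,\hat\Lambda_a)Q^\top$, $C=Q\,\mathrm{diag}(1,\hat\Lambda_c)Q^\top$, $B^2=Q\,\mathrm{diag}(0,\hat\Lambda_b^2)Q^\top$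 with diagonal $\hat\Lambda_a,\hat\Lambda_c,\hat\Lambda_b^2$. The SUDA deviation matrix $\begin{bmatrix}\hat\Lambda_a\hat\Lambda_c-\hat\Lambda_b^2&-I\\ \hat\Lambda_b^2&I\end{bmatrix}$ is assumed to have all eigenvalues strictly inside the unit circle. SUDA constants. Under stability there exist $\gamma\in(0,1)$, $v_1,v_2\ge1$, $\lambda_a\ge0$, depending only on $A,B,C$ and the network, such that for every $\alpha>0$, every $\mathbf X^0$, $\mathbf Y^0=0$, and every stacked input sequence $(\mathbf U^{k+1})_{k\ge0}$, the recursion $\mathbf X^{k+1}=A(C\mathbf X^k-\alpha\mathbf U^{k+1})-B\mathbf Y^k$, $\mathbf Y^{k+1}=\mathbf Y^k+B\mathbf X^{k+1}$ satisfies for all $k\ge0$: $\|\tilde{\mathbf X}^k\|_F\le v_1v_2\gamma^k(1+\|B^2\|)\|\tilde{\mathbf X}^0\|_F+\frac{\alpha v_1v_2\lambda_a}{1-\gamma}\sup_{0\le t\le k}\|\tilde{\mathbf U}^{t+1}\|_F$. Any such $(\gamma,v_1,v_2,\lambda_a)$ are called SUDA constants. *)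

theory Defs
  imports "HOL-Probability.Probability" "HOL-Computational_Algebra.Polynomial"
begin

text \<open>
  An \<open>m \<times> n\<close> matrix has type \<open>real^'n^'m\<close>, whose library \<open>norm\<close> and inner product are the
  Frobenius ones. Agents are indexed by a finite type \<open>'a\<close>, so a stacked variable has type
  \<open>real^'n^'m^'a\<close>; its library \<open>norm\<close> is again the Frobenius norm of the stack.
\<close>

definition outer_prod :: "real^'m \<Rightarrow> real^'n \<Rightarrow> real^'n^'m" where
  "outer_prod u v = (\<chi> a b. u $ a * v $ b)"

text \<open>
  \<open>H = U \<Sigma> V\<^sup>T\<close> with \<open>r\<close> columns: \<open>u i\<close>, \<open>v i\<close> (\<open>i < r\<close>) are the columns of \<open>U\<close>, \<open>V\<close> and
  \<open>s i > 0\<close> the diagonal of \<open>\<Sigma>\<close>; \<open>r\<close> is then the rank of \<open>H\<close>, and \<open>r = 0\<close> iff \<open>H = 0\<close>.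
\<close>

definition reduced_svd ::
  "real^'n^'m \<Rightarrow> nat \<Rightarrow> (nat \<Rightarrow> real^'m) \<Rightarrow> (nat \<Rightarrow> real) \<Rightarrow> (nat \<Rightarrow> real^'n) \<Rightarrow> bool" where
  "reduced_svd H r u s v \<longleftrightarrow>
     (\<forall>i<r. \<forall>j<r. u i \<bullet> u j = (if i = j then 1 else 0)) \<and>
     (\<forall>i<r. \<forall>j<r. v i \<bullet> v j = (if i = j then 1 else 0)) \<and>
     (\<forall>i<r. 0 < s i) \<and>
     H = (\<Sum>i<r. s i *\<^sub>R outer_prod (u i) (v i))"

text \<open>The values below do not depend on the chosen decomposition; both vanish at \<open>0\<close>.\<close>

definition msgn :: "real^'n^'m \<Rightarrow> real^'n^'m" where
  "msgn H = (THE D. \<exists>r u s v. reduced_svd H r u s v \<and> D = (\<Sum>i<r. outer_prod (u i) (v i)))"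

definition nuclear_norm :: "real^'n^'m \<Rightarrow> real" where
  "nuclear_norm H = (THE c. \<exists>r u s v. reduced_svd H r u s v \<and> c = (\<Sum>i<r. s i))"

abbreviation op_norm :: "real^'n^'m \<Rightarrow> real" where
  "op_norm H \<equiv> onorm (\<lambda>x. H *v x)"

definition diag_mat :: "('a \<Rightarrow> real) \<Rightarrow> real^'a^'a" where
  "diag_mat d = (\<chi> i j. if i = j then d i else 0)"

primrec matpow :: "real^'a^'a \<Rightarrow> nat \<Rightarrow> real^'a^'a" where
  "matpow W 0 = mat 1"
| "matpow W (Suc k) = W ** matpow W k"

definition polynomial_in :: "real^'a^'a \<Rightarrow> real^'a^'a \<Rightarrow> bool" where
  "polynomial_in W P \<longleftrightarrow>
     (\<exists>p :: real poly. P = (\<Sum>k\<le>degree p. coeff p k *\<^sub>R matpow W k))"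

definition doubly_stochastic :: "real^'a^'a \<Rightarrow> bool" where
  "doubly_stochastic P \<longleftrightarrow>
     (\<forall>i j. 0 \<le> P $ i $ j) \<and>
     (\<forall>i. (\<Sum>j\<in>UNIV. P $ i $ j) = 1) \<and> (\<forall>j. (\<Sum>i\<in>UNIV. P $ i $ j) = 1)"

text \<open>The usual notion for entrywise nonnegative matrices.\<close>

definition primitive_matrix :: "real^'a^'a \<Rightarrow> bool" where
  "primitive_matrix P \<longleftrightarrow>
     (\<forall>i j. 0 \<le> P $ i $ j) \<and> (\<exists>k\<ge>1. \<forall>i j. 0 < matpow P k $ i $ j)"

text \<open>Complex eigenvalues of a real matrix whose rows and columns range over the finite set \<open>I\<close>.\<close>

definition eigenvalue_on :: "'i set \<Rightarrow> ('i \<Rightarrow> 'i \<Rightarrow> real) \<Rightarrow> complex \<Rightarrow> bool" where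
  "eigenvalue_on I D \<mu> \<longleftrightarrow>
     (\<exists>x :: 'i \<Rightarrow> complex. (\<exists>p\<in>I. x p \<noteq> 0) \<and>
        (\<forall>p\<in>I. (\<Sum>q\<in>I. of_real (D p q) * x q) = \<mu> * x p))"

definition spectral_radius :: "real^'a^'a \<Rightarrow> real" where
  "spectral_radius P = (SUP \<mu> \<in> {\<mu>. eigenvalue_on UNIV (\<lambda>i j. P $ i $ j) \<mu>}. cmod \<mu>)"

definition avg_mat :: "real^'a^'a" where
  "avg_mat = (\<chi> i j. 1 / real CARD('a))"

definition act :: "real^'a^'a \<Rightarrow> ('b::real_vector)^'a \<Rightarrow> 'b^'a" where
  "act P Z = (\<chi> i. \<Sum>j\<in>UNIV. P $ i $ j *\<^sub>R Z $ j)"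

definition mean :: "('b::real_vector)^'a \<Rightarrow> 'b" where
  "mean Z = (1 / real CARD('a)) *\<^sub>R (\<Sum>i\<in>UNIV. Z $ i)"

definition dev :: "('b::real_vector)^'a \<Rightarrow> 'b^'a" where
  "dev Z = act (mat 1 - avg_mat) Z"

definition msgn_stack :: "real^'n^'m^'a \<Rightarrow> real^'n^'m^'a" where
  "msgn_stack Z = (\<chi> i. msgn (Z $ i))"

definition gradient :: "('b::real_inner \<Rightarrow> real) \<Rightarrow> 'b \<Rightarrow> 'b" where
  "gradient g x = (THE D. GDERIV g x :> D)"

definition avg_fun :: "('a::finite \<Rightarrow> 'b \<Rightarrow> real) \<Rightarrow> 'b \<Rightarrow> real" where
  "avg_fun f x = (1 / real CARD('a)) * (\<Sum>i\<in>UNIV. f i x)"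

definition grad_stack :: "('a \<Rightarrow> 'b::real_inner \<Rightarrow> real) \<Rightarrow> 'b^'a \<Rightarrow> 'b^'a" where
  "grad_stack f Z = (\<chi> i. gradient (f i) (Z $ i))"

definition suda_rec ::
  "real^'a^'a \<Rightarrow> real^'a^'a \<Rightarrow> real^'a^'a \<Rightarrow> real \<Rightarrow> (nat \<Rightarrow> ('b::real_vector)^'a) \<Rightarrow>
   (nat \<Rightarrow> 'b^'a) \<Rightarrow> (nat \<Rightarrow> 'b^'a) \<Rightarrow> bool" where
  "suda_rec A B C \<alpha> U X Y \<longleftrightarrow>
     Y 0 = 0 \<and>
     (\<forall>k. X (Suc k) = act A (act C (X k) - \<alpha> *\<^sub>R U (Suc k)) - act B (Y k)) \<and>
     (\<forall>k. Y (Suc k) = Y k + act B (X (Suc k)))"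

text \<open>
  The block matrix with rows \<open>[\<Lambda>\<^sub>a\<Lambda>\<^sub>c - \<Lambda>\<^sub>b\<^sup>2, -I]\<close> and \<open>[\<Lambda>\<^sub>b\<^sup>2, I]\<close>; \<open>Inl\<close> and \<open>Inr\<close> index the
  first and the second block, and \<open>lb2\<close> is the diagonal of \<open>\<Lambda>\<^sub>b\<^sup>2\<close>.
\<close>

fun suda_dev_mat ::
  "('a \<Rightarrow> real) \<Rightarrow> ('a \<Rightarrow> real) \<Rightarrow> ('a \<Rightarrow> real) \<Rightarrow> 'a + 'a \<Rightarrow> 'a + 'a \<Rightarrow> real" where
  "suda_dev_mat la lc lb2 (Inl i) (Inl j) = (if i = j then la i * lc i - lb2 i else 0)"
| "suda_dev_mat la lc lb2 (Inl i) (Inr j) = (if i = j then - 1 else 0)"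
| "suda_dev_mat la lc lb2 (Inr i) (Inl j) = (if i = j then lb2 i else 0)"
| "suda_dev_mat la lc lb2 (Inr i) (Inr j) = (if i = j then 1 else 0)"

text \<open>
  The index \<open>o1\<close> plays the role of the first column of \<open>Q\<close>. The hatted diagonal blocks are the
  restrictions to the remaining indices, so the deviation matrix is taken on
  \<open>(- {o1}) <+> (- {o1})\<close>.
\<close>

definition suda_stable ::
  "real^'a^'a \<Rightarrow> real^'a^'a \<Rightarrow> real^'a^'a \<Rightarrow> real^'a^'a \<Rightarrow> bool" where
  "suda_stable W A B C \<longleftrightarrow>
     (\<exists>(Q :: real^'a^'a) o1 l la lc lb2.
        orthogonal_matrix Q \<and> (\<forall>i. Q $ i $ o1 = 1 / sqrt (real CARD('a))) \<and>
        l o1 = 1 \<and> W = Q ** diag_mat l ** transpose Q \<and>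
        la o1 = 1 \<and> A = Q ** diag_mat la ** transpose Q \<and>
        lc o1 = 1 \<and> C = Q ** diag_mat lc ** transpose Q \<and>
        lb2 o1 = 0 \<and> B ** B = Q ** diag_mat lb2 ** transpose Q \<and>
        (\<forall>\<mu>. eigenvalue_on ((- {o1}) <+> (- {o1})) (suda_dev_mat la lc lb2) \<mu> \<longrightarrow> cmod \<mu> < 1))"

text \<open>The first argument only fixes the type \<open>'b\<close> of the blocks.\<close>

definition suda_constants ::
  "'b::real_normed_vector itself \<Rightarrow> real^'a^'a \<Rightarrow> real^'a^'a \<Rightarrow> real^'a^'a \<Rightarrow>
   real \<Rightarrow> real \<Rightarrow> real \<Rightarrow> real \<Rightarrow> bool" where
  "suda_constants _ A B C \<gamma> v1 v2 la \<longleftrightarrow>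
     0 < \<gamma> \<and> \<gamma> < 1 \<and> 1 \<le> v1 \<and> 1 \<le> v2 \<and> 0 \<le> la \<and>
     (\<forall>\<alpha>>0. \<forall>(U :: nat \<Rightarrow> 'b^'a) X Y. suda_rec A B C \<alpha> U X Y \<longrightarrow>
        (\<forall>k. norm (dev (X k)) \<le>
               v1 * v2 * \<gamma> ^ k * (1 + op_norm (B ** B)) * norm (dev (X 0)) +
               \<alpha> * v1 * v2 * la / (1 - \<gamma>) * (SUP t\<in>{..k}. norm (dev (U (Suc t))))))"

definition suda_muon ::
  "real^'a^'a \<Rightarrow> real^'a^'a \<Rightarrow> real^'a^'a \<Rightarrow> real^'a^'a \<Rightarrow> real \<Rightarrow> real \<Rightarrow> real^'n^'m^'a \<Rightarrow>
   (nat \<Rightarrow> real^'n^'m^'a) \<Rightarrow> (nat \<Rightarrow> real^'n^'m^'a) \<Rightarrow> (nat \<Rightarrow> real^'n^'m^'a) \<Rightarrow>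
   (nat \<Rightarrow> real^'n^'m^'a) \<Rightarrow> (nat \<Rightarrow> real^'n^'m^'a) \<Rightarrow> bool" where
  "suda_muon W A B C \<alpha> \<beta> X0 G M H X Y \<longleftrightarrow>
     X 0 = X0 \<and> M 0 = G 0 \<and> H 0 = M 0 \<and>
     (\<forall>k. M (Suc k) = \<beta> *\<^sub>R M k + (1 - \<beta>) *\<^sub>R G k) \<and>
     (\<forall>k. H (Suc k) = act W (H k + M (Suc k) - M k)) \<and>
     suda_rec A B C \<alpha> (\<lambda>k. msgn_stack (H k)) X Y"

text \<open>
  \<open>X 0\<close> is deterministic and \<open>X k\<close> is formed from \<open>G 0, ..., G (k - 1)\<close>, so this is the natural
  filtration at step \<open>k\<close>; it is trivial for \<open>k = 0\<close>.
\<close>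

definition nat_filt ::
  "'w measure \<Rightarrow> (nat \<Rightarrow> 'w \<Rightarrow> 'c::topological_space) \<Rightarrow> nat \<Rightarrow> 'w measure" where
  "nat_filt P G k = sigma (space P) {G j -` S \<inter> space P | j S. j < k \<and> S \<in> sets borel}"

text \<open>
  Conditional independence of a finite family, factorising conditional probabilities of
  measurable rectangles; subfamilies are covered by taking some of the \<open>S i\<close> to be \<open>UNIV\<close>.
\<close>

definition cond_indep_vars ::
  "'w measure \<Rightarrow> 'w measure \<Rightarrow> 'i set \<Rightarrow> ('i \<Rightarrow> 'w \<Rightarrow> 'c::topological_space) \<Rightarrow> bool" where
  "cond_indep_vars P F I Z \<longleftrightarrow>
     (\<forall>S. (\<forall>i\<in>I. S i \<in> sets borel) \<longrightarrow>
        (AE \<omega> in P.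
           real_cond_exp P F (indicator {\<omega> \<in> space P. \<forall>i\<in>I. Z i \<omega> \<in> S i}) \<omega> =
           (\<Prod>i\<in>I. real_cond_exp P F (indicator {\<omega> \<in> space P. Z i \<omega> \<in> S i}) \<omega>)))"

text \<open>
  The conditional mean is taken entrywise. The conditional variance is the \<open>ennreal\<close>-valued
  conditional expectation, so that the bound includes its finiteness. Conditional independence
  across agents and time given the history up to step \<open>k\<close> concerns the gradients drawn up to and
  including step \<open>k\<close>.
\<close>

definition stochastic_oracle ::
  "'w measure \<Rightarrow> ('a \<Rightarrow> real^'n^'m \<Rightarrow> real) \<Rightarrow> real \<Rightarrow> (nat \<Rightarrow> 'w \<Rightarrow> real^'n^'m^'a) \<Rightarrow>
   (nat \<Rightarrow> 'w \<Rightarrow> real^'n^'m^'a) \<Rightarrow> bool" where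
  "stochastic_oracle P f \<sigma> X G \<longleftrightarrow>
     prob_space P \<and>
     (\<forall>k. integrable P (G k)) \<and>
     (\<forall>k i a b. AE \<omega> in P.
        real_cond_exp P (nat_filt P G k) (\<lambda>\<omega>. G k \<omega> $ i $ a $ b) \<omega> =
        gradient (f i) (X k \<omega> $ i) $ a $ b) \<and>
     (\<forall>k i. AE \<omega> in P.
        nn_cond_exp P (nat_filt P G k)
          (\<lambda>\<omega>. ennreal ((norm (G k \<omega> $ i - gradient (f i) (X k \<omega> $ i)))\<^sup>2)) \<omega> \<le> ennreal (\<sigma>\<^sup>2)) \<and>
     (\<forall>k. cond_indep_vars P (nat_filt P G k) (UNIV \<times> {..k}) (\<lambda>(i, t) \<omega>. G t \<omega> $ i))"

text \<open>The run with horizon \<open>K\<close>: stepsize \<open>\<alpha>\<^sub>0 K\<^bsup>-3/4\<^esup>\<close> and \<open>1 - \<beta> = b\<^sub>0 / \<surd>K\<close>.\<close>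

definition suda_muon_run ::
  "real^'a^'a \<Rightarrow> real^'a^'a \<Rightarrow> real^'a^'a \<Rightarrow> real^'a^'a \<Rightarrow> ('a \<Rightarrow> real^'n^'m \<Rightarrow> real) \<Rightarrow> real \<Rightarrow>
   real \<Rightarrow> real \<Rightarrow> real^'n^'m^'a \<Rightarrow> nat \<Rightarrow> 'w measure \<Rightarrow>
   (nat \<Rightarrow> 'w \<Rightarrow> real^'n^'m^'a) \<Rightarrow> (nat \<Rightarrow> 'w \<Rightarrow> real^'n^'m^'a) \<Rightarrow> (nat \<Rightarrow> 'w \<Rightarrow> real^'n^'m^'a) \<Rightarrow>
   (nat \<Rightarrow> 'w \<Rightarrow> real^'n^'m^'a) \<Rightarrow> (nat \<Rightarrow> 'w \<Rightarrow> real^'n^'m^'a) \<Rightarrow> bool" where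
  "suda_muon_run W A B C f \<sigma> \<alpha>0 b0 X0 K P G M H X Y \<longleftrightarrow>
     (\<forall>\<omega>. suda_muon W A B C (\<alpha>0 / real K powr (3/4)) (1 - b0 / sqrt (real K)) X0
        (\<lambda>k. G k \<omega>) (\<lambda>k. M k \<omega>) (\<lambda>k. H k \<omega>) (\<lambda>k. X k \<omega>) (\<lambda>k. Y k \<omega>)) \<and>
     stochastic_oracle P f \<sigma> X G"

definition avg_grad_norm ::
  "('a::finite \<Rightarrow> real^'n^'m \<Rightarrow> real) \<Rightarrow> nat \<Rightarrow> 'w measure \<Rightarrow> (nat \<Rightarrow> 'w \<Rightarrow> real^'n^'m^'a) \<Rightarrow> real" where
  "avg_grad_norm f K P X =
     1 / real K * (\<Sum>k<K. \<integral>\<omega>. nuclear_norm (gradient (avg_fun f) (mean (X k \<omega>))) \<partial>P)"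

end

theory Submission
  imports Defs
begin

text \<open>
  Since the two norms are dual, \<open>\<langle>H, msgn H\<rangle> = \<parallel>H\<parallel>\<^sub>*\<close> and the descent lemma along \<open>mean (msgn H)\<close> bounds the sum of
  \<open>\<parallel>\<nabla>f(mean X)\<parallel>\<^sub>*\<close> by the tracking error \<open>mean M - \<nabla>f(mean X)\<close> and the disagreement \<open>dev H\<close>. In both, the
  moving average of the gradient noise is split off: what remains obeys a scalar contraction whose
  inputs are bounded by the SUDA constants, while the noise average has orthogonal increments, so its
  second moment is at most \<open>(1 - \<beta>)\<close> times that of the noise. Borel measurability of \<open>msgn\<close>, needed
  for \<open>X\<close> to be adapted, holds because \<open>msgn H\<close> is the limit of the projections of \<open>k H\<close> onto the
  unit ball of the operator norm.
\<close>

section \<open>Singular value decomposition\<close>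

text \<open>\<open>msgn\<close> is not linear, so the expected direction says nothing about the
  gradient: the descent estimate has to hold on each sample path, and expectations are taken only
  once everything is affine in norms. Averaged over the horizon K, three errors compete: the
  function gap \<open>\<Delta>0 / (\<alpha> K)\<close>, the lag
  \<open>L \<alpha> / (1 - \<beta>)\<close> of the momentum behind a moving iterate, and the
  averaged noise \<open>\<sigma> sqrt ((1 - \<beta>) / N)\<close>. With \<alpha> of order K^(-3/4)
  and 1 - \<beta> of order K^(-1/2) all three are of order K^(-1/4), the leading rate; the
  disagreement terms are of lower order. The factor 1/N in the noise needs different agents to be
  uncorrelated, which has to be extracted from a factorisation of conditional probabilities of
  events. Two further facts are not given directly. The mean iterate moves by the mean sign alone
  only if the columns of \<open>B\<close> sum to zero, although \<open>B\<close> is described just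
  by its kernel and its square. And no moment bound on the gradients is assumed: their integrability
  comes from the boundedness of \<open>msgn\<close>, which confines each iterate to a ball fixed in
  advance.\<close>

lemma outer_prod_inner: "outer_prod u v \<bullet> (Z :: real^'n^'m) = u \<bullet> (Z *v v)"
  by (simp add: outer_prod_def inner_vec_def matrix_vector_mult_def sum_distrib_left mult_ac)

lemma outer_prod_mult_vec: "outer_prod u v *v x = (v \<bullet> x) *\<^sub>R (u :: real^'m)" for v x :: "real^'n"
  by (simp add: vec_eq_iff outer_prod_def inner_vec_def matrix_vector_mult_def sum_distrib_left mult_ac)

lemma sum_mult_vec: "(\<Sum>i\<in>I. F i) *v x = (\<Sum>i\<in>I. F i *v x)" for F :: "'i \<Rightarrow> real^'n^'m"
  by (induction I rule: infinite_finite_induct) (auto simp: matrix_vector_mult_add_rdistrib)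

definition orthonormal_fam :: "nat \<Rightarrow> (nat \<Rightarrow> 'b::real_inner) \<Rightarrow> bool" where
  "orthonormal_fam r v \<longleftrightarrow> (\<forall>i<r. \<forall>j<r. v i \<bullet> v j = (if i = j then 1 else 0))"

lemma reduced_svd_iff:
  "reduced_svd H r u s v \<longleftrightarrow> orthonormal_fam r u \<and> orthonormal_fam r v \<and> (\<forall>i<r. 0 < s i) \<and>
     H = (\<Sum>i<r. s i *\<^sub>R outer_prod (u i) (v i))"
  by (simp add: reduced_svd_def orthonormal_fam_def)

lemma orthonormal_fam_card:
  fixes v :: "nat \<Rightarrow> 'b::euclidean_space"
  assumes "orthonormal_fam r v" shows "r \<le> DIM('b)"
proof -
  have o: "\<And>i j. i < r \<Longrightarrow> j < r \<Longrightarrow> v i \<bullet> v j = (if i = j then 1 else 0)"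
    using assms by (simp add: orthonormal_fam_def)
  have inj: "inj_on v {..<r}"
    by (rule inj_onI) (metis o lessThan_iff zero_neq_one)
  have "pairwise orthogonal (v ` {..<r})"
    unfolding pairwise_def orthogonal_def using o by (metis (no_types, lifting) imageE lessThan_iff)
  moreover have "0 \<notin> v ` {..<r}" using o by (metis imageE inner_zero_left lessThan_iff zero_neq_one)
  ultimately have "independent (v ` {..<r})" by (rule pairwise_orthogonal_independent)
  then have "card (v ` {..<r}) \<le> DIM('b)" by (simp add: independent_bound)
  then show ?thesis by (simp add: card_image inj)
qed

lemma bessel:
  fixes v :: "nat \<Rightarrow> 'b::real_inner"
  assumes "orthonormal_fam r v"
  shows "(\<Sum>i<r. (v i \<bullet> x)\<^sup>2) \<le> (norm x)\<^sup>2"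
proof -
  have o: "\<And>i j. i < r \<Longrightarrow> j < r \<Longrightarrow> v i \<bullet> v j = (if i = j then 1 else 0)"
    using assms by (simp add: orthonormal_fam_def)
  let ?p = "\<Sum>i<r. (v i \<bullet> x) *\<^sub>R v i"
  have px: "?p \<bullet> x = (\<Sum>i<r. (v i \<bullet> x)\<^sup>2)"
    by (simp add: inner_sum_left power2_eq_square)
  have pv: "?p \<bullet> v j = v j \<bullet> x" if "j < r" for j
  proof -
    have "?p \<bullet> v j = (\<Sum>i<r. (v i \<bullet> x) * (if i = j then 1 else 0))"
      unfolding inner_sum_left by (intro sum.cong) (use that o in auto)
    also have "\<dots> = (\<Sum>i<r. if i = j then v j \<bullet> x else 0)" by (intro sum.cong) auto
    finally show ?thesis using that by simp
  qed
  have pp: "?p \<bullet> ?p = (\<Sum>i<r. (v i \<bullet> x)\<^sup>2)"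
    by (subst inner_sum_right) (simp add: pv power2_eq_square)
  have "0 \<le> (x - ?p) \<bullet> (x - ?p)" by simp
  also have "\<dots> = x \<bullet> x - 2 * (?p \<bullet> x) + ?p \<bullet> ?p"
    by (simp add: inner_diff_left inner_diff_right inner_commute)
  finally show ?thesis unfolding px pp by (simp add: power2_norm_eq_inner)
qed

lemma inner_mult_vec_le:
  "u \<bullet> (Z *v v) \<le> op_norm Z * norm u * norm v" for Z :: "real^'n^'m"
proof -
  have "u \<bullet> (Z *v v) \<le> norm u * norm (Z *v v)" by (rule norm_cauchy_schwarz)
  also have "\<dots> \<le> norm u * (op_norm Z * norm v)"
    by (intro mult_left_mono onorm matrix_vector_mul_bounded_linear) auto
  finally show ?thesis by (simp add: mult_ac)
qed

lemma op_norm_leI: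
  fixes Z :: "real^'n^'m"
  assumes "\<And>x y. y \<bullet> (Z *v x) \<le> b * norm y * norm x"
  shows "op_norm Z \<le> b"
proof (rule onorm_le)
  fix x
  have "norm (Z *v x) * norm (Z *v x) \<le> norm (Z *v x) * (b * norm x)"
    using assms[of "Z *v x" x] by (simp add: dot_square_norm power2_eq_square mult_ac)
  \<comment> \<open>The sign of \<open>b\<close> is not given. If \<open>Z *v x = 0\<close>, testing
    with the unit vector \<open>axis undefined 1\<close> still yields
    \<open>0 \<le> b * norm x\<close>; otherwise one factor cancels.\<close>
  then show "norm (Z *v x) \<le> b * norm x"
    by (cases "Z *v x = 0") (use assms[of "Z *v x" x] assms[of "axis undefined 1" x] in \<open>auto\<close>)
qed

text \<open>The bilinear form of this matrix pairs the coordinates of its two arguments along the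
  frames, so Cauchy-Schwarz followed by Bessel in each frame bounds it by the product of the
  norms.\<close>

lemma svd_frame_op_norm_le:
  fixes u :: "nat \<Rightarrow> real^'m" and v :: "nat \<Rightarrow> real^'n"
  assumes "orthonormal_fam r u" "orthonormal_fam r v"
  shows "op_norm (\<Sum>i<r. outer_prod (u i) (v i)) \<le> 1"
proof (rule op_norm_leI)
  fix x :: "real^'n" and y :: "real^'m"
  have "y \<bullet> ((\<Sum>i<r. outer_prod (u i) (v i)) *v x) = (\<Sum>i<r. (u i \<bullet> y) * (v i \<bullet> x))"
    by (simp add: sum_mult_vec outer_prod_mult_vec inner_sum_right inner_commute mult.commute)
  also have "\<dots> \<le> sqrt ((\<Sum>i<r. (u i \<bullet> y)\<^sup>2) * (\<Sum>i<r. (v i \<bullet> x)\<^sup>2))"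
    by (rule real_le_rsqrt[OF Cauchy_Schwarz_ineq_sum])
  also have "\<dots> \<le> sqrt ((norm y)\<^sup>2 * (norm x)\<^sup>2)"
    by (intro real_sqrt_le_mono mult_mono bessel assms sum_nonneg) auto
  also have "\<dots> = 1 * norm y * norm x" by (simp add: real_sqrt_mult)
  finally show "y \<bullet> ((\<Sum>i<r. outer_prod (u i) (v i)) *v x) \<le> 1 * norm y * norm x" .
qed

text \<open>Maximise \<open>u \<bullet> (R *v v)\<close> over pairs of unit vectors; compactness
  gives a maximiser, and \<open>s\<close> is the maximum. Testing the normalised
  \<open>R *v v\<close> against \<open>v\<close> shows that its norm is at most \<open>s\<close>,
  while its inner product with \<open>u\<close> equals \<open>s\<close>: the equality case of
  Cauchy-Schwarz makes the two parallel. The transpose is treated in the same way.\<close>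

lemma top_singular_pair:
  fixes R :: "real^'n^'m"
  assumes "R \<noteq> 0"
  obtains u v s where "s > 0" "norm u = 1" "norm v = 1" "R *v v = s *\<^sub>R u"
    "transpose R *v u = s *\<^sub>R v"
proof -
  let ?S = "sphere (0::real^'m) 1 \<times> sphere (0::real^'n) 1"
  let ?q = "\<lambda>(u, v). u \<bullet> (R *v v)"
  have "compact ?S" by (intro compact_Times compact_sphere)
  moreover have "?S \<noteq> {}" by simp
  moreover have "continuous_on ?S ?q"
    unfolding case_prod_beta
    by (intro continuous_intros bounded_linear.continuous_on[OF matrix_vector_mul_bounded_linear])
  ultimately obtain p where p: "p \<in> ?S" "\<And>q. q \<in> ?S \<Longrightarrow> ?q q \<le> ?q p"
    using continuous_attains_sup[of ?S ?q] by blast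
  obtain u v where uv: "p = (u, v)" by fastforce
  define s where "s = u \<bullet> (R *v v)"
  have n: "norm u = 1" "norm v = 1" using p(1) uv by auto
  have le: "x \<bullet> (R *v y) \<le> s" if "norm x = 1" "norm y = 1" for x y
    using p(2)[of "(x, y)"] that uv by (simp add: s_def)
  have scale: "(x /\<^sub>R norm x) \<bullet> (R *v (y /\<^sub>R norm y)) = x \<bullet> (R *v y) / (norm x * norm y)" for x y
    by (simp add: matrix_vector_mult_scaleR divide_inverse mult_ac)
  have tr: "(transpose R *v x) \<bullet> y = x \<bullet> (R *v y)" for x y
    by (metis dot_lmul_matrix transpose_matrix_vector)
  obtain y where y: "R *v y \<noteq> 0" using assms matrix_eq[of R 0] by auto
  then have y0: "y \<noteq> 0" by auto
  have "0 < (R *v y) \<bullet> (R *v y) / (norm (R *v y) * norm y)" using y y0 by simp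
  also have "\<dots> \<le> s" unfolding scale[symmetric] by (rule le) (use y y0 in auto)
  finally have s: "s > 0" .
  have a: "norm (R *v v) \<le> s"
  proof (cases "R *v v = 0")
    case False
    have "(R *v v) \<bullet> (R *v v) / (norm (R *v v) * norm v) \<le> s"
      unfolding scale[symmetric] by (rule le) (use n False in auto)
    then show ?thesis using False n by (simp add: dot_square_norm power2_eq_square)
  qed (use s in auto)
  have b: "norm (transpose R *v u) \<le> s"
  proof (cases "transpose R *v u = 0")
    case False
    let ?w = "transpose R *v u"
    have "u \<bullet> (R *v ?w) / (norm u * norm ?w) \<le> s"
      unfolding scale[symmetric] by (rule le) (use n False in auto)
    then show ?thesis using False n unfolding tr[symmetric] by (simp add: dot_square_norm power2_eq_square)
  qed (use s in auto)
  have eq: "w = s *\<^sub>R z" if "norm w \<le> s" "norm z = 1" "w \<bullet> z = s" for w z :: "'b::real_inner"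
  proof -
    have "(norm w)\<^sup>2 \<le> s\<^sup>2" using that s by simp
    have "z \<bullet> z = 1" using that by (simp add: norm_eq_1)
    then have "(norm (w - s *\<^sub>R z))\<^sup>2 = (norm w)\<^sup>2 - 2 * s * (w \<bullet> z) + s * s"
      by (simp add: power2_norm_eq_inner inner_diff_left inner_diff_right inner_commute)
    also have "\<dots> \<le> 0" using that \<open>(norm w)\<^sup>2 \<le> s\<^sup>2\<close> by (simp add: power2_eq_square)
    finally show ?thesis by simp
  qed
  have "R *v v = s *\<^sub>R u" by (rule eq[OF a n(1)]) (simp add: s_def inner_commute)
  moreover have "transpose R *v u = s *\<^sub>R v" by (rule eq[OF b n(2)]) (simp only: s_def tr)
  ultimately show ?thesis using that s n by blast
qed

text \<open>Singular triples are split off greedily. The predicate \<open>P k\<close> asks for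
  \<open>k\<close> triples whose remainder \<open>R\<close> vanishes on both frames;
  \<open>k\<close> is bounded by the dimension, so a maximal one exists, and a nonzero remainder
  would supply one more triple through \<open>top_singular_pair\<close>. Vanishing of
  \<open>R\<close> on the old frames is what makes the new vectors orthogonal to them.\<close>

lemma reduced_svd_exists:
  fixes H :: "real^'n^'m"
  obtains r u s v where "reduced_svd H r u s v"
proof -
  define P where "P = (\<lambda>k. \<exists>u s v R. orthonormal_fam k u \<and> orthonormal_fam k v \<and> (\<forall>i<k. 0 < s i) \<and>
     H = (\<Sum>i<k. s i *\<^sub>R outer_prod (u i) (v i)) + R \<and>
     (\<forall>i<k. R *v v i = 0 \<and> transpose R *v u i = 0))"
  have bound: "k \<le> CARD('n)" if "P k" for k
    using that orthonormal_fam_card[where 'b = "real^'n"] unfolding P_def by auto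
  have "P 0" unfolding P_def by (auto simp: orthonormal_fam_def)
  with bound obtain k where k: "P k" "\<And>j. P j \<Longrightarrow> j \<le> k"
    using Greatest_le_nat[of P _ "CARD('n)"] GreatestI_nat[of P 0 "CARD('n)"] by blast
  then obtain u s v R where h: "orthonormal_fam k u" "orthonormal_fam k v" "\<forall>i<k. 0 < s i"
    "H = (\<Sum>i<k. s i *\<^sub>R outer_prod (u i) (v i)) + R"
    "\<forall>i<k. R *v v i = 0 \<and> transpose R *v u i = 0" unfolding P_def by blast
  have "R = 0"
  proof (rule ccontr)
    assume "R \<noteq> 0"
    then obtain u' v' s' where t: "s' > 0" "norm u' = 1" "norm v' = 1" "R *v v' = s' *\<^sub>R u'"
      "transpose R *v u' = s' *\<^sub>R v'" by (rule top_singular_pair)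
    have tr: "(transpose R *v x) \<bullet> y = x \<bullet> (R *v y)" for x y
      by (metis dot_lmul_matrix transpose_matrix_vector)
    have ou: "u i \<bullet> u' = 0" if "i < k" for i
    proof -
      have "s' * (u i \<bullet> u') = (transpose R *v u i) \<bullet> v'" unfolding tr t(4) by simp
      then show ?thesis using h(5) that t(1) by simp
    qed
    have ov: "v i \<bullet> v' = 0" if "i < k" for i
    proof -
      have "s' * (v' \<bullet> v i) = (transpose R *v u') \<bullet> v i" unfolding t(5) by simp
      then show ?thesis using h(5) that t(1) unfolding tr by (simp add: inner_commute)
    qed
    have "P (Suc k)" unfolding P_def
    proof (intro exI conjI)
      show "orthonormal_fam (Suc k) (u(k := u'))" "orthonormal_fam (Suc k) (v(k := v'))"
        using h(1,2) ou ov t(2,3) unfolding orthonormal_fam_def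
        by (auto simp: less_Suc_eq norm_eq_1 inner_commute)
      show "\<forall>i<Suc k. 0 < (s(k := s')) i" using h(3) t(1) by (auto simp: less_Suc_eq)
      have "(\<Sum>i<k. (s(k := s')) i *\<^sub>R outer_prod ((u(k := u')) i) ((v(k := v')) i)) =
        (\<Sum>i<k. s i *\<^sub>R outer_prod (u i) (v i))" by (intro sum.cong) auto
      then show "H = (\<Sum>i<Suc k. (s(k := s')) i *\<^sub>R outer_prod ((u(k := u')) i) ((v(k := v')) i)) +
          (R - s' *\<^sub>R outer_prod u' v')"
        using h(4) by simp
      have sm: "(c *\<^sub>R F) *v x = c *\<^sub>R (F *v x)" for c :: real and F :: "real^'p^'q" and x
        by (simp add: scaleR_matrix_vector_assoc)
      have td: "transpose (R - s' *\<^sub>R outer_prod u' v') = transpose R - s' *\<^sub>R outer_prod v' u'"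
        by (simp add: transpose_def vec_eq_iff outer_prod_def mult_ac)
      show "\<forall>i<Suc k. (R - s' *\<^sub>R outer_prod u' v') *v (v(k := v')) i = 0 \<and>
          transpose (R - s' *\<^sub>R outer_prod u' v') *v (u(k := u')) i = 0"
        unfolding td using h(5) t ou ov
        by (auto simp: less_Suc_eq matrix_vector_mult_diff_rdistrib sm outer_prod_mult_vec inner_commute
            norm_eq_1)
    qed
    then show False using k(2) by fastforce
  qed
  then show ?thesis using that h by (auto simp: reduced_svd_iff)
qed

section \<open>The matrix sign and the nuclear norm\<close>

definition op_ball :: "(real^'n^'m) set" where
  "op_ball = {Z. op_norm Z \<le> 1}"

lemma op_norm_le_iff:
  fixes Z :: "real^'n^'m"
  shows "op_norm Z \<le> b \<longleftrightarrow> (\<forall>x y. y \<bullet> (Z *v x) \<le> b * norm y * norm x)"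
proof (intro iffI allI)
  fix x :: "real^'n" and y :: "real^'m" assume "op_norm Z \<le> b"
  then have "op_norm Z * norm y * norm x \<le> b * norm y * norm x"
    by (intro mult_right_mono) auto
  then show "y \<bullet> (Z *v x) \<le> b * norm y * norm x" using inner_mult_vec_le[of y Z x] by linarith
qed (rule op_norm_leI, simp)

text \<open>Written as an intersection of half-spaces, the ball is visibly convex and closed, the
  two properties that the projection needs.\<close>

lemma op_ball_eq: "(op_ball :: (real^'n^'m) set) = (\<Inter>x y. {Z. outer_prod y x \<bullet> Z \<le> norm y * norm x})"
proof -
  have "Z \<in> op_ball \<longleftrightarrow> (\<forall>x y. outer_prod y x \<bullet> Z \<le> norm y * norm x)" for Z :: "real^'n^'m"
    unfolding op_ball_def mem_Collect_eq op_norm_le_iff outer_prod_inner by simp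
  then show ?thesis by blast
qed

lemma convex_op_ball: "convex (op_ball :: (real^'n^'m) set)"
  unfolding op_ball_eq by (intro convex_INT convex_halfspace_le)

lemma closed_op_ball: "closed (op_ball :: (real^'n^'m) set)"
  unfolding op_ball_eq by (intro closed_INT ballI closed_halfspace_le)

text \<open>
  On \<open>op_ball\<close> the inner products with \<open>u\<^sub>i v\<^sub>i\<^sup>T\<close> are at most \<open>1\<close>, with equality at
  \<open>D = \<Sum> u\<^sub>i v\<^sub>i\<^sup>T\<close>; so \<open>D\<close> is the projection of \<open>c H\<close> as soon as all \<open>c s\<^sub>i \<ge> 1\<close>.
\<close>

lemma svd_frame_inner_le:
  assumes "orthonormal_fam r u" "orthonormal_fam r v" "i < r" "Z \<in> op_ball"
  shows "outer_prod (u i) (v i) \<bullet> Z \<le> 1"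
proof -
  have "norm (u i) = 1" "norm (v i) = 1"
    using assms(1-3) by (auto simp: orthonormal_fam_def norm_eq_1)
  then show ?thesis using assms(4) inner_mult_vec_le[of "u i" Z "v i"]
    by (simp add: outer_prod_inner op_ball_def)
qed

lemma outer_prod_inner_outer_prod:
  "outer_prod u v \<bullet> outer_prod u' v' = (u \<bullet> u') * (v \<bullet> v')" for u u' :: "real^'m" and v v' :: "real^'n"
  by (simp add: outer_prod_inner outer_prod_mult_vec inner_commute)

lemma norm_outer_prod: "norm (outer_prod u v) = norm u * norm v" for u :: "real^'m" and v :: "real^'n"
  by (simp only: norm_eq_sqrt_inner outer_prod_inner_outer_prod real_sqrt_mult)

lemma svd_frame_inner_sum:
  fixes u :: "nat \<Rightarrow> real^'m" and v :: "nat \<Rightarrow> real^'n"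
  assumes "orthonormal_fam r u" "orthonormal_fam r v" "i < r"
  shows "outer_prod (u i) (v i) \<bullet> (\<Sum>j<r. c j *\<^sub>R outer_prod (u j) (v j)) = c i"
proof -
  have "outer_prod (u i) (v i) \<bullet> (\<Sum>j<r. c j *\<^sub>R outer_prod (u j) (v j)) = (\<Sum>j<r. if j = i then c i else 0)"
    unfolding inner_sum_right inner_scaleR_right outer_prod_inner_outer_prod
    using assms by (intro sum.cong) (auto simp: orthonormal_fam_def)
  then show ?thesis using assms by simp
qed

text \<open>The obtuse-angle criterion: expanding the square leaves a cross term of favourable sign,
  so \<open>p\<close> is at least as close to \<open>a\<close> as any \<open>z\<close>, and closest
  points of a closed convex set are unique.\<close>

lemma closest_point_eqI:
  fixes a :: "'b::euclidean_space"
  assumes "convex S" "closed S" "p \<in> S" "\<And>z. z \<in> S \<Longrightarrow> (a - p) \<bullet> (z - p) \<le> 0"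
  shows "closest_point S a = p"
proof (rule closest_point_unique[OF assms(1-3), symmetric], rule ballI)
  fix z assume "z \<in> S"
  have "a - z = (a - p) - (z - p)" by simp
  then have eq: "(norm (a - z))\<^sup>2 = (norm (a - p))\<^sup>2 - 2 * ((a - p) \<bullet> (z - p)) + (norm (z - p))\<^sup>2"
    by (simp only: power2_norm_eq_inner inner_diff_left inner_diff_right) (simp add: inner_commute)
  have "(norm (a - p))\<^sup>2 \<le> (norm (a - z))\<^sup>2"
    using assms(4)[OF \<open>z \<in> S\<close>] zero_le_power2[of "norm (z - p)"] unfolding eq by linarith
  then show "dist a p \<le> dist a z" by (simp add: dist_norm)
qed

lemma svd_frame_eq_closest_point:
  fixes H :: "real^'n^'m"
  assumes svd: "reduced_svd H r u s v" and c: "\<forall>i<r. 1 \<le> c * s i"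
  shows "closest_point op_ball (c *\<^sub>R H) = (\<Sum>i<r. outer_prod (u i) (v i))" (is "_ = ?D")
proof (rule closest_point_eqI[OF convex_op_ball closed_op_ball])
  note o = svd[unfolded reduced_svd_iff]
  show "?D \<in> op_ball" using o svd_frame_op_norm_le by (auto simp: op_ball_def)
  fix Z :: "real^'n^'m" assume Z: "Z \<in> op_ball"
  have eq: "c *\<^sub>R H - ?D = (\<Sum>i<r. (c * s i - 1) *\<^sub>R outer_prod (u i) (v i))"
    using o by (simp add: scaleR_sum_right algebra_simps sum_subtractf)
  have "(c *\<^sub>R H - ?D) \<bullet> (Z - ?D) =
      (\<Sum>i<r. (c * s i - 1) * (outer_prod (u i) (v i) \<bullet> Z - outer_prod (u i) (v i) \<bullet> ?D))"
    unfolding eq by (simp only: inner_sum_left inner_scaleR_left inner_diff_right right_diff_distrib sum_subtractf)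
  also have "\<dots> \<le> 0"
  proof (rule sum_nonpos)
    fix i assume i: "i \<in> {..<r}"
    have "outer_prod (u i) (v i) \<bullet> ?D = 1"
      using svd_frame_inner_sum[of r u v i "\<lambda>_. 1"] o i by simp
    moreover have "outer_prod (u i) (v i) \<bullet> Z \<le> 1"
      using svd_frame_inner_le[of r u v i Z] o i Z by auto
    ultimately show "(c * s i - 1) * (outer_prod (u i) (v i) \<bullet> Z - outer_prod (u i) (v i) \<bullet> ?D) \<le> 0"
      using c i by (intro mult_nonneg_nonpos) auto
  qed
  finally show "(c *\<^sub>R H - ?D) \<bullet> (Z - ?D) \<le> 0" .
qed

lemma svd_frame_eventually_closest_point:
  fixes H :: "real^'n^'m"
  assumes svd: "reduced_svd H r u s v"
  shows "\<forall>\<^sub>F k in sequentially. closest_point op_ball (real k *\<^sub>R H) = (\<Sum>i<r. outer_prod (u i) (v i))"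
proof -
  have "\<forall>\<^sub>F k in sequentially. \<forall>i\<in>{..<r}. 1 \<le> real k * s i"
  proof (rule eventually_ball_finite; clarsimp)
    fix i assume "i < r"
    then have "0 < s i" using svd by (simp add: reduced_svd_iff)
    moreover obtain k0 :: nat where "1 / s i \<le> real k0" using real_arch_simple by blast
    ultimately have "1 \<le> real k0 * s i" "0 \<le> s i" by (auto simp: pos_divide_le_eq)
    then have "1 \<le> real k * s i" if "k0 \<le> k" for k
      using that by (intro order_trans[OF \<open>1 \<le> real k0 * s i\<close> mult_right_mono]) auto
    then show "\<forall>\<^sub>F k in sequentially. 1 \<le> real k * s i" by (rule eventually_sequentiallyI)
  qed
  then show ?thesis
    by (rule eventually_mono) (simp add: svd_frame_eq_closest_point[OF svd])
qed

text \<open>Both frames eventually equal the same projections of \<open>k H\<close>, in which no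
  decomposition occurs. This makes the definite description in \<open>msgn\<close> meaningful
  without a comparison of singular spaces.\<close>

lemma svd_frame_unique:
  fixes H :: "real^'n^'m"
  assumes "reduced_svd H r u s v" "reduced_svd H r' u' s' v'"
  shows "(\<Sum>i<r. outer_prod (u i) (v i)) = (\<Sum>i<r'. outer_prod (u' i) (v' i))"
proof -
  have "\<forall>\<^sub>F k :: nat in sequentially. (\<Sum>i<r. outer_prod (u i) (v i)) = (\<Sum>i<r'. outer_prod (u' i) (v' i))"
    using svd_frame_eventually_closest_point[OF assms(1)] svd_frame_eventually_closest_point[OF assms(2)]
    by eventually_elim simp
  then show ?thesis by simp
qed

lemma msgn_eq:
  "reduced_svd H r u s v \<Longrightarrow> msgn H = (\<Sum>i<r. outer_prod (u i) (v i))"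
  unfolding msgn_def by (rule the_equality) (auto intro: svd_frame_unique)

text \<open>By orthonormality each frame term picks out its own singular value. The right-hand side
  refers to \<open>H\<close> alone, which is why the nuclear norm does not depend on the
  decomposition.\<close>

lemma svd_sum_eq_inner:
  fixes H :: "real^'n^'m"
  assumes "reduced_svd H r u s v"
  shows "(\<Sum>i<r. s i) = msgn H \<bullet> H"
proof -
  have H: "H = (\<Sum>j<r. s j *\<^sub>R outer_prod (u j) (v j))" using assms by (simp add: reduced_svd_iff)
  have "msgn H \<bullet> H = (\<Sum>i<r. outer_prod (u i) (v i) \<bullet> (\<Sum>j<r. s j *\<^sub>R outer_prod (u j) (v j)))"
    unfolding msgn_eq[OF assms] inner_sum_left by (subst H) (rule refl)
  also have "\<dots> = (\<Sum>i<r. s i)"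
    using assms by (intro sum.cong svd_frame_inner_sum) (auto simp: reduced_svd_iff)
  finally show ?thesis ..
qed

lemma nuclear_norm_eq:
  assumes "reduced_svd H r u s v" shows "nuclear_norm H = (\<Sum>i<r. s i)"
  unfolding nuclear_norm_def
proof (rule the_equality)
  fix c assume "\<exists>r u s v. reduced_svd H r u s v \<and> c = (\<Sum>i<r. s i)"
  then show "c = (\<Sum>i<r. s i)"
    by (elim exE conjE) (simp only: svd_sum_eq_inner[OF assms] svd_sum_eq_inner)
qed (use assms in blast)

lemma nuclear_norm_eq_inner: "nuclear_norm H = msgn H \<bullet> H" for H :: "real^'n^'m"
proof -
  obtain r u s v where svd: "reduced_svd H r u s v" by (rule reduced_svd_exists)
  show ?thesis unfolding nuclear_norm_eq[OF svd] by (rule svd_sum_eq_inner[OF svd])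
qed

lemma msgn_in_op_ball: "msgn H \<in> op_ball" for H :: "real^'n^'m"
proof -
  obtain r u s v where svd: "reduced_svd H r u s v" by (rule reduced_svd_exists)
  then show ?thesis
    unfolding msgn_eq[OF svd] op_ball_def reduced_svd_iff by (blast intro: svd_frame_op_norm_le)
qed

text \<open>\<open>Z\<close> is paired with rank-one terms, each contributing at most its singular
  value. With \<open>nuclear_norm_eq_inner\<close> this says that the nuclear norm is the support
  function of \<open>op_ball\<close>, attained at \<open>msgn H\<close>; subadditivity and the
  Hoelder inequality below follow by choosing the test matrix.\<close>

lemma inner_le_nuclear_norm:
  fixes H :: "real^'n^'m"
  assumes "Z \<in> op_ball" shows "Z \<bullet> H \<le> nuclear_norm H"
proof -
  obtain r u s v where svd: "reduced_svd H r u s v" by (rule reduced_svd_exists)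
  then have o: "orthonormal_fam r u" "orthonormal_fam r v" "\<forall>i<r. 0 < s i"
    and H: "H = (\<Sum>i<r. s i *\<^sub>R outer_prod (u i) (v i))" by (auto simp: reduced_svd_iff)
  have "Z \<bullet> H = (\<Sum>i<r. s i * (outer_prod (u i) (v i) \<bullet> Z))"
    by (subst H) (simp add: inner_sum_right inner_commute)
  also have "\<dots> \<le> (\<Sum>i<r. s i * 1)"
    using o assms by (intro sum_mono mult_left_mono svd_frame_inner_le) (auto intro: less_imp_le)
  finally show ?thesis by (simp add: nuclear_norm_eq[OF svd])
qed

lemma op_norm_nonneg: "0 \<le> op_norm Z" for Z :: "real^'n^'m"
  by (simp add: onorm_pos_le matrix_vector_mul_bounded_linear)

lemma op_norm_eq_0: "op_norm Z = 0 \<longleftrightarrow> Z = 0" for Z :: "real^'n^'m"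
  using onorm_eq_0[OF matrix_vector_mul_bounded_linear, of Z] matrix_eq[of Z 0] by auto

lemma op_ball_scaleR:
  fixes Z :: "real^'n^'m"
  assumes "0 < c" "op_norm Z \<le> c" shows "(1 / c) *\<^sub>R Z \<in> op_ball"
proof -
  have "y \<bullet> (Z *v x) \<le> c * norm y * norm x" for x y using assms(2) op_norm_le_iff by blast
  then have "y \<bullet> (((1 / c) *\<^sub>R Z) *v x) \<le> 1 * norm y * norm x" for x y
    using assms(1) by (simp add: scaleR_matrix_vector_assoc[symmetric] pos_divide_le_eq mult_ac)
  then show ?thesis unfolding op_ball_def mem_Collect_eq op_norm_le_iff by blast
qed

lemma inner_le_op_norm_nuclear_norm:
  fixes H Z :: "real^'n^'m"
  shows "Z \<bullet> H \<le> op_norm Z * nuclear_norm H"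
proof (cases "op_norm Z = 0")
  case False
  then have pos: "0 < op_norm Z" using op_norm_nonneg[of Z] by linarith
  have "((1 / op_norm Z) *\<^sub>R Z) \<bullet> H \<le> nuclear_norm H"
    by (rule inner_le_nuclear_norm[OF op_ball_scaleR[OF pos order_refl]])
  then show ?thesis using pos by (simp add: pos_divide_le_eq mult.commute)
next
  case True
  then have "Z = 0" using op_norm_eq_0 by blast
  then show ?thesis using True by (simp del: matrix_vector_mult_0)
qed

lemma nuclear_norm_sum_le: "nuclear_norm (\<Sum>i\<in>I. F i) \<le> (\<Sum>i\<in>I. nuclear_norm (F i))"
  for F :: "'i \<Rightarrow> real^'n^'m"
  unfolding nuclear_norm_eq_inner[of "\<Sum>i\<in>I. F i"] inner_sum_right
  by (intro sum_mono inner_le_nuclear_norm msgn_in_op_ball)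

lemma nuclear_norm_add_le: "nuclear_norm (G + H) \<le> nuclear_norm G + nuclear_norm H"
  for G H :: "real^'n^'m"
  unfolding nuclear_norm_eq_inner[of "G + H"] inner_add_right
  by (intro add_mono inner_le_nuclear_norm msgn_in_op_ball)

lemma nuclear_norm_scaleR_le: "0 \<le> c \<Longrightarrow> nuclear_norm (c *\<^sub>R H) \<le> c * nuclear_norm H"
  for H :: "real^'n^'m"
  unfolding nuclear_norm_eq_inner[of "c *\<^sub>R H"] inner_scaleR_right
  by (intro mult_left_mono inner_le_nuclear_norm msgn_in_op_ball)

lemma nuclear_norm_nonneg: "0 \<le> nuclear_norm H" for H :: "real^'n^'m"
  using inner_le_nuclear_norm[of 0 H] op_norm_eq_0[of "0 :: real^'n^'m"]
  by (simp add: op_ball_def del: matrix_vector_mult_0)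

lemma norm_le_nuclear_norm: "norm H \<le> nuclear_norm H" for H :: "real^'n^'m"
proof -
  obtain r u s v where svd: "reduced_svd H r u s v" by (rule reduced_svd_exists)
  then have o: "orthonormal_fam r u" "orthonormal_fam r v" "\<forall>i<r. 0 < s i"
    and H: "H = (\<Sum>i<r. s i *\<^sub>R outer_prod (u i) (v i))" by (auto simp: reduced_svd_iff)
  have "norm (outer_prod (u i) (v i)) = 1" if "i < r" for i
  proof -
    have "norm (u i) = 1" "norm (v i) = 1" using o that by (auto simp: orthonormal_fam_def norm_eq_1)
    then show ?thesis by (simp add: norm_outer_prod)
  qed
  moreover have "norm H \<le> (\<Sum>i<r. norm (s i *\<^sub>R outer_prod (u i) (v i)))"
    by (subst H) (rule norm_sum)
  moreover have "(\<Sum>i<r. \<bar>s i\<bar>) = (\<Sum>i<r. s i)" using o(3) by (intro sum.cong) auto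
  ultimately have "norm H \<le> (\<Sum>i<r. s i)" by simp
  then show ?thesis by (simp add: nuclear_norm_eq[OF svd])
qed

lemma op_norm_le_norm: "op_norm Z \<le> norm Z" for Z :: "real^'n^'m"
proof (rule op_norm_leI)
  fix x :: "real^'n" and y :: "real^'m"
  have "outer_prod y x \<bullet> Z \<le> norm (outer_prod y x) * norm Z" by (rule norm_cauchy_schwarz)
  then show "y \<bullet> (Z *v x) \<le> norm Z * norm y * norm x"
    by (simp add: outer_prod_inner norm_outer_prod mult_ac)
qed

text \<open>The squared Frobenius norm of the frame is the rank. Every factor
  \<open>sqrt r_max\<close> in the final bound originates here.\<close>

lemma norm_msgn_le: "norm (msgn H) \<le> sqrt (real (min CARD('m) CARD('n)))"
  for H :: "real^'n^'m"
proof -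
  obtain r u s v where svd: "reduced_svd H r u s v" by (rule reduced_svd_exists)
  then have o: "orthonormal_fam r u" "orthonormal_fam r v" by (auto simp: reduced_svd_iff)
  have "msgn H \<bullet> msgn H = (\<Sum>i<r. outer_prod (u i) (v i) \<bullet> (\<Sum>j<r. 1 *\<^sub>R outer_prod (u j) (v j)))"
    by (simp add: msgn_eq[OF svd] inner_sum_left)
  also have "\<dots> = (\<Sum>i<r. 1)" using o by (intro sum.cong svd_frame_inner_sum) auto
  finally have "norm (msgn H) = sqrt (real r)" by (simp add: norm_eq_sqrt_inner)
  moreover have "r \<le> min CARD('m) CARD('n)"
    using orthonormal_fam_card[OF o(1)] orthonormal_fam_card[OF o(2)] by simp
  ultimately show ?thesis by simp
qed

lemma nuclear_norm_le_norm: "nuclear_norm H \<le> sqrt (real (min CARD('m) CARD('n))) * norm H"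
  for H :: "real^'n^'m"
  unfolding nuclear_norm_eq_inner
  by (rule order_trans[OF norm_cauchy_schwarz]) (intro mult_right_mono norm_msgn_le norm_ge_zero)

lemma continuous_on_nuclear_norm: "continuous_on UNIV (nuclear_norm :: real^'n^'m \<Rightarrow> real)"
proof -
  let ?c = "sqrt (real (min CARD('m) CARD('n)))"
  have le: "nuclear_norm G - nuclear_norm H \<le> ?c * norm (G - H)" for G H :: "real^'n^'m"
    using nuclear_norm_add_le[of H "G - H"] nuclear_norm_le_norm[of "G - H"] by simp
  have "\<bar>nuclear_norm G - nuclear_norm H\<bar> \<le> ?c * norm (G - H)" for G H :: "real^'n^'m"
    using le[of G H] le[of H G] unfolding abs_le_iff by (simp add: norm_minus_commute)
  then have "?c-lipschitz_on UNIV (nuclear_norm :: real^'n^'m \<Rightarrow> real)"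
    by (intro lipschitz_onI) (auto simp: dist_norm)
  then show ?thesis by (rule lipschitz_on_continuous_on)
qed

text \<open>At matrices of deficient rank \<open>msgn\<close> jumps, so continuity cannot give
  measurability. The projections are continuous, and at each \<open>H\<close> their sequence is
  eventually constant.\<close>

lemma borel_measurable_msgn: "(msgn :: real^'n^'m \<Rightarrow> real^'n^'m) \<in> borel_measurable borel"
proof (rule borel_measurable_LIMSEQ_metric)
  show "(\<lambda>H. closest_point op_ball (real k *\<^sub>R H) :: real^'n^'m) \<in> borel_measurable borel" for k
  proof (rule borel_measurable_continuous_onI)
    have "continuous_on UNIV (closest_point (op_ball :: (real^'n^'m) set))"
      using continuous_on_closest_point[OF convex_op_ball closed_op_ball] msgn_in_op_ball by blast
    then show "continuous_on UNIV (\<lambda>H. closest_point op_ball (real k *\<^sub>R H) :: real^'n^'m)"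
      by (rule continuous_on_compose2) (auto intro!: continuous_intros)
  qed
  show "(\<lambda>k. closest_point op_ball (real k *\<^sub>R H)) \<longlonglongrightarrow> msgn H" for H :: "real^'n^'m"
  proof (rule reduced_svd_exists[of H])
    fix r u s v assume "reduced_svd H r u s v"
    then show ?thesis
      unfolding msgn_eq[OF \<open>reduced_svd H r u s v\<close>]
      by (intro tendsto_eventually svd_frame_eventually_closest_point)
  qed
qed

section \<open>Stacked variables and mixing matrices\<close>

lemma act_nth: "act P Z $ i = (\<Sum>j\<in>UNIV. P $ i $ j *\<^sub>R Z $ j)"
  by (simp add: act_def)

lemma linear_act: "linear (act P :: ('b::real_vector)^'a \<Rightarrow> 'b^'a)"
  by (rule linearI) (simp_all add: vec_eq_iff act_nth scaleR_add_right sum.distrib scaleR_sum_right mult.commute)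

lemma linear_mean: "linear (mean :: ('b::real_vector)^'a \<Rightarrow> 'b)"
  by (rule linearI) (simp_all add: mean_def sum.distrib scaleR_add_right scaleR_sum_right[symmetric] mult.commute)

lemma linear_dev: "linear (dev :: ('b::real_vector)^'a \<Rightarrow> 'b^'a)"
  unfolding dev_def[abs_def] by (rule linear_act)

lemmas mean_diff = linear_diff[OF linear_mean] and mean_add = linear_add[OF linear_mean]
  and mean_scaleR = linear_scale[OF linear_mean]
lemmas dev_diff = linear_diff[OF linear_dev] and dev_add = linear_add[OF linear_dev]
  and dev_scaleR = linear_scale[OF linear_dev]

lemma dev_nth: "dev Z $ i = Z $ i - mean (Z :: ('b::real_vector)^'a)"
proof -
  have "dev Z $ i = (\<Sum>j\<in>UNIV. (if i = j then Z $ j else 0) - (1 / real CARD('a)) *\<^sub>R Z $ j)"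
    unfolding dev_def act_nth by (intro sum.cong) (auto simp: mat_def avg_mat_def algebra_simps)
  then show ?thesis by (simp add: sum_subtractf mean_def scaleR_sum_right)
qed

lemma mean_dev: "mean (dev Z) = 0" for Z :: "('b::real_vector)^'a"
proof -
  have "mean (dev Z) = (1 / real CARD('a)) *\<^sub>R ((\<Sum>i\<in>UNIV. Z $ i) - real CARD('a) *\<^sub>R mean Z)"
    unfolding mean_def[of "dev Z"] by (simp add: dev_nth sum_subtractf scaleR_conv_of_real[symmetric] sum_constant_scaleR)
  also have "\<dots> = 0" by (simp add: mean_def)
  finally show ?thesis .
qed

lemma mean_act:
  fixes P :: "real^'a^'a" and Z :: "('b::real_vector)^'a"
  assumes "\<And>j. (\<Sum>i\<in>UNIV. P $ i $ j) = c"
  shows "mean (act P Z) = c *\<^sub>R mean Z"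
proof -
  have "(\<Sum>i\<in>UNIV. act P Z $ i) = (\<Sum>j\<in>UNIV. \<Sum>i\<in>UNIV. P $ i $ j *\<^sub>R Z $ j)"
    unfolding act_nth by (rule sum.swap)
  also have "\<dots> = c *\<^sub>R (\<Sum>j\<in>UNIV. Z $ j)"
    by (simp add: scaleR_sum_left[symmetric] assms scaleR_sum_right)
  finally show ?thesis by (simp add: mean_def)
qed

lemma act_mult: "act (P ** R) Z = act P (act R (Z :: ('b::real_vector)^'a))" for P R :: "real^'a^'a"
proof -
  have "(\<Sum>k\<in>UNIV. (\<Sum>j\<in>UNIV. P $ i $ j * R $ j $ k) *\<^sub>R Z $ k) =
     (\<Sum>j\<in>UNIV. P $ i $ j *\<^sub>R (\<Sum>k\<in>UNIV. R $ j $ k *\<^sub>R Z $ k))" for i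
    unfolding scaleR_sum_left scaleR_sum_right by (subst sum.swap) simp
  then show ?thesis by (simp add: vec_eq_iff act_nth matrix_matrix_mult_def)
qed

lemma norm_stack: "(norm Z)\<^sup>2 = (\<Sum>i\<in>UNIV. (norm (Z $ i))\<^sup>2)" for Z :: "('b::real_inner)^'a"
  by (simp add: power2_norm_eq_inner inner_vec_def)

lemma inner_act_transpose: "act P Z \<bullet> Y = Z \<bullet> act (transpose P) Y" for Z Y :: "('b::real_inner)^'a"
proof -
  have "act P Z \<bullet> Y = (\<Sum>i\<in>UNIV. \<Sum>j\<in>UNIV. P $ i $ j * (Z $ j \<bullet> Y $ i))"
    by (simp add: inner_vec_def act_nth inner_sum_left)
  also have "\<dots> = (\<Sum>j\<in>UNIV. \<Sum>i\<in>UNIV. P $ i $ j * (Z $ j \<bullet> Y $ i))" by (rule sum.swap)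
  also have "\<dots> = Z \<bullet> act (transpose P) Y"
    by (simp add: inner_vec_def act_nth inner_sum_right transpose_def)
  finally show ?thesis .
qed

lemma norm_act_orthogonal:
  fixes Z :: "('b::real_inner)^'a"
  assumes "orthogonal_matrix Q" shows "norm (act Q Z) = norm Z"
proof -
  have "act (mat 1) Z = Z"
    by (simp add: vec_eq_iff act_nth mat_def if_distrib[of "\<lambda>c. c *\<^sub>R _"] cong: if_cong)
  moreover have "transpose Q ** Q = mat 1" using assms by (simp add: orthogonal_matrix_def)
  ultimately have "act Q Z \<bullet> act Q Z = Z \<bullet> Z" by (metis inner_act_transpose act_mult)
  then show ?thesis by (simp add: norm_eq_sqrt_inner)
qed

lemma norm_act_diag_le:
  fixes Z :: "('b::real_inner)^'a"
  assumes "\<And>i. \<bar>d i\<bar> \<le> c" shows "norm (act (diag_mat d) Z) \<le> c * norm Z"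
proof -
  have c: "0 \<le> c" using assms[of undefined] by linarith
  have "act (diag_mat d) Z $ i = d i *\<^sub>R Z $ i" for i
    by (simp add: act_nth diag_mat_def if_distrib[of "\<lambda>c. c *\<^sub>R _"] cong: if_cong)
  then have "(norm (act (diag_mat d) Z))\<^sup>2 = (\<Sum>i\<in>UNIV. (d i)\<^sup>2 * (norm (Z $ i))\<^sup>2)"
    by (simp add: norm_stack power_mult_distrib)
  also have "\<dots> \<le> (\<Sum>i\<in>UNIV. c\<^sup>2 * (norm (Z $ i))\<^sup>2)"
    by (intro sum_mono mult_right_mono) (use assms in \<open>auto simp: abs_le_square_iff[symmetric] c\<close>)
  also have "\<dots> = (c * norm Z)\<^sup>2" by (simp add: power_mult_distrib norm_stack sum_distrib_left)
  finally show ?thesis by (rule power2_le_imp_le) (simp add: c)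
qed

lemma norm_mean_le: "norm (mean Z) \<le> (\<Sum>i\<in>UNIV. norm (Z $ i)) / real CARD('a)"
  for Z :: "('b::real_normed_vector)^'a"
  by (simp add: mean_def norm_sum divide_right_mono)

lemma sum_norm_stack_le: "(\<Sum>i\<in>UNIV. norm (Z $ i)) \<le> sqrt (real CARD('a)) * norm Z"
  for Z :: "('b::real_inner)^'a"
proof -
  have "(\<Sum>i\<in>UNIV. norm (Z $ i)) \<le> sqrt ((\<Sum>i\<in>(UNIV::'a set). 1\<^sup>2) * (\<Sum>i\<in>UNIV. (norm (Z $ i))\<^sup>2))"
    using Cauchy_Schwarz_ineq_sum[of "\<lambda>_. 1" "\<lambda>i. norm (Z $ i)" "UNIV :: 'a set"]
    by (intro real_le_rsqrt) simp
  then show ?thesis by (simp add: norm_stack[symmetric] real_sqrt_mult)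
qed

lemma norm_dev_le: "norm (dev Z) \<le> norm Z" for Z :: "('b::real_inner)^'a"
proof -
  let ?c = "real CARD('a)"
  have s: "(\<Sum>i\<in>UNIV. Z $ i) = ?c *\<^sub>R mean Z" by (simp add: mean_def)
  have "(norm (dev Z))\<^sup>2 = (\<Sum>i\<in>UNIV. (norm (Z $ i))\<^sup>2 - 2 * (Z $ i \<bullet> mean Z) + mean Z \<bullet> mean Z)"
    unfolding norm_stack dev_nth
    by (intro sum.cong) (auto simp: power2_norm_eq_inner inner_diff_left inner_diff_right inner_commute)
  also have "\<dots> = (norm Z)\<^sup>2 - 2 * ((\<Sum>i\<in>UNIV. Z $ i) \<bullet> mean Z) + ?c * (mean Z \<bullet> mean Z)"
    by (simp add: sum.distrib sum_subtractf norm_stack inner_sum_left sum_distrib_left)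
  also have "\<dots> = (norm Z)\<^sup>2 - ?c * (mean Z \<bullet> mean Z)" unfolding s by simp
  also have "\<dots> \<le> (norm Z)\<^sup>2" by simp
  finally show ?thesis by (rule power2_le_imp_le) simp
qed

text \<open>Both row and column sums are used: averaging commutes with \<open>W\<close>, and
  \<open>avg_mat\<close> may be subtracted for free because \<open>dev Z\<close> has mean zero. The
  subtraction removes the eigenvalue 1, for which there would be no contraction.\<close>

lemma dev_act:
  fixes W :: "real^'a^'a" and Z :: "('b::real_vector)^'a"
  assumes r: "\<And>i. (\<Sum>j\<in>UNIV. W $ i $ j) = 1" and c: "\<And>j. (\<Sum>i\<in>UNIV. W $ i $ j) = 1"
  shows "dev (act W Z) = act (W - avg_mat) (dev Z)"
proof -
  have "act (W - avg_mat) (dev Z) $ i = dev (act W Z) $ i" for i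
  proof -
    have "act (W - avg_mat) (dev Z) $ i = (\<Sum>j\<in>UNIV. W $ i $ j *\<^sub>R dev Z $ j) - mean (dev Z)"
      by (simp add: act_nth avg_mat_def mean_def scaleR_diff_left sum_subtractf scaleR_sum_right)
    also have "\<dots> = (\<Sum>j\<in>UNIV. W $ i $ j *\<^sub>R Z $ j) - (\<Sum>j\<in>UNIV. W $ i $ j) *\<^sub>R mean Z"
      by (simp add: mean_dev dev_nth scaleR_diff_right sum_subtractf scaleR_sum_left)
    finally show ?thesis by (simp add: r dev_nth act_nth mean_act[OF c])
  qed
  then show ?thesis by (simp add: vec_eq_iff)
qed

section \<open>Spectral contraction of the disagreement\<close>

lemma eigenvalue_on_bounded:
  fixes D :: "'i::finite \<Rightarrow> 'i \<Rightarrow> real"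
  assumes "eigenvalue_on UNIV D \<mu>"
  shows "cmod \<mu> \<le> (\<Sum>p\<in>UNIV. \<Sum>q\<in>UNIV. \<bar>D p q\<bar>)" (is "_ \<le> ?S")
proof -
  obtain x where x: "\<exists>p. x p \<noteq> 0" "\<And>p. (\<Sum>q\<in>UNIV. of_real (D p q) * x q) = \<mu> * x p"
    using assms by (auto simp: eigenvalue_on_def)
  let ?T = "\<Sum>p\<in>UNIV. cmod (x p)"
  obtain p0 where "x p0 \<noteq> 0" using x by blast
  then have T: "0 < ?T" by (intro sum_pos2[of _ p0]) auto
  have "cmod \<mu> * cmod (x p) \<le> (\<Sum>q\<in>UNIV. \<bar>D p q\<bar>) * ?T" for p
  proof -
    have "cmod \<mu> * cmod (x p) \<le> (\<Sum>q\<in>UNIV. \<bar>D p q\<bar> * cmod (x q))"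
      unfolding norm_mult[symmetric] x(2)[symmetric] by (rule sum_norm_le) (simp add: norm_mult)
    also have "\<dots> \<le> (\<Sum>q\<in>UNIV. \<bar>D p q\<bar> * ?T)"
      by (intro sum_mono mult_left_mono member_le_sum) auto
    finally show ?thesis by (simp add: sum_distrib_right)
  qed
  then have "(\<Sum>p\<in>UNIV. cmod \<mu> * cmod (x p)) \<le> (\<Sum>p\<in>UNIV. (\<Sum>q\<in>UNIV. \<bar>D p q\<bar>) * ?T)"
    by (intro sum_mono)
  then have "cmod \<mu> * ?T \<le> ?S * ?T" unfolding sum_distrib_left[symmetric] sum_distrib_right[symmetric] .
  then show ?thesis using T by (simp add: mult_le_cancel_right)
qed

lemma eigenvalue_le_spectral_radius:
  fixes P :: "real^'a^'a"
  assumes "eigenvalue_on UNIV (\<lambda>i j. P $ i $ j) \<mu>"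
  shows "cmod \<mu> \<le> spectral_radius P"
  unfolding spectral_radius_def
proof (rule cSUP_upper)
  \<comment> \<open>A real \<open>SUP\<close> dominates its elements only if the set is bounded
    above; the crude bound by the sum of absolute entries is enough.\<close>
  show "bdd_above (cmod ` {\<mu>. eigenvalue_on UNIV (\<lambda>i j. P $ i $ j) \<mu>})"
    by (rule bdd_aboveI2) (use eigenvalue_on_bounded in blast)
qed (use assms in simp)

lemma orthogonal_conj_nth:
  fixes Q :: "real^'a^'a"
  shows "(Q ** diag_mat d ** transpose Q) $ i $ j = (\<Sum>k\<in>UNIV. Q $ i $ k * d k * Q $ j $ k)"
  by (simp add: matrix_matrix_mult_def diag_mat_def transpose_def if_distrib cong: if_cong)

lemma orthogonal_columns:
  fixes Q :: "real^'a^'a"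
  assumes "orthogonal_matrix Q"
  shows "(\<Sum>i\<in>UNIV. Q $ i $ k * Q $ i $ l) = (if k = l then 1 else 0)"
proof -
  have "(transpose Q ** Q) $ k $ l = mat 1 $ k $ l" using assms by (simp add: orthogonal_matrix_def)
  then show ?thesis by (simp add: matrix_matrix_mult_def transpose_def mat_def)
qed

lemma orthogonal_conj_mult_column:
  fixes Q :: "real^'a^'a"
  assumes "orthogonal_matrix Q"
  shows "(\<Sum>j\<in>UNIV. (Q ** diag_mat d ** transpose Q) $ i $ j * Q $ j $ k) = d k * Q $ i $ k"
proof -
  have "(\<Sum>j\<in>UNIV. (Q ** diag_mat d ** transpose Q) $ i $ j * Q $ j $ k) =
      (\<Sum>l\<in>UNIV. Q $ i $ l * d l * (\<Sum>j\<in>UNIV. Q $ j $ l * Q $ j $ k))"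
    unfolding orthogonal_conj_nth sum_distrib_right sum_distrib_left by (subst sum.swap) (simp add: mult_ac)
  also have "\<dots> = d k * Q $ i $ k"
    by (simp add: orthogonal_columns[OF assms] if_distrib[of "\<lambda>c. _ * c"] cong: if_cong)
  finally show ?thesis .
qed

text \<open>In the eigenbasis \<open>Q\<close> the matrix \<open>W - avg_mat\<close> is diagonal
  with the entry at \<open>o1\<close> set to zero, since that column contributes exactly
  \<open>avg_mat\<close>. The diagonal entries are eigenvalues, hence bounded by the spectral
  radius, and orthogonal mixing of the blocks preserves the Frobenius norm.\<close>

lemma norm_dev_act_le:
  fixes W :: "real^'a^'a" and Z :: "('b::real_inner)^'a"
  assumes W: "doubly_stochastic W" and Q: "orthogonal_matrix Q"
    and Q1: "\<And>i. Q $ i $ o1 = 1 / sqrt (real CARD('a))" and l1: "l o1 = 1"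
    and Wl: "W = Q ** diag_mat l ** transpose Q"
  shows "norm (dev (act W Z)) \<le> spectral_radius (W - avg_mat) * norm (dev Z)"
proof -
  define d where "d = l(o1 := 0)"
  have dec: "W - avg_mat = Q ** diag_mat d ** transpose Q"
  proof -
    have "(Q ** diag_mat d ** transpose Q) $ i $ j = W $ i $ j - avg_mat $ i $ j" for i j
    proof -
      have "(\<Sum>k\<in>UNIV. Q $ i $ k * l k * Q $ j $ k) - (\<Sum>k\<in>UNIV. Q $ i $ k * d k * Q $ j $ k) =
          (\<Sum>k\<in>UNIV. if k = o1 then Q $ i $ o1 * Q $ j $ o1 else 0)"
        unfolding sum_subtractf[symmetric] by (intro sum.cong) (auto simp: d_def l1)
      then show ?thesis unfolding Wl orthogonal_conj_nth by (simp add: avg_mat_def Q1)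
    qed
    then show ?thesis by (simp add: vec_eq_iff)
  qed
  have "\<bar>d k\<bar> \<le> spectral_radius (W - avg_mat)" for k
  proof -
    have "eigenvalue_on UNIV (\<lambda>i j. (W - avg_mat) $ i $ j) (complex_of_real (d k))"
      unfolding eigenvalue_on_def
    proof (intro exI[of _ "\<lambda>i. complex_of_real (Q $ i $ k)"] conjI ballI)
      show "\<exists>p\<in>UNIV. complex_of_real (Q $ p $ k) \<noteq> 0"
      proof (rule ccontr)
        assume "\<not> (\<exists>p\<in>UNIV. complex_of_real (Q $ p $ k) \<noteq> 0)"
        then show False using orthogonal_columns[OF Q, of k k] by simp
      qed
      show "(\<Sum>q\<in>UNIV. complex_of_real ((W - avg_mat) $ p $ q) * complex_of_real (Q $ q $ k)) =
         complex_of_real (d k) * complex_of_real (Q $ p $ k)" for p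
        unfolding of_real_mult[symmetric] of_real_sum[symmetric] dec orthogonal_conj_mult_column[OF Q] ..
    qed
    then show ?thesis using eigenvalue_le_spectral_radius by fastforce
  qed
  note bound = norm_act_diag_le[of d, OF this]
  have Qt: "orthogonal_matrix (transpose Q)" using Q by (simp add: orthogonal_matrix_transpose)
  have "dev (act W Z) = act (W - avg_mat) (dev Z)"
    by (rule dev_act) (use W in \<open>auto simp: doubly_stochastic_def\<close>)
  also have "\<dots> = act Q (act (diag_mat d) (act (transpose Q) (dev Z)))"
    by (simp add: dec act_mult)
  finally have "norm (dev (act W Z)) = norm (act (diag_mat d) (act (transpose Q) (dev Z)))"
    by (simp add: norm_act_orthogonal[OF Q])
  also have "\<dots> \<le> spectral_radius (W - avg_mat) * norm (act (transpose Q) (dev Z))" by (rule bound)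
  finally show ?thesis by (simp add: norm_act_orthogonal[OF Qt])
qed

text \<open>
  Stability forces \<open>\<Lambda>\<^sub>b\<^sup>2\<close> to be invertible, since \<open>1\<close> would be an eigenvalue otherwise. Hence the
  row \<open>1\<^sup>T B\<close>, which \<open>B\<close> annihilates from the right, is a multiple of \<open>1\<^sup>T\<close>; and \<open>1\<^sup>T B 1 = 0\<close>.
\<close>

lemma suda_stable_lb2_nonzero:
  assumes st: "\<And>\<mu>. eigenvalue_on ((- {o1}) <+> (- {o1})) (suda_dev_mat la lc lb2) \<mu> \<Longrightarrow> cmod \<mu> < 1"
    and i: "i \<noteq> (o1 :: 'a::finite)"
  shows "lb2 i \<noteq> 0"
proof
  assume z: "lb2 i = 0"
  let ?I = "(- {o1}) <+> (- {o1})"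
  \<comment> \<open>With \<open>lb2 i = 0\<close> the deviation matrix at index \<open>i\<close> is
    the block with rows \<open>la lc, -1\<close> and \<open>0, 1\<close>; this is its eigenvector
    for the eigenvalue 1, extended by zero.\<close>
  let ?x = "\<lambda>p. case p of Inl j \<Rightarrow> if j = i then 1 else 0 | Inr j \<Rightarrow> if j = i then complex_of_real (la i * lc i - 1) else 0"
  have split: "(\<Sum>q\<in>?I. h q) = (\<Sum>j\<in>-{o1}. h (Inl j)) + (\<Sum>j\<in>-{o1}. h (Inr j))"
    for h :: "'a + 'a \<Rightarrow> complex"
    by (subst sum.Plus) auto
  have "eigenvalue_on ?I (suda_dev_mat la lc lb2) 1"
    unfolding eigenvalue_on_def
  proof (intro exI[of _ ?x] conjI ballI)
    show "\<exists>p\<in>?I. ?x p \<noteq> 0" by (rule bexI[of _ "Inl i"]) (use i in auto)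
    fix p assume p: "p \<in> ?I"
    show "(\<Sum>q\<in>?I. complex_of_real (suda_dev_mat la lc lb2 p q) * ?x q) = 1 * ?x p"
    proof (cases p)
      case (Inl k)
      have "(\<Sum>j\<in>-{o1}. complex_of_real (suda_dev_mat la lc lb2 (Inl k) (Inl j)) * ?x (Inl j)) =
          (\<Sum>j\<in>-{o1}. if j = i then if k = i then complex_of_real (la i * lc i) else 0 else 0)"
        by (intro sum.cong) (auto simp: z)
      moreover have "(\<Sum>j\<in>-{o1}. complex_of_real (suda_dev_mat la lc lb2 (Inl k) (Inr j)) * ?x (Inr j)) =
          (\<Sum>j\<in>-{o1}. if j = i then if k = i then - complex_of_real (la i * lc i - 1) else 0 else 0)"
        by (intro sum.cong) (auto simp: z)
      ultimately show ?thesis using i unfolding split Inl by simp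
    next
      case (Inr k)
      have "(\<Sum>j\<in>-{o1}. complex_of_real (suda_dev_mat la lc lb2 (Inr k) (Inl j)) * ?x (Inl j)) = 0"
        by (intro sum.neutral) (auto simp: z)
      moreover have "(\<Sum>j\<in>-{o1}. complex_of_real (suda_dev_mat la lc lb2 (Inr k) (Inr j)) * ?x (Inr j)) =
          (\<Sum>j\<in>-{o1}. if j = i then if k = i then complex_of_real (la i * lc i - 1) else 0 else 0)"
        by (intro sum.cong) (auto simp: z)
      ultimately show ?thesis using i unfolding split Inr by simp
    qed
  qed
  from st[OF this] show False by simp
qed

lemma suda_stable_column_sums:
  fixes W A B C :: "real^'a^'a"
  assumes stable: "suda_stable W A B C"
    and cons: "\<forall>Z :: real^'n^'m^'a. act B Z = 0 \<longleftrightarrow> (\<forall>i j. Z $ i = Z $ j)"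
  shows "(\<Sum>i\<in>UNIV. B $ i $ j) = 0"
proof -
  obtain Q o1 lb2 la lc where Q: "orthogonal_matrix Q" and Q1: "\<And>i. Q $ i $ o1 = 1 / sqrt (real CARD('a))"
    and BB: "B ** B = Q ** diag_mat lb2 ** transpose Q"
    and st: "\<And>\<mu>. eigenvalue_on ((- {o1}) <+> (- {o1})) (suda_dev_mat la lc lb2) \<mu> \<Longrightarrow> cmod \<mu> < 1"
    using stable unfolding suda_stable_def by blast
  \<comment> \<open>A stack of identical one-entry matrices turns the consensus hypothesis into the
    scalar statement that the rows of \<open>B\<close> sum to zero.\<close>
  have "act B ((\<chi> i. axis undefined (axis undefined 1)) :: real^'n^'m^'a) = 0" using cons by simp
  then have "act B ((\<chi> i. axis undefined (axis undefined 1)) :: real^'n^'m^'a) $ i $ undefined $ undefined = 0" for i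
    by simp
  then have row: "(\<Sum>j\<in>UNIV. B $ i $ j) = 0" for i
    by (simp add: act_nth)
  \<comment> \<open>\<open>w\<close> is the row vector of column sums. Symmetry of
    \<open>B ** B\<close> and the zero row sums of \<open>B\<close> give \<open>w B = 0\<close>;
    multiplying by \<open>B\<close> once more puts \<open>w\<close> into the kernel of
    \<open>B ** B\<close>.\<close>
  define w where "w j = (\<Sum>i\<in>UNIV. B $ i $ j)" for j
  have w1: "(\<Sum>j\<in>UNIV. w j) = 0" unfolding w_def by (subst sum.swap) (simp add: row)
  have BBw: "(\<Sum>j\<in>UNIV. w j * B $ j $ k) = (\<Sum>i\<in>UNIV. (B ** B) $ i $ k)" for k
    unfolding w_def sum_distrib_right matrix_matrix_mult_def by (subst sum.swap) simp
  have BBsym: "(B ** B) $ i $ k = (B ** B) $ k $ i" for i k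
    unfolding BB orthogonal_conj_nth by (simp add: mult_ac)
  have "(\<Sum>i\<in>UNIV. (B ** B) $ i $ k) = (\<Sum>i\<in>UNIV. \<Sum>l\<in>UNIV. B $ k $ l * B $ l $ i)" for k
    by (subst BBsym) (simp add: matrix_matrix_mult_def)
  also have "\<dots> k = (\<Sum>l\<in>UNIV. B $ k $ l * (\<Sum>i\<in>UNIV. B $ l $ i))" for k
    unfolding sum_distrib_left by (rule sum.swap)
  finally have "(\<Sum>j\<in>UNIV. w j * B $ j $ k) = 0" for k by (simp add: BBw row)
  then have "0 = (\<Sum>l\<in>UNIV. (\<Sum>j\<in>UNIV. w j * B $ j $ l) * B $ l $ k)" for k by simp
  also have "\<dots> k = (\<Sum>j\<in>UNIV. (B ** B) $ k $ j * w j)" for k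
  proof -
    have "(\<Sum>l\<in>UNIV. (\<Sum>j\<in>UNIV. w j * B $ j $ l) * B $ l $ k) = (\<Sum>j\<in>UNIV. (B ** B) $ j $ k * w j)"
      unfolding sum_distrib_right by (subst sum.swap)
        (simp add: matrix_matrix_mult_def sum_distrib_right sum_distrib_left mult_ac)
    then show ?thesis by (subst BBsym) simp
  qed
  finally have BBw0: "(\<Sum>j\<in>UNIV. (B ** B) $ k $ j * w j) = 0" for k by simp
  \<comment> \<open>Coordinates of \<open>w\<close> in the eigenbasis: those away from
    \<open>o1\<close> vanish because \<open>lb2\<close> is nonzero there, and the one at
    \<open>o1\<close> is a multiple of the total of \<open>w\<close>, which is zero by
    \<open>w1\<close>.\<close>
  define c where "c k = (\<Sum>j\<in>UNIV. Q $ j $ k * w j)" for k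
  have QQt: "(\<Sum>k\<in>UNIV. Q $ i $ k * Q $ j $ k) = (if i = j then 1 else 0)" for i j
  proof -
    have "orthogonal_matrix (transpose Q)" using Q by (simp only: orthogonal_matrix_transpose)
    from orthogonal_columns[OF this, of i j] show ?thesis by (simp add: transpose_def)
  qed
  have w_eq: "w j = (\<Sum>k\<in>UNIV. c k * Q $ j $ k)" for j
  proof -
    have "(\<Sum>k\<in>UNIV. c k * Q $ j $ k) = (\<Sum>i\<in>UNIV. w i * (\<Sum>k\<in>UNIV. Q $ i $ k * Q $ j $ k))"
      unfolding c_def sum_distrib_right sum_distrib_left by (subst sum.swap) (simp add: mult_ac)
    then show ?thesis by (simp add: QQt if_distrib[of "\<lambda>c. _ * c"] cong: if_cong)
  qed
  have "lb2 k * c k = 0" for k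
  proof -
    have "lb2 k * c k = (\<Sum>j\<in>UNIV. (\<Sum>i\<in>UNIV. (B ** B) $ j $ i * Q $ i $ k) * w j)"
      unfolding BB orthogonal_conj_mult_column[OF Q] c_def sum_distrib_left by (simp add: mult_ac)
    also have "\<dots> = (\<Sum>i\<in>UNIV. Q $ i $ k * (\<Sum>j\<in>UNIV. (B ** B) $ i $ j * w j))"
      unfolding sum_distrib_right sum_distrib_left by (subst sum.swap) (simp add: BBsym mult_ac)
    finally show ?thesis by (simp add: BBw0)
  qed
  then have c0: "c k = 0" if "k \<noteq> o1" for k
    using suda_stable_lb2_nonzero[of o1 la lc lb2 k, OF st that] by (metis mult_eq_0_iff)
  have "c o1 = 0"
    unfolding c_def Q1 sum_distrib_left[symmetric] w1 by simp
  then have "c k = 0" for k using c0 by (cases "k = o1") simp_all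
  then show ?thesis using w_eq[of j] by (simp add: w_def)
qed

section \<open>Smoothness\<close>

lemma GDERIV_unique:
  assumes "GDERIV g x :> D" "GDERIV g x :> D'" shows "D = D'"
proof -
  have "(\<lambda>h. h \<bullet> D) = (\<lambda>h. h \<bullet> D')"
    by (rule has_derivative_unique[OF assms[unfolded gderiv_def]])
  then have "(D - D') \<bullet> D = (D - D') \<bullet> D'" by (rule fun_cong)
  then have "(D - D') \<bullet> (D - D') = 0" by (simp add: inner_diff_right)
  then show ?thesis by simp
qed

lemma GDERIV_gradient:
  fixes g :: "'b::euclidean_space \<Rightarrow> real"
  assumes "g differentiable (at x)" shows "GDERIV g x :> gradient g x"
proof -
  obtain g' where g': "(g has_derivative g') (at x)" using assms by (auto simp: differentiable_def)
  have "linear g'" using g' by (rule has_derivative_linear)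
  have "g' h = h \<bullet> (\<Sum>b\<in>Basis. g' b *\<^sub>R b)" for h
  proof -
    have "g' h = g' (\<Sum>b\<in>Basis. (h \<bullet> b) *\<^sub>R b)" by (simp add: euclidean_representation)
    also have "\<dots> = (\<Sum>b\<in>Basis. (h \<bullet> b) * g' b)"
      by (simp add: linear_sum[OF \<open>linear g'\<close>] linear_scale[OF \<open>linear g'\<close>])
    finally show ?thesis by (simp add: inner_sum_right mult.commute)
  qed
  then have "g' = (\<lambda>h. h \<bullet> (\<Sum>b\<in>Basis. g' b *\<^sub>R b))" by (rule ext)
  with g' have "GDERIV g x :> (\<Sum>b\<in>Basis. g' b *\<^sub>R b)" (is "GDERIV g x :> ?D")
    unfolding gderiv_def by simp
  then show ?thesis unfolding gradient_def
    by (rule theI) (rule GDERIV_unique[OF _ \<open>GDERIV g x :> ?D\<close>])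
qed

lemma gradient_eqI:
  fixes g :: "'b::euclidean_space \<Rightarrow> real"
  assumes "GDERIV g x :> D" shows "gradient g x = D"
proof -
  have "GDERIV g x :> gradient g x"
    using assms by (intro GDERIV_gradient) (auto simp: gderiv_def differentiable_def)
  from GDERIV_unique[OF this assms] show ?thesis .
qed

lemma norm_stack_mono:
  fixes Z :: "('b::real_inner)^'a" and r :: "real^'a"
  assumes "\<And>i. norm (Z $ i) \<le> r $ i" shows "norm Z \<le> norm r"
proof (rule power2_le_imp_le)
  have "(norm (Z $ i))\<^sup>2 \<le> (norm (r $ i))\<^sup>2" for i
    using assms[of i] by (intro power_mono) auto
  then show "(norm Z)\<^sup>2 \<le> (norm r)\<^sup>2" unfolding norm_stack by (intro sum_mono)
qed simp

lemma norm_const_stack: "norm ((\<chi> i. z) :: 'b^'a) = sqrt (real CARD('a)) * norm z" for z :: "'b::real_inner"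
  by (simp add: norm_eq_sqrt_inner inner_vec_def real_sqrt_mult)

lemma norm_msgn_stack_le:
  "norm (msgn_stack Z) \<le> sqrt (real CARD('a)) * sqrt (real (min CARD('m) CARD('n)))"
  for Z :: "real^'n^'m^'a"
proof -
  have "norm (msgn_stack Z) \<le> norm ((\<chi> i. sqrt (real (min CARD('m) CARD('n)))) :: real^'a)"
    by (rule norm_stack_mono) (simp add: msgn_stack_def norm_msgn_le)
  then show ?thesis unfolding norm_const_stack by simp
qed

lemma mean_in_op_ball:
  fixes Z :: "real^'n^'m^'a"
  assumes "\<And>i. Z $ i \<in> op_ball" shows "mean Z \<in> op_ball"
proof -
  have "(\<Sum>i\<in>UNIV. (1 / real CARD('a)) *\<^sub>R Z $ i) \<in> op_ball"
    by (rule convex_sum[OF _ convex_op_ball]) (use assms in auto)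
  then show ?thesis by (simp add: mean_def scaleR_sum_right)
qed

locale smooth_agents =
  fixes f :: "'a::finite \<Rightarrow> real^'n^'m \<Rightarrow> real" and L :: real
  assumes diff: "\<And>i Z. f i differentiable (at Z)"
    and smooth: "\<And>i Z Z'. nuclear_norm (gradient (f i) Z - gradient (f i) Z') \<le> L * op_norm (Z - Z')"
begin

text \<open>The sign of \<open>L\<close> is not a hypothesis; comparing gradients at zero and at one
  nonzero matrix forces it.\<close>

lemma L_nonneg: "0 \<le> L"
proof -
  let ?Z = "axis undefined (axis undefined 1) :: real^'n^'m"
  have "?Z \<noteq> 0" by (simp add: axis_eq_0_iff)
  then have "0 < op_norm ?Z" using op_norm_eq_0[of ?Z] op_norm_nonneg[of ?Z] by linarith
  moreover have "0 \<le> L * op_norm (?Z - 0)" by (rule order_trans[OF nuclear_norm_nonneg smooth])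
  ultimately show ?thesis by (simp add: zero_le_mult_iff)
qed

lemma GDERIV_avg_fun: "GDERIV (avg_fun f) Z :> mean (\<chi> i. gradient (f i) Z)"
proof -
  have "((\<lambda>Z. (1 / real CARD('a)) * (\<Sum>i\<in>UNIV. f i Z)) has_derivative
      (\<lambda>h. (1 / real CARD('a)) * (\<Sum>i\<in>UNIV. h \<bullet> gradient (f i) Z))) (at Z)"
    using GDERIV_gradient[OF diff] unfolding gderiv_def
    by (intro has_derivative_mult_right has_derivative_sum) auto
  then show ?thesis unfolding gderiv_def avg_fun_def[abs_def]
    by (simp add: mean_def inner_sum_right)
qed

lemma gradient_avg_fun: "gradient (avg_fun f) Z = mean (\<chi> i. gradient (f i) Z)"
  by (rule gradient_eqI[OF GDERIV_avg_fun])

lemma nuclear_norm_gradient_avg_diff: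
  "nuclear_norm (gradient (avg_fun f) Z - gradient (avg_fun f) Z') \<le> L * op_norm (Z - Z')"
proof -
  let ?c = "1 / real CARD('a)"
  have "gradient (avg_fun f) Z - gradient (avg_fun f) Z' = ?c *\<^sub>R (\<Sum>i\<in>UNIV. gradient (f i) Z - gradient (f i) Z')"
    by (simp add: gradient_avg_fun mean_def scaleR_diff_right sum_subtractf)
  then have "nuclear_norm (gradient (avg_fun f) Z - gradient (avg_fun f) Z') \<le>
      ?c * nuclear_norm (\<Sum>i\<in>UNIV. gradient (f i) Z - gradient (f i) Z')"
    using nuclear_norm_scaleR_le[of ?c] by simp
  also have "\<dots> \<le> ?c * (\<Sum>i\<in>(UNIV::'a set). L * op_norm (Z - Z'))"
    by (intro mult_left_mono order_trans[OF nuclear_norm_sum_le] sum_mono smooth) auto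
  finally show ?thesis by simp
qed

lemma norm_gradient_diff: "norm (gradient (f i) Z - gradient (f i) Z') \<le> L * op_norm (Z - Z')"
  by (rule order_trans[OF norm_le_nuclear_norm smooth])

lemma norm_gradient_avg_diff:
  "norm (gradient (avg_fun f) Z - gradient (avg_fun f) Z') \<le> L * op_norm (Z - Z')"
  by (rule order_trans[OF norm_le_nuclear_norm nuclear_norm_gradient_avg_diff])

lemma lipschitz_gradient: "L-lipschitz_on UNIV (gradient (f i))"
proof (rule lipschitz_onI)
  show "dist (gradient (f i) Z) (gradient (f i) Z') \<le> L * dist Z Z'" for Z Z'
    unfolding dist_norm
    by (rule order_trans[OF norm_gradient_diff mult_left_mono[OF op_norm_le_norm L_nonneg]])
qed (rule L_nonneg)

lemma continuous_on_gradient: "continuous_on S (gradient (f i))"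
  by (rule continuous_on_subset[OF lipschitz_on_continuous_on[OF lipschitz_gradient]]) simp

lemma continuous_on_gradient_avg: "continuous_on S (gradient (avg_fun f))"
  unfolding gradient_avg_fun[abs_def] mean_def by (simp add: continuous_intros continuous_on_gradient)

text \<open>A descent lemma for the dual pair of operator and nuclear norm, so that the quadratic
  term of a sign step carries no rank factor. Up to a constant, \<open>\<phi>\<close> is the excess
  over the claimed bound along the segment; duality and smoothness make its derivative
  nonpositive.\<close>

lemma avg_fun_descent:
  "avg_fun f (Z + D) \<le> avg_fun f Z + gradient (avg_fun f) Z \<bullet> D + L / 2 * (op_norm D)\<^sup>2"
proof -
  let ?g = "gradient (avg_fun f)"
  define \<phi> where "\<phi> t = avg_fun f (Z + t *\<^sub>R D) - t * (?g Z \<bullet> D) - L / 2 * t\<^sup>2 * (op_norm D)\<^sup>2" for t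
  have der: "(\<phi> has_real_derivative (?g (Z + t *\<^sub>R D) - ?g Z) \<bullet> D - L * t * (op_norm D)\<^sup>2) (at t)" for t
  proof -
    have "((\<lambda>t. Z + t *\<^sub>R D) has_derivative (\<lambda>h. h *\<^sub>R D)) (at t)"
      by (auto intro!: derivative_eq_intros)
    moreover have "(avg_fun f has_derivative (\<lambda>h. h \<bullet> ?g (Z + t *\<^sub>R D))) (at (Z + t *\<^sub>R D))"
      using GDERIV_avg_fun[of "Z + t *\<^sub>R D"] unfolding gderiv_def gradient_avg_fun .
    ultimately have "((\<lambda>t. avg_fun f (Z + t *\<^sub>R D)) has_derivative (\<lambda>h. (h *\<^sub>R D) \<bullet> ?g (Z + t *\<^sub>R D))) (at t)"
      by (rule has_derivative_compose)
    then have "((\<lambda>t. avg_fun f (Z + t *\<^sub>R D)) has_real_derivative (?g (Z + t *\<^sub>R D) \<bullet> D)) (at t)"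
      unfolding has_field_derivative_def
      by (rule has_derivative_eq_rhs) (simp add: fun_eq_iff inner_commute mult.commute)
    then show ?thesis unfolding \<phi>_def
      by (auto intro!: derivative_eq_intros simp: inner_diff_left)
  qed
  have "\<phi> 1 \<le> \<phi> 0"
  proof (rule DERIV_nonpos_imp_nonincreasing[of 0 1 \<phi>])
    fix t :: real assume t: "0 \<le> t"
    have "(?g (Z + t *\<^sub>R D) - ?g Z) \<bullet> D \<le> op_norm D * nuclear_norm (?g (Z + t *\<^sub>R D) - ?g Z)"
      by (subst inner_commute) (rule inner_le_op_norm_nuclear_norm)
    also have "\<dots> \<le> op_norm D * (L * op_norm (Z + t *\<^sub>R D - Z))"
      by (intro mult_left_mono nuclear_norm_gradient_avg_diff op_norm_nonneg)
    also have "op_norm (Z + t *\<^sub>R D - Z) = t * op_norm D"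
      using t onorm_scaleR[OF matrix_vector_mul_bounded_linear, of t D]
      by (simp add: scaleR_matrix_vector_assoc)
    finally have "(?g (Z + t *\<^sub>R D) - ?g Z) \<bullet> D - L * t * (op_norm D)\<^sup>2 \<le> 0"
      by (simp add: power2_eq_square mult_ac)
    with der[of t] show "\<exists>y. DERIV \<phi> t :> y \<and> y \<le> 0" by blast
  qed simp
  then show ?thesis by (simp add: \<phi>_def)
qed

text \<open>Cauchy-Schwarz over the agents: a sum of N block norms costs \<open>sqrt N\<close>, and
  the average divides by N.\<close>

lemma norm_mean_grad_stack_le:
  "norm (mean (grad_stack f X) - gradient (avg_fun f) (mean X)) \<le> L / sqrt (real CARD('a)) * norm (dev X)"
proof -
  let ?c = "real CARD('a)"
  have "mean (grad_stack f X) - gradient (avg_fun f) (mean X) =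
      mean (\<chi> i. gradient (f i) (X $ i) - gradient (f i) (mean X))"
    by (simp add: gradient_avg_fun mean_def grad_stack_def scaleR_diff_right sum_subtractf)
  then have "norm (mean (grad_stack f X) - gradient (avg_fun f) (mean X)) \<le>
      (\<Sum>i\<in>UNIV. norm (gradient (f i) (X $ i) - gradient (f i) (mean X))) / ?c"
    using norm_mean_le[of "\<chi> i. gradient (f i) (X $ i) - gradient (f i) (mean X)"] by simp
  also have "\<dots> \<le> (\<Sum>i\<in>UNIV. L * norm (dev X $ i)) / ?c"
    by (intro divide_right_mono sum_mono order_trans[OF norm_gradient_diff] mult_left_mono)
      (auto simp: dev_nth op_norm_le_norm L_nonneg)
  also have "\<dots> \<le> L * (sqrt ?c * norm (dev X)) / ?c"
    unfolding sum_distrib_left[symmetric]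
    by (intro divide_right_mono mult_left_mono sum_norm_stack_le L_nonneg) auto
  also have "\<dots> = L * (sqrt ?c * norm (dev X)) / (sqrt ?c * sqrt ?c)" by simp
  also have "\<dots> = L / sqrt ?c * norm (dev X)" by (simp del: real_sqrt_mult_self)
  finally show ?thesis .
qed

text \<open>Each block difference is split into its deviation parts and the common mean
  displacement. The latter is kept in operator norm, where a sign step has size at most
  \<open>\<alpha>\<close>. The pieces are recombined as vectors of block norms, so the triangle
  inequality produces \<open>sqrt N\<close> only on the mean part.\<close>

lemma norm_grad_stack_diff_le:
  assumes "op_norm (mean X' - mean X) \<le> a"
  shows "norm (grad_stack f X' - grad_stack f X) \<le>
    L * (norm (dev X') + norm (dev X) + sqrt (real CARD('a)) * a)"
proof -
  let ?r = "\<lambda>Z :: real^'n^'m^'a. (\<chi> i. norm (dev Z $ i)) :: real^'a"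
  have a: "0 \<le> a" using assms op_norm_nonneg[of "mean X' - mean X"] by linarith
  have r: "norm (?r Z) = norm (dev Z)" for Z
  proof (rule power2_eq_imp_eq)
    show "(norm (?r Z))\<^sup>2 = (norm (dev Z))\<^sup>2" unfolding norm_stack[of "?r Z"] norm_stack[of "dev Z"] by simp
  qed simp_all
  have "norm ((grad_stack f X' - grad_stack f X) $ i) \<le> (L *\<^sub>R (?r X' + ?r X + (\<chi> i. a))) $ i" for i
  proof -
    have eq: "X' $ i - X $ i = (dev X' $ i - dev X $ i) + (mean X' - mean X)" by (simp add: dev_nth)
    have "op_norm (X' $ i - X $ i) \<le> op_norm (dev X' $ i - dev X $ i) + op_norm (mean X' - mean X)"
      unfolding eq matrix_vector_mult_add_rdistrib
      by (rule onorm_triangle) (rule matrix_vector_mul_bounded_linear)+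
    also have "\<dots> \<le> norm (dev X' $ i) + norm (dev X $ i) + a"
      using op_norm_le_norm[of "dev X' $ i - dev X $ i"] norm_triangle_ineq4[of "dev X' $ i" "dev X $ i"] assms
      by linarith
    finally have "L * op_norm (X' $ i - X $ i) \<le> L * (norm (dev X' $ i) + norm (dev X $ i) + a)"
      by (rule mult_left_mono[OF _ L_nonneg])
    then show ?thesis
      using norm_gradient_diff[of i "X' $ i" "X $ i"] by (simp add: grad_stack_def)
  qed
  then have "norm (grad_stack f X' - grad_stack f X) \<le> norm (L *\<^sub>R (?r X' + ?r X + (\<chi> i. a)))"
    by (rule norm_stack_mono)
  also have "\<dots> = L * norm (?r X' + ?r X + (\<chi> i. a))" by (simp add: L_nonneg)
  also have "\<dots> \<le> L * (norm (?r X') + norm (?r X) + norm ((\<chi> i. a) :: real^'a))"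
    by (intro mult_left_mono norm_triangle_le add_mono norm_triangle_ineq L_nonneg order_refl)
  finally show ?thesis by (simp only: r norm_const_stack) (simp add: a)
qed

end

section \<open>Pathwise bounds\<close>

text \<open>The average starts at zero and its value at \<open>k\<close> uses only inputs before
  \<open>k\<close>; for the gradient noise it is therefore determined by the past and orthogonal to
  the next input. The start of the momentum at \<open>G 0\<close> is accounted for separately, in
  the initial errors.\<close>

primrec ema :: "real \<Rightarrow> (nat \<Rightarrow> 'b::real_vector) \<Rightarrow> nat \<Rightarrow> 'b" where
  "ema \<beta> \<xi> 0 = 0"
| "ema \<beta> \<xi> (Suc k) = \<beta> *\<^sub>R ema \<beta> \<xi> k + (1 - \<beta>) *\<^sub>R \<xi> k"

lemma linear_ema: "linear T \<Longrightarrow> T (ema \<beta> \<xi> k) = ema \<beta> (\<lambda>k. T (\<xi> k)) k"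
  by (induction k) (simp_all add: linear_0 linear_add linear_scale)

lemma sum_contraction_le:
  fixes a :: "nat \<Rightarrow> real"
  assumes "\<And>k. a (Suc k) \<le> q * a k + c k"
  shows "(1 - q) * (\<Sum>k<K. a k) + a K \<le> a 0 + (\<Sum>k<K. c k)"
proof (induction K)
  case (Suc K)
  then show ?case using assms[of K] by (simp add: algebra_simps)
qed simp

text \<open>Shifting the sum to \<open>a 1, ..., a K\<close> leaves the factor \<open>q\<close> on
  \<open>a 0\<close>. With \<open>q = lam\<close>, and \<open>lam\<close> also in front of the
  inputs, all consensus terms get the prefactor \<open>lam / (1 - lam)\<close>.\<close>

lemma sum_contraction_Suc_le:
  fixes a :: "nat \<Rightarrow> real"
  assumes "\<And>k. a (Suc k) \<le> q * a k + c k"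
  shows "(1 - q) * (\<Sum>k<K. a (Suc k)) + q * a K \<le> q * a 0 + (\<Sum>k<K. c k)"
proof (induction K)
  case (Suc K)
  then show ?case using assms[of K] by (simp add: algebra_simps)
qed simp

lemma sum_power_le:
  fixes q :: real
  assumes "0 \<le> q" "q < 1" shows "(\<Sum>k<K. q ^ k) \<le> 1 / (1 - q)"
proof -
  have "(1 - q) * (\<Sum>k<K. q ^ k) \<le> 1"
    using sum_contraction_le[of "\<lambda>k. q ^ k" q "\<lambda>_. 0" K] zero_le_power[OF assms(1), of K] by simp
  then show ?thesis using assms by (simp add: pos_le_divide_eq mult.commute)
qed

text \<open>A single sample path, without probability. The contraction by \<open>W\<close> and the
  zero column sums of \<open>B\<close> enter as hypotheses; they are derived from stability when the
  locale is instantiated.\<close>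

locale suda_muon_path = smooth_agents f L
  for f :: "'a::finite \<Rightarrow> real^'n^'m \<Rightarrow> real" and L :: real +
  fixes W A B C :: "real^'a^'a" and \<alpha> \<beta> lam f_inf \<gamma> v1 v2 la :: real
    and X0 :: "real^'n^'m^'a" and G M H X Y :: "nat \<Rightarrow> real^'n^'m^'a"
  assumes run: "suda_muon W A B C \<alpha> \<beta> X0 G M H X Y"
    and \<alpha>: "0 < \<alpha>" and \<beta>: "0 \<le> \<beta>" "\<beta> < 1"
    and ds: "doubly_stochastic W" "doubly_stochastic A" "doubly_stochastic C"
    and colB: "\<And>j. (\<Sum>i\<in>UNIV. B $ i $ j) = 0"
    and lam: "0 \<le> lam" "lam < 1"
    and contr: "\<And>Z :: real^'n^'m^'a. norm (dev (act W Z)) \<le> lam * norm (dev Z)"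
    and sc: "suda_constants TYPE(real^'n^'m) A B C \<gamma> v1 v2 la"
    and lower: "\<And>Z. f_inf \<le> avg_fun f Z"
begin

abbreviation "gbar \<equiv> gradient (avg_fun f)"

definition "noise k = G k - grad_stack f (X k)"
definition "noise_ema = ema \<beta> noise"

lemma
  X_0: "X 0 = X0" and M_0: "M 0 = G 0" and H_0: "H 0 = M 0"
  and M_Suc: "M (Suc k) = \<beta> *\<^sub>R M k + (1 - \<beta>) *\<^sub>R G k"
  and H_Suc: "H (Suc k) = act W (H k + M (Suc k) - M k)"
  and rec: "suda_rec A B C \<alpha> (\<lambda>k. msgn_stack (H k)) X Y"
  using run by (auto simp: suda_muon_def)

lemma X_Suc: "X (Suc k) = act A (act C (X k) - \<alpha> *\<^sub>R msgn_stack (H (Suc k))) - act B (Y k)"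
  and Y_Suc: "Y (Suc k) = Y k + act B (X (Suc k))" and Y_0: "Y 0 = 0"
  using rec by (auto simp: suda_rec_def)

lemma mean_act_stoch: "doubly_stochastic P \<Longrightarrow> mean (act P Z) = mean Z"
  for Z :: "real^'n^'m^'a"
  using mean_act[of P 1 Z] by (simp add: doubly_stochastic_def)

text \<open>\<open>A\<close> and \<open>C\<close> preserve the mean, and \<open>act B\<close> has
  mean zero by \<open>colB\<close>: the network drops out of the mean dynamics, which become a plain
  sign step.\<close>

lemma mean_X_Suc: "mean (X (Suc k)) = mean (X k) - \<alpha> *\<^sub>R mean (msgn_stack (H (Suc k)))"
  using ds mean_act[of B 0 "Y k", OF colB]
  by (simp add: X_Suc mean_diff mean_act_stoch mean_scaleR)

lemma mean_H: "mean (H k) = mean (M k)"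
  by (induction k) (simp_all add: H_0 H_Suc mean_act_stoch ds mean_diff mean_add)

lemma op_norm_mean_X_diff: "op_norm (mean (X (Suc k)) - mean (X k)) \<le> \<alpha>"
proof -
  have "mean (msgn_stack (H (Suc k))) \<in> op_ball"
    by (rule mean_in_op_ball) (simp add: msgn_stack_def msgn_in_op_ball)
  then have "\<alpha> * op_norm (mean (msgn_stack (H (Suc k)))) \<le> \<alpha> * 1"
    using \<alpha> by (intro mult_left_mono) (auto simp: op_ball_def)
  moreover have "op_norm (mean (X (Suc k)) - mean (X k)) = \<alpha> * op_norm (mean (msgn_stack (H (Suc k))))"
    using onorm_scaleR[OF matrix_vector_mul_bounded_linear, of "- \<alpha>" "mean (msgn_stack (H (Suc k)))"] \<alpha>
    by (simp add: mean_X_Suc scaleR_matrix_vector_assoc)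
  ultimately show ?thesis by simp
qed

text \<open>The right-hand side of the SUDA inequality with the supremum replaced by the universal
  bound on a stack of signs. It is deterministic, so the disagreement of \<open>X\<close> needs no
  expectation.\<close>

definition "dev_bound k = v1 * v2 * (1 + op_norm (B ** B)) * norm (dev X0) * \<gamma> ^ k +
  \<alpha> * (v1 * v2 * la / (1 - \<gamma>)) * (sqrt (real CARD('a)) * sqrt (real (min CARD('m) CARD('n))))"

lemma sc_pos: "0 < \<gamma>" "\<gamma> < 1" "1 \<le> v1" "1 \<le> v2" "0 \<le> la"
  using sc by (auto simp: suda_constants_def)

lemma norm_dev_X_le: "norm (dev (X k)) \<le> dev_bound k"
proof -
  let ?s = "SUP t\<in>{..k}. norm (dev (msgn_stack (H (Suc t))))"
  have "norm (dev (X k)) \<le> v1 * v2 * \<gamma> ^ k * (1 + op_norm (B ** B)) * norm (dev (X 0)) +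
      \<alpha> * v1 * v2 * la / (1 - \<gamma>) * ?s"
    using sc rec \<alpha> unfolding suda_constants_def by blast
  moreover have "?s \<le> sqrt (real CARD('a)) * sqrt (real (min CARD('m) CARD('n)))"
    by (rule cSUP_least) (auto intro!: order_trans[OF norm_dev_le norm_msgn_stack_le])
  then have "\<alpha> * v1 * v2 * la / (1 - \<gamma>) * ?s \<le> \<alpha> * v1 * v2 * la / (1 - \<gamma>) * (sqrt (real CARD('a)) * sqrt (real (min CARD('m) CARD('n))))"
    using sc_pos \<alpha> by (intro mult_left_mono) auto
  ultimately show ?thesis by (simp add: X_0 dev_bound_def mult_ac)
qed

lemma dev_bound_Suc_le: "dev_bound (Suc k) \<le> dev_bound k"
proof -
  have "\<gamma> ^ Suc k \<le> \<gamma> ^ k" using sc_pos by (intro power_decreasing) auto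
  then show ?thesis unfolding dev_bound_def
    using sc_pos op_norm_nonneg[of "B ** B"] by (intro add_right_mono mult_left_mono) auto
qed

lemma sum_dev_bound_le:
  "(\<Sum>k<K. dev_bound k) \<le> v1 * v2 * (1 + op_norm (B ** B)) * norm (dev X0) / (1 - \<gamma>) +
    K * (\<alpha> * (v1 * v2 * la / (1 - \<gamma>)) * (sqrt (real CARD('a)) * sqrt (real (min CARD('m) CARD('n)))))"
proof -
  have "v1 * v2 * (1 + op_norm (B ** B)) * norm (dev X0) * (\<Sum>k<K. \<gamma> ^ k) \<le>
      v1 * v2 * (1 + op_norm (B ** B)) * norm (dev X0) * (1 / (1 - \<gamma>))"
    using sc_pos op_norm_nonneg[of "B ** B"] by (intro mult_left_mono sum_power_le) auto
  then show ?thesis unfolding dev_bound_def sum.distrib sum_distrib_left[symmetric] by (simp add: mult_ac)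
qed

text \<open>The inner product of the gradient with \<open>msgn\<close> of a block of
  \<open>H\<close> would be a nuclear norm if the gradient were that block. Replacing one by the
  other costs their nuclear distance twice, in the inner product and in the nuclear norm, whence the
  factor 2; passing to Frobenius norms costs \<open>sqrt r_max\<close>. The distance is then split
  into mean tracking error and disagreement.\<close>

lemma descent_step:
  "\<alpha> * nuclear_norm (gbar (mean (X k))) \<le> avg_fun f (mean (X k)) - avg_fun f (mean (X (Suc k))) +
    L * \<alpha>\<^sup>2 / 2 + 2 * \<alpha> * sqrt (real (min CARD('m) CARD('n))) *
      (norm (mean (M (Suc k)) - gbar (mean (X k))) + norm (dev (H (Suc k))) / sqrt (real CARD('a)))"
proof -
  let ?g = "gbar (mean (X k))" and ?H = "H (Suc k)"
  let ?D = "mean (msgn_stack ?H)" and ?e = "norm (mean (M (Suc k)) - ?g)"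
  have step: "mean (X (Suc k)) = mean (X k) + (- \<alpha> *\<^sub>R ?D)" by (simp add: mean_X_Suc)
  have "op_norm (- \<alpha> *\<^sub>R ?D) \<le> \<alpha>" using op_norm_mean_X_diff[of k] unfolding step by simp
  then have "L / 2 * (op_norm (- \<alpha> *\<^sub>R ?D))\<^sup>2 \<le> L / 2 * \<alpha>\<^sup>2"
    by (intro mult_left_mono power_mono op_norm_nonneg) (use L_nonneg in auto)
  with avg_fun_descent[of "mean (X k)" "- \<alpha> *\<^sub>R ?D"]
  have d: "avg_fun f (mean (X (Suc k))) \<le> avg_fun f (mean (X k)) - \<alpha> * (?g \<bullet> ?D) + L / 2 * \<alpha>\<^sup>2"
    unfolding step[symmetric] by simp
  have block: "nuclear_norm ?g - 2 * sqrt (real (min CARD('m) CARD('n))) * (?e + norm (dev ?H $ i)) \<le> ?g \<bullet> msgn (?H $ i)" for i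
  proof -
    have "?g = ?H $ i + (?g - ?H $ i)" by simp
    then have "nuclear_norm ?g \<le> nuclear_norm (?H $ i) + nuclear_norm (?g - ?H $ i)"
      by (metis nuclear_norm_add_le)
    moreover have "msgn (?H $ i) \<bullet> (?H $ i - ?g) \<le> nuclear_norm (?H $ i - ?g)"
      by (intro inner_le_nuclear_norm msgn_in_op_ball)
    then have "nuclear_norm (?H $ i) - nuclear_norm (?H $ i - ?g) \<le> ?g \<bullet> msgn (?H $ i)"
      by (simp add: nuclear_norm_eq_inner[of "?H $ i"] inner_diff_right inner_commute[of ?g])
    moreover have "norm (?H $ i - ?g) \<le> ?e + norm (dev ?H $ i)"
      using norm_triangle_ineq[of "mean (M (Suc k)) - ?g" "dev ?H $ i"]
      by (simp add: dev_nth mean_H)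
    then have "sqrt (real (min CARD('m) CARD('n))) * norm (?H $ i - ?g) \<le> sqrt (real (min CARD('m) CARD('n))) * (?e + norm (dev ?H $ i))"
      by (intro mult_left_mono) auto
    with nuclear_norm_le_norm[of "?H $ i - ?g"] nuclear_norm_le_norm[of "?g - ?H $ i"]
    have "nuclear_norm (?H $ i - ?g) \<le> sqrt (real (min CARD('m) CARD('n))) * (?e + norm (dev ?H $ i))"
      "nuclear_norm (?g - ?H $ i) \<le> sqrt (real (min CARD('m) CARD('n))) * (?e + norm (dev ?H $ i))"
      by (simp_all only: norm_minus_commute[of ?g "?H $ i"])
    ultimately show ?thesis by simp
  qed
  have "real CARD('a) * (nuclear_norm ?g - 2 * sqrt (real (min CARD('m) CARD('n))) * ?e) - 2 * sqrt (real (min CARD('m) CARD('n))) * (\<Sum>i\<in>UNIV. norm (dev ?H $ i)) =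
      (\<Sum>i\<in>UNIV. nuclear_norm ?g - 2 * sqrt (real (min CARD('m) CARD('n))) * (?e + norm (dev ?H $ i)))"
    by (simp add: sum_subtractf sum.distrib sum_distrib_left algebra_simps)
  also have "\<dots> \<le> (\<Sum>i\<in>UNIV. ?g \<bullet> msgn (?H $ i))" by (intro sum_mono block)
  also have "\<dots> = real CARD('a) * (?g \<bullet> ?D)" by (simp add: mean_def inner_sum_right msgn_stack_def)
  finally have "real CARD('a) * (nuclear_norm ?g - 2 * sqrt (real (min CARD('m) CARD('n))) * ?e - ?g \<bullet> ?D) \<le>
      2 * sqrt (real (min CARD('m) CARD('n))) * (\<Sum>i\<in>UNIV. norm (dev ?H $ i))" by (simp add: algebra_simps)
  \<comment> \<open>Cauchy-Schwarz over the agents; after the division by N only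
    \<open>1 / sqrt N\<close> remains on the disagreement.\<close>
  also have "\<dots> \<le> 2 * sqrt (real (min CARD('m) CARD('n))) * (sqrt (real CARD('a)) * norm (dev ?H))"
    by (intro mult_left_mono sum_norm_stack_le) auto
  also have "sqrt (real CARD('a)) = real CARD('a) / sqrt (real CARD('a))" by (simp add: real_div_sqrt)
  also have "2 * sqrt (real (min CARD('m) CARD('n))) * (real CARD('a) / sqrt (real CARD('a)) * norm (dev ?H)) =
      real CARD('a) * (2 * sqrt (real (min CARD('m) CARD('n))) * (norm (dev ?H) / sqrt (real CARD('a))))"
    by (simp only: times_divide_eq_left times_divide_eq_right mult_ac)
  finally have "nuclear_norm ?g - 2 * sqrt (real (min CARD('m) CARD('n))) * ?e - ?g \<bullet> ?D \<le>
      2 * sqrt (real (min CARD('m) CARD('n))) * (norm (dev ?H) / sqrt (real CARD('a)))"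
    by (simp only: mult_le_cancel_left_pos of_nat_0_less_iff zero_less_card_finite)
  then have "nuclear_norm ?g \<le> ?g \<bullet> ?D + 2 * sqrt (real (min CARD('m) CARD('n))) * (?e + norm (dev ?H) / sqrt (real CARD('a)))"
    by (simp add: algebra_simps)
  then have "\<alpha> * nuclear_norm ?g \<le> \<alpha> * (?g \<bullet> ?D + 2 * sqrt (real (min CARD('m) CARD('n))) * (?e + norm (dev ?H) / sqrt (real CARD('a))))"
    using \<alpha> by (intro mult_left_mono) auto
  then show ?thesis using d by (simp add: algebra_simps)
qed

lemma sum_nuclear_norm_le:
  "(\<Sum>k<K. nuclear_norm (gbar (mean (X k)))) \<le> (avg_fun f (mean X0) - f_inf) / \<alpha> + K * (L * \<alpha> / 2) +
    2 * sqrt (real (min CARD('m) CARD('n))) * (\<Sum>k<K. norm (mean (M (Suc k)) - gbar (mean (X k)))) +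
    2 * sqrt (real (min CARD('m) CARD('n))) / sqrt (real CARD('a)) * (\<Sum>k<K. norm (dev (H (Suc k))))"
proof -
  have "\<alpha> * (\<Sum>k<K. nuclear_norm (gbar (mean (X k)))) \<le>
      (\<Sum>k<K. avg_fun f (mean (X k)) - avg_fun f (mean (X (Suc k))) + L * \<alpha>\<^sup>2 / 2 + 2 * \<alpha> * sqrt (real (min CARD('m) CARD('n))) *
        (norm (mean (M (Suc k)) - gbar (mean (X k))) + norm (dev (H (Suc k))) / sqrt (real CARD('a))))"
    unfolding sum_distrib_left by (intro sum_mono descent_step)
  also have "\<dots> = (avg_fun f (mean (X 0)) - avg_fun f (mean (X K))) + K * (L * \<alpha>\<^sup>2 / 2) + 2 * \<alpha> * sqrt (real (min CARD('m) CARD('n))) *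
      ((\<Sum>k<K. norm (mean (M (Suc k)) - gbar (mean (X k)))) + (\<Sum>k<K. norm (dev (H (Suc k)))) / sqrt (real CARD('a)))"
    by (simp add: sum.distrib sum_lessThan_telescope'[of "\<lambda>k. avg_fun f (mean (X k))"]
        sum_distrib_left[symmetric] sum_divide_distrib)
  also have "\<dots> \<le> (avg_fun f (mean X0) - f_inf) + K * (L * \<alpha>\<^sup>2 / 2) + 2 * \<alpha> * sqrt (real (min CARD('m) CARD('n))) *
      ((\<Sum>k<K. norm (mean (M (Suc k)) - gbar (mean (X k)))) + (\<Sum>k<K. norm (dev (H (Suc k)))) / sqrt (real CARD('a)))"
    using lower[of "mean (X K)"] by (simp add: X_0)
  also have "\<dots> = \<alpha> * ((avg_fun f (mean X0) - f_inf) / \<alpha> + K * (L * \<alpha> / 2) +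
    2 * sqrt (real (min CARD('m) CARD('n))) * (\<Sum>k<K. norm (mean (M (Suc k)) - gbar (mean (X k)))) +
    2 * sqrt (real (min CARD('m) CARD('n))) / sqrt (real CARD('a)) * (\<Sum>k<K. norm (dev (H (Suc k)))))"
    using \<alpha> by (simp add: field_simps power2_eq_square)
  finally show ?thesis using \<alpha> by (simp only: mult_le_cancel_left_pos)
qed

text \<open>Let \<open>q\<close> be the tracking error before the update, with the noise average
  removed. One update contracts it by \<open>\<beta>\<close> and mixes in the gradient disagreement
  \<open>c\<close> with weight \<open>1 - \<beta>\<close>; the move of the mean iterate adds at most
  \<open>L \<alpha>\<close>. Summing the recursion divides this drift by \<open>1 - \<beta>\<close>,
  which is the lag of the momentum.\<close>

lemma sum_tracking_le:
  "(\<Sum>k<K. norm (mean (M (Suc k)) - gbar (mean (X k)))) \<le>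
    (\<Sum>k<K. norm (mean (noise_ema (Suc k)))) + L / sqrt (real CARD('a)) * (\<Sum>k<K. dev_bound k) +
    (norm (mean (H 0) - gbar (mean (X 0))) + K * (L * \<alpha>)) / (1 - \<beta>)"
proof -
  define q where "q k = mean (M k) - gbar (mean (X k)) - mean (noise_ema k)" for k
  define c where "c k = mean (grad_stack f (X k)) - gbar (mean (X k))" for k
  have split: "mean (M (Suc k)) - gbar (mean (X k)) - mean (noise_ema (Suc k)) =
      \<beta> *\<^sub>R q k + (1 - \<beta>) *\<^sub>R c k" for k
    by (simp add: M_Suc noise_ema_def noise_def q_def c_def mean_add mean_diff mean_scaleR algebra_simps)
  have nc: "norm (c k) \<le> L / sqrt (real CARD('a)) * dev_bound k" for k
    unfolding c_def using norm_dev_X_le[of k] L_nonneg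
    by (intro order_trans[OF norm_mean_grad_stack_le] mult_left_mono) auto
  have e_le: "norm (mean (M (Suc k)) - gbar (mean (X k)) - mean (noise_ema (Suc k))) \<le>
      \<beta> * norm (q k) + (1 - \<beta>) * (L / sqrt (real CARD('a)) * dev_bound k)" for k
  proof -
    have "(1 - \<beta>) * norm (c k) \<le> (1 - \<beta>) * (L / sqrt (real CARD('a)) * dev_bound k)"
      using \<beta> by (intro mult_left_mono nc) auto
    then show ?thesis unfolding split using \<beta> norm_triangle_ineq[of "\<beta> *\<^sub>R q k" "(1 - \<beta>) *\<^sub>R c k"]
      by simp
  qed
  have "norm (q (Suc k)) \<le> \<beta> * norm (q k) + ((1 - \<beta>) * (L / sqrt (real CARD('a)) * dev_bound k) + L * \<alpha>)" for k
  proof -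
    have "q (Suc k) = (mean (M (Suc k)) - gbar (mean (X k)) - mean (noise_ema (Suc k))) +
        (gbar (mean (X k)) - gbar (mean (X (Suc k))))" by (simp add: q_def)
    then have "norm (q (Suc k)) \<le> norm (mean (M (Suc k)) - gbar (mean (X k)) - mean (noise_ema (Suc k))) +
        norm (gbar (mean (X (Suc k))) - gbar (mean (X k)))"
      by (metis norm_minus_commute norm_triangle_ineq)
    moreover have "norm (gbar (mean (X (Suc k))) - gbar (mean (X k))) \<le> L * \<alpha>"
      by (intro order_trans[OF norm_gradient_avg_diff] mult_left_mono op_norm_mean_X_diff L_nonneg)
    ultimately show ?thesis using e_le[of k] by linarith
  qed
  from sum_contraction_le[of "\<lambda>k. norm (q k)", OF this, of K]
  have "(1 - \<beta>) * (\<Sum>k<K. norm (q k)) + norm (q K) \<le> norm (q 0) + (1 - \<beta>) * (L / sqrt (real CARD('a)) * (\<Sum>k<K. dev_bound k)) + K * (L * \<alpha>)"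
    unfolding sum.distrib sum_distrib_left[symmetric] sum_constant by (simp add: mult_ac)
  then have "(1 - \<beta>) * (\<Sum>k<K. norm (q k)) \<le> norm (q 0) +
      (1 - \<beta>) * (L / sqrt (real CARD('a)) * (\<Sum>k<K. dev_bound k)) + K * (L * \<alpha>)"
    using norm_ge_zero[of "q K"] by linarith
  then have "(\<Sum>k<K. norm (q k)) \<le> L / sqrt (real CARD('a)) * (\<Sum>k<K. dev_bound k) + (norm (q 0) + K * (L * \<alpha>)) / (1 - \<beta>)"
    using \<beta> by (simp add: field_simps)
  then have "\<beta> * (\<Sum>k<K. norm (q k)) \<le> \<beta> * (L / sqrt (real CARD('a)) * (\<Sum>k<K. dev_bound k)) + \<beta> * ((norm (q 0) + K * (L * \<alpha>)) / (1 - \<beta>))"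
    using \<beta> by (metis distrib_left mult_left_mono)
  moreover have "\<beta> * ((norm (q 0) + K * (L * \<alpha>)) / (1 - \<beta>)) \<le> 1 * ((norm (q 0) + K * (L * \<alpha>)) / (1 - \<beta>))"
    using \<beta> L_nonneg \<alpha> by (intro mult_right_mono) auto
  moreover have "(\<Sum>k<K. norm (mean (M (Suc k)) - gbar (mean (X k)))) \<le>
      (\<Sum>k<K. norm (mean (noise_ema (Suc k))) + (\<beta> * norm (q k) + (1 - \<beta>) * (L / sqrt (real CARD('a)) * dev_bound k)))"
  proof (rule sum_mono)
    fix k
    show "norm (mean (M (Suc k)) - gbar (mean (X k))) \<le>
       norm (mean (noise_ema (Suc k))) + (\<beta> * norm (q k) + (1 - \<beta>) * (L / sqrt (real CARD('a)) * dev_bound k))"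
      using e_le[of k] norm_triangle_sub[of "mean (M (Suc k)) - gbar (mean (X k))" "mean (noise_ema (Suc k))"]
      by linarith
  qed
  moreover have "\<dots> = (\<Sum>k<K. norm (mean (noise_ema (Suc k)))) + \<beta> * (\<Sum>k<K. norm (q k)) +
      (1 - \<beta>) * (L / sqrt (real CARD('a)) * (\<Sum>k<K. dev_bound k))"
    by (simp add: sum.distrib sum_distrib_left)
  moreover have "q 0 = mean (H 0) - gbar (mean (X 0))"
    by (simp add: q_def noise_ema_def mean_H linear_0[OF linear_mean])
  \<comment> \<open>The disagreement enters through the history \<open>q\<close> with weight
    \<open>\<beta>\<close> and through the current \<open>c\<close> with weight
    \<open>1 - \<beta>\<close>; the weights recombine to one.\<close>
  moreover have "\<beta> * (L / sqrt (real CARD('a)) * (\<Sum>k<K. dev_bound k)) + (1 - \<beta>) * (L / sqrt (real CARD('a)) * (\<Sum>k<K. dev_bound k)) =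
      L / sqrt (real CARD('a)) * (\<Sum>k<K. dev_bound k)" by (simp only: distrib_right[symmetric]) simp
  ultimately show ?thesis by simp
qed

text \<open>A momentum increment is \<open>(1 - \<beta>) (G - M)\<close>, and its disagreement
  splits into fresh noise, noise average and the noise-free lag \<open>D\<close>. The lag contracts
  by \<open>\<beta>\<close>, so its sum is of order \<open>1 / (1 - \<beta>)\<close> times the
  gradient drift. The prefactor of the increment cancels this exactly, and only the noise keeps a
  factor \<open>1 - \<beta>\<close>.\<close>

lemma sum_dev_H_le:
  "(\<Sum>k<K. norm (dev (H (Suc k)))) \<le> lam / (1 - lam) * (norm (dev (H 0)) +
    norm (dev (grad_stack f (X 0)) - dev (M 0)) +
    (1 - \<beta>) * ((\<Sum>k<K. norm (noise k)) + (\<Sum>k<K. norm (noise_ema k))) +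
    L * (2 * (\<Sum>k<K. dev_bound k) + K * (sqrt (real CARD('a)) * \<alpha>)))"
proof -
  define D where "D k = dev (grad_stack f (X k)) - dev (M k) + dev (noise_ema k)" for k
  \<comment> \<open>The noise cancels between momentum and noise average; what is left is the change
    of the gradient stack along the step.\<close>
  have "D (Suc k) = \<beta> *\<^sub>R D k + dev (grad_stack f (X (Suc k)) - grad_stack f (X k))" for k
    by (simp add: D_def M_Suc noise_ema_def noise_def dev_add dev_diff dev_scaleR algebra_simps)
  moreover have drift: "norm (dev (grad_stack f (X (Suc k)) - grad_stack f (X k))) \<le>
      L * (2 * dev_bound k + sqrt (real CARD('a)) * \<alpha>)" for k
  proof -
    have "norm (dev (grad_stack f (X (Suc k)) - grad_stack f (X k))) \<le>
        L * (norm (dev (X (Suc k))) + norm (dev (X k)) + sqrt (real CARD('a)) * \<alpha>)"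
      by (intro order_trans[OF norm_dev_le] norm_grad_stack_diff_le op_norm_mean_X_diff)
    also have "\<dots> \<le> L * (2 * dev_bound k + sqrt (real CARD('a)) * \<alpha>)"
      using norm_dev_X_le[of k] norm_dev_X_le[of "Suc k"] dev_bound_Suc_le[of k] L_nonneg
      by (intro mult_left_mono) auto
    finally show ?thesis .
  qed
  ultimately have "norm (D (Suc k)) \<le> \<beta> * norm (D k) + L * (2 * dev_bound k + sqrt (real CARD('a)) * \<alpha>)" for k
    using \<beta> by (metis abs_of_nonneg norm_scaleR norm_triangle_le add_left_mono)
  from sum_contraction_le[of "\<lambda>k. norm (D k)", OF this, of K]
  have D: "(1 - \<beta>) * (\<Sum>k<K. norm (D k)) \<le> norm (dev (grad_stack f (X 0)) - dev (M 0)) +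
      L * (2 * (\<Sum>k<K. dev_bound k) + K * (sqrt (real CARD('a)) * \<alpha>))"
    using norm_ge_zero[of "D K"]
    by (simp add: D_def[of 0] noise_ema_def linear_0[OF linear_dev] sum.distrib sum_distrib_left[symmetric]
        del: norm_ge_zero)
  have M_diff: "norm (dev (M (Suc k) - M k)) \<le> (1 - \<beta>) * (norm (noise k) + norm (noise_ema k) + norm (D k))" for k
  proof -
    have "dev (M (Suc k) - M k) = (1 - \<beta>) *\<^sub>R (dev (noise k) - dev (noise_ema k) + D k)"
      by (simp add: M_Suc noise_def D_def dev_add dev_diff dev_scaleR algebra_simps)
    then have "norm (dev (M (Suc k) - M k)) = (1 - \<beta>) * norm (dev (noise k) - dev (noise_ema k) + D k)"
      using \<beta> by simp
    also have "\<dots> \<le> (1 - \<beta>) * (norm (noise k) + norm (noise_ema k) + norm (D k))"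
      using norm_triangle_ineq[of "dev (noise k) - dev (noise_ema k)" "D k"]
        norm_triangle_ineq4[of "dev (noise k)" "dev (noise_ema k)"] norm_dev_le[of "noise k"]
        norm_dev_le[of "noise_ema k"] \<beta>
      by (intro mult_left_mono) auto
    finally show ?thesis .
  qed
  have "norm (dev (H (Suc k))) \<le> lam * norm (dev (H k)) +
      lam * ((1 - \<beta>) * (norm (noise k) + norm (noise_ema k) + norm (D k)))" for k
  proof -
    have "norm (dev (H (Suc k))) \<le> lam * norm (dev (H k) + dev (M (Suc k) - M k))"
      using contr[of "H k + M (Suc k) - M k"] unfolding H_Suc by (simp add: dev_add dev_diff algebra_simps)
    also have "\<dots> \<le> lam * (norm (dev (H k)) + (1 - \<beta>) * (norm (noise k) + norm (noise_ema k) + norm (D k)))"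
      using M_diff[of k] lam by (intro mult_left_mono norm_triangle_le add_mono) auto
    finally show ?thesis by (simp add: distrib_left)
  qed
  from sum_contraction_Suc_le[of "\<lambda>k. norm (dev (H k))", OF this, of K]
  have "(1 - lam) * (\<Sum>k<K. norm (dev (H (Suc k)))) \<le> lam * norm (dev (H 0)) +
      lam * ((1 - \<beta>) * ((\<Sum>k<K. norm (noise k)) + (\<Sum>k<K. norm (noise_ema k)) + (\<Sum>k<K. norm (D k))))"
    using mult_nonneg_nonneg[OF lam(1) norm_ge_zero[of "dev (H K)"]]
    unfolding sum.distrib sum_distrib_left[symmetric] by linarith
  also have "\<dots> = lam * (norm (dev (H 0)) + (1 - \<beta>) * ((\<Sum>k<K. norm (noise k)) + (\<Sum>k<K. norm (noise_ema k))) +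
      (1 - \<beta>) * (\<Sum>k<K. norm (D k)))" by (simp add: algebra_simps)
  also have "\<dots> \<le> lam * (norm (dev (H 0)) + (1 - \<beta>) * ((\<Sum>k<K. norm (noise k)) + (\<Sum>k<K. norm (noise_ema k))) +
      (norm (dev (grad_stack f (X 0)) - dev (M 0)) + L * (2 * (\<Sum>k<K. dev_bound k) + K * (sqrt (real CARD('a)) * \<alpha>))))"
    using D lam by (intro mult_left_mono add_left_mono) auto
  finally show ?thesis using lam by (simp add: field_simps)
qed

end

section \<open>Conditional independence and moving averages\<close>

lemma borel_measurable_linear:
  fixes T :: "'b::euclidean_space \<Rightarrow> 'c::euclidean_space"
  assumes "linear T" shows "T \<in> borel_measurable borel"
  by (rule borel_measurable_continuous_onI) (simp add: assms linear_continuous_on linear_conv_bounded_linear[symmetric])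

lemma borel_measurable_vec_lambda:
  fixes F :: "'w \<Rightarrow> ('b::euclidean_space)^'a"
  assumes "\<And>i. (\<lambda>x. F x $ i) \<in> borel_measurable M" shows "F \<in> borel_measurable M"
proof (subst borel_measurable_euclidean_space, rule ballI)
  fix e :: "'b^'a" assume "e \<in> Basis"
  then obtain i u where "e = axis i u" by (auto simp: Basis_vec_def)
  then show "(\<lambda>x. F x \<bullet> e) \<in> borel_measurable M" using assms[of i] by (simp add: inner_axis)
qed

lemma borel_measurable_vec_nth [measurable]: "(\<lambda>Z. Z $ i) \<in> borel_measurable borel"
  for i :: "'a::finite" and Z :: "('b::euclidean_space)^'a"
  by (rule borel_measurable_continuous_onI) (intro continuous_intros)

lemma borel_measurable_msgn_stack:
  "(msgn_stack :: real^'n^'m^'a \<Rightarrow> real^'n^'m^'a) \<in> borel_measurable borel"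
  by (rule borel_measurable_vec_lambda)
    (simp add: msgn_stack_def measurable_compose[OF borel_measurable_vec_nth borel_measurable_msgn])

lemma integrable_mult_L2:
  fixes f g :: "'w \<Rightarrow> real"
  assumes [measurable]: "f \<in> borel_measurable M" "g \<in> borel_measurable M"
    and "integrable M (\<lambda>x. (f x)\<^sup>2)" "integrable M (\<lambda>x. (g x)\<^sup>2)"
  shows "integrable M (\<lambda>x. f x * g x)"
proof (rule Bochner_Integration.integrable_bound)
  show "integrable M (\<lambda>x. (f x)\<^sup>2 + (g x)\<^sup>2)" using assms by simp
  show "AE x in M. norm (f x * g x) \<le> norm ((f x)\<^sup>2 + (g x)\<^sup>2)"
  proof (rule AE_I2)
    fix x
    have "2 * \<bar>f x * g x\<bar> \<le> (f x)\<^sup>2 + (g x)\<^sup>2"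
      using sum_squares_bound[of "\<bar>f x\<bar>" "\<bar>g x\<bar>"] by (simp add: abs_mult)
    then show "norm (f x * g x) \<le> norm ((f x)\<^sup>2 + (g x)\<^sup>2)" by simp
  qed
qed simp

context prob_space
begin

lemma sigma_finite_subalgebra:
  assumes "subalgebra M F" shows "sigma_finite_subalgebra M F"
  using finite_measure_subalgebra_is_sigma_finite[of M F] assms finite_measure_axioms
  by (simp add: finite_measure_subalgebra_def finite_measure_subalgebra_axioms_def)

lemma integral_norm_le_sqrt:
  fixes n :: "'a \<Rightarrow> 'b::euclidean_space"
  assumes n [measurable]: "n \<in> borel_measurable M" and sq: "integrable M (\<lambda>x. (norm (n x))\<^sup>2)"
    and V: "(\<integral>x. (norm (n x))\<^sup>2 \<partial>M) \<le> V"
  shows "integrable M n" "(\<integral>x. norm (n x) \<partial>M) \<le> sqrt V"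
proof -
  have "integrable M (\<lambda>x. norm (n x) * 1)" by (rule integrable_mult_L2) (use sq in auto)
  then have i: "integrable M (\<lambda>x. norm (n x))" by simp
  then show "integrable M n" by (simp add: integrable_norm_iff)
  let ?c = "\<integral>x. norm (n x) \<partial>M"
  have "0 \<le> (\<integral>x. (norm (n x) - ?c)\<^sup>2 \<partial>M)" by simp
  also have "\<dots> = (\<integral>x. (norm (n x))\<^sup>2 - 2 * ?c * norm (n x) + ?c\<^sup>2 \<partial>M)"
    by (simp add: power2_diff algebra_simps)
  also have "\<dots> = (\<integral>x. (norm (n x))\<^sup>2 \<partial>M) - ?c\<^sup>2"
    using i sq by (simp add: prob_space power2_eq_square)
  finally have "?c\<^sup>2 \<le> V" using V by simp
  then show "?c \<le> sqrt V" by (rule real_le_rsqrt)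
qed

text \<open>The last hypothesis says that \<open>Z\<close> has conditional mean zero given the
  \<sigma>-algebra generated by \<open>g\<close>, tested on its events. As \<open>g\<close> is
  measurable for that algebra, it can be pulled through the conditional expectation, which replaces
  an approximation of \<open>g\<close> by simple functions.\<close>

lemma integral_mult_eq_0I:
  fixes g Z :: "'a \<Rightarrow> real"
  assumes g [measurable]: "g \<in> borel_measurable M" and Z: "integrable M Z" and gZ: "integrable M (\<lambda>x. g x * Z x)"
    and 0: "\<And>S. S \<in> sets borel \<Longrightarrow> (\<integral>x. indicator {x \<in> space M. g x \<in> S} x * Z x \<partial>M) = 0"
  shows "(\<integral>x. g x * Z x \<partial>M) = 0"
proof -
  let ?V = "vimage_algebra (space M) g borel"
  have "subalgebra M ?V"
    unfolding subalgebra_def by (auto simp: sets_vimage_algebra2)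
  then interpret V: sigma_finite_subalgebra M ?V by (rule sigma_finite_subalgebra)
  have gV: "g \<in> borel_measurable ?V" by (rule measurable_vimage_algebra1) simp
  have "AE x in M. real_cond_exp M ?V Z x = 0"
  proof (rule V.real_cond_exp_charact)
    fix A assume "A \<in> sets ?V"
    then obtain S where S: "S \<in> sets borel" "A = g -` S \<inter> space M" by (auto simp: sets_vimage_algebra2)
    then have A: "A = {x \<in> space M. g x \<in> S}" by auto
    show "set_lebesgue_integral M A Z = set_lebesgue_integral M A (\<lambda>x. 0)"
      using 0[OF S(1)] by (simp add: set_lebesgue_integral_def A)
  qed (use Z in auto)
  then have "(\<integral>x. g x * real_cond_exp M ?V Z x \<partial>M) = (\<integral>x. 0 \<partial>M)"
    by (intro integral_cong_AE) (auto intro: measurable_from_subalg[OF V.subalg gV])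
  moreover have "(\<integral>x. g x * real_cond_exp M ?V Z x \<partial>M) = (\<integral>x. g x * Z x \<partial>M)"
    by (rule V.real_cond_exp_intg[OF gZ gV]) (use Z in auto)
  ultimately show ?thesis by simp
qed

text \<open>
  The factorisation of conditional probabilities passes to the product of \<open>g - E[g | F]\<close> and \<open>h\<close>
  by testing first against the events of \<open>\<sigma>(g)\<close>, then against those of \<open>\<sigma>(h)\<close>.
\<close>

lemma cond_indep_uncorrelated:
  fixes g h :: "'a \<Rightarrow> real"
  assumes F: "subalgebra M F" and g: "integrable M g" and h [measurable]: "h \<in> borel_measurable M"
    and prod: "integrable M (\<lambda>x. h x * (g x - real_cond_exp M F g x))"
    and ci: "\<And>S T. S \<in> sets borel \<Longrightarrow> T \<in> sets borel \<Longrightarrow>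
      AE x in M. real_cond_exp M F (indicator {x \<in> space M. g x \<in> S \<and> h x \<in> T}) x =
        real_cond_exp M F (indicator {x \<in> space M. g x \<in> S}) x *
        real_cond_exp M F (indicator {x \<in> space M. h x \<in> T}) x"
  shows "(\<integral>x. h x * (g x - real_cond_exp M F g x) \<partial>M) = 0"
proof (rule integral_mult_eq_0I[OF h])
  interpret F: sigma_finite_subalgebra M F by (rule sigma_finite_subalgebra[OF F])
  have [measurable]: "g \<in> borel_measurable M" using g by simp
  have gint: "integrable M (real_cond_exp M F g)" by (rule F.real_cond_exp_int(1)[OF g])
  show "integrable M (\<lambda>x. g x - real_cond_exp M F g x)" using g gint by simp
  show "integrable M (\<lambda>x. h x * (g x - real_cond_exp M F g x))" by (rule prod)
  fix T :: "real set" assume T [measurable]: "T \<in> sets borel"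
  let ?T = "{x \<in> space M. h x \<in> T}"
  let ?b = "indicator ?T :: 'a \<Rightarrow> real"
  let ?pT = "real_cond_exp M F ?b"
  have bint: "integrable M ?b" by (intro integrable_real_indicator) (auto simp: emeasure_eq_measure)
  have pT0: "AE x in M. 0 \<le> ?pT x" by (rule F.real_cond_exp_pos) (auto simp: indicator_def)
  have pT1: "AE x in M. ?pT x \<le> 1" using bint by (intro F.real_cond_exp_le_c) (auto simp: indicator_def)
  have pTm: "?pT \<in> borel_measurable F" "?pT \<in> borel_measurable M" by auto
  \<comment> \<open>\<open>?pT\<close> lies in [0, 1] almost everywhere, so multiplying by it keeps
    integrability, also for \<open>g\<close>, which is merely integrable.\<close>
  have bdd: "integrable M (\<lambda>x. ?pT x * k x)" if k: "integrable M k" for k :: "'a \<Rightarrow> real"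
  proof (rule Bochner_Integration.integrable_bound[OF k])
    show "(\<lambda>x. ?pT x * k x) \<in> borel_measurable M" using k pTm by auto
    show "AE x in M. norm (?pT x * k x) \<le> norm (k x)"
      using pT0 pT1 by eventually_elim (simp add: abs_mult mult_left_le_one_le)
  qed
  have ind: "integrable M (\<lambda>x. ?b x * k x)" if k: "integrable M k" for k :: "'a \<Rightarrow> real"
    using integrable_real_mult_indicator[OF _ k, of ?T] by (simp add: mult.commute)
  \<comment> \<open>In integrals against \<open>g\<close>, the indicator of \<open>h \<in> T\<close>
    may be replaced by its conditional probability; on events of \<open>g\<close> this is the
    factorisation \<open>ci\<close> after integration.\<close>
  have "(\<integral>x. g x * (?b x - ?pT x) \<partial>M) = 0"
  proof (rule integral_mult_eq_0I)
    show "integrable M (\<lambda>x. ?b x - ?pT x)" using bint F.real_cond_exp_int(1)[OF bint] by simp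
    show "integrable M (\<lambda>x. g x * (?b x - ?pT x))"
      using bdd[OF g] ind[OF g] by (simp add: right_diff_distrib mult.commute)
    fix S :: "real set" assume S [measurable]: "S \<in> sets borel"
    let ?S = "{x \<in> space M. g x \<in> S}"
    let ?a = "indicator ?S :: 'a \<Rightarrow> real"
    have aint: "integrable M ?a" by (intro integrable_real_indicator) (auto simp: emeasure_eq_measure)
    have ab: "(\<lambda>x. ?a x * ?b x) = indicator {x \<in> space M. g x \<in> S \<and> h x \<in> T}"
      by (auto simp: fun_eq_iff indicator_def)
    have abint: "integrable M (\<lambda>x. ?a x * ?b x)" using ind[OF aint] by (simp add: mult.commute)
    have "(\<integral>x. ?a x * ?b x \<partial>M) = (\<integral>x. real_cond_exp M F (\<lambda>x. ?a x * ?b x) x \<partial>M)"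
      by (rule F.real_cond_exp_int(2)[OF abint, symmetric])
    also have "\<dots> = (\<integral>x. ?pT x * real_cond_exp M F ?a x \<partial>M)"
      using ci[OF S T] unfolding ab by (intro integral_cong_AE) (auto simp: mult.commute)
    also have "\<dots> = (\<integral>x. ?pT x * ?a x \<partial>M)"
      by (rule F.real_cond_exp_intg(2)[OF bdd[OF aint] pTm(1)]) simp
    finally have "(\<integral>x. ?a x * ?b x \<partial>M) = (\<integral>x. ?a x * ?pT x \<partial>M)" by (simp add: mult.commute)
    moreover have "integrable M (\<lambda>x. ?a x * ?pT x)" using bdd[OF aint] by (simp add: mult.commute)
    ultimately show "(\<integral>x. ?a x * (?b x - ?pT x) \<partial>M) = 0"
      using abint by (simp add: right_diff_distrib)
  qed simp
  then have "(\<integral>x. ?b x * g x \<partial>M) = (\<integral>x. ?pT x * g x \<partial>M)"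
    using bdd[OF g] ind[OF g] by (simp add: right_diff_distrib mult.commute)
  \<comment> \<open>Conditional expectation is self-adjoint: it is moved from the indicator to
    \<open>g\<close>.\<close>
  also have "\<dots> = (\<integral>x. real_cond_exp M F g x * ?pT x \<partial>M)"
    using F.real_cond_exp_intg(2)[OF bdd[OF g] pTm(1)] by (simp add: mult.commute)
  also have "\<dots> = (\<integral>x. real_cond_exp M F g x * ?b x \<partial>M)"
    using ind[OF gint] by (intro F.real_cond_exp_intg(2)) (auto simp: mult.commute)
  finally show "(\<integral>x. ?b x * (g x - real_cond_exp M F g x) \<partial>M) = 0"
    using ind[OF g] ind[OF gint] by (simp add: algebra_simps)
qed

text \<open>Since \<open>n k\<close> is known before step \<open>k\<close>, the cross term vanishes,
  and a second moment \<open>a\<close> is followed by at most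
  \<open>\<beta>^2 a + (1 - \<beta>)^2 V\<close>. The bound \<open>(1 - \<beta>) V\<close> is
  preserved because \<open>\<beta>^2 + (1 - \<beta>) \<le> 1\<close>. The triangle inequality alone
  would give \<open>V\<close>, without the small factor on which the leading rate rests.\<close>

lemma ema_second_moment:
  fixes \<zeta> :: "nat \<Rightarrow> 'a \<Rightarrow> 'b::euclidean_space"
  assumes \<beta>: "0 \<le> \<beta>" "\<beta> < 1"
    and F: "\<And>k. subalgebra M (F k)" "\<And>k. subalgebra (F (Suc k)) (F k)"
    and meas: "\<And>k. \<zeta> k \<in> borel_measurable (F (Suc k))"
    and sq: "\<And>k. integrable M (\<lambda>x. (norm (\<zeta> k x))\<^sup>2)"
    and V: "\<And>k. (\<integral>x. (norm (\<zeta> k x))\<^sup>2 \<partial>M) \<le> V"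
    and orth: "\<And>k n. n \<in> borel_measurable (F k) \<Longrightarrow> integrable M (\<lambda>x. (norm (n x))\<^sup>2) \<Longrightarrow>
      (\<integral>x. n x \<bullet> \<zeta> k x \<partial>M) = 0"
  defines "n \<equiv> \<lambda>k x. ema \<beta> (\<lambda>k. \<zeta> k x) k"
  shows "n k \<in> borel_measurable (F k)" "integrable M (\<lambda>x. (norm (n k x))\<^sup>2)"
    "(\<integral>x. (norm (n k x))\<^sup>2 \<partial>M) \<le> (1 - \<beta>) * V"
proof -
  have V0: "0 \<le> V" using V[of 0] by (meson Bochner_Integration.integral_nonneg order_trans zero_le_power2)
  have "n k \<in> borel_measurable (F k) \<and> integrable M (\<lambda>x. (norm (n k x))\<^sup>2) \<and>
    (\<integral>x. (norm (n k x))\<^sup>2 \<partial>M) \<le> (1 - \<beta>) * V"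
  proof (induction k)
    case 0
    then show ?case using V0 \<beta> by (simp add: n_def)
  next
    case (Suc k)
    have nS: "n (Suc k) = (\<lambda>x. \<beta> *\<^sub>R n k x + (1 - \<beta>) *\<^sub>R \<zeta> k x)" by (simp add: n_def fun_eq_iff)
    have nF: "n k \<in> borel_measurable (F (Suc k))" using Suc measurable_from_subalg[OF F(2)] by blast
    have nM [measurable]: "n k \<in> borel_measurable M" using nF measurable_from_subalg[OF F(1)] by blast
    have zM [measurable]: "\<zeta> k \<in> borel_measurable M" using meas measurable_from_subalg[OF F(1)] by blast
    have inn: "integrable M (\<lambda>x. n k x \<bullet> \<zeta> k x)"
    proof (rule Bochner_Integration.integrable_bound)
      show "integrable M (\<lambda>x. norm (n k x) * norm (\<zeta> k x))"
        using Suc sq by (intro integrable_mult_L2) auto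
      show "AE x in M. norm (n k x \<bullet> \<zeta> k x) \<le> norm (norm (n k x) * norm (\<zeta> k x))"
        by (simp add: Cauchy_Schwarz_ineq2)
    qed simp
    have exp: "(norm (n (Suc k) x))\<^sup>2 = \<beta>\<^sup>2 * (norm (n k x))\<^sup>2 + 2 * \<beta> * (1 - \<beta>) * (n k x \<bullet> \<zeta> k x) +
        (1 - \<beta>)\<^sup>2 * (norm (\<zeta> k x))\<^sup>2" for x
      unfolding nS power2_norm_eq_inner
      by (simp add: inner_add_left inner_add_right inner_commute power2_eq_square algebra_simps)
    have i: "integrable M (\<lambda>x. (norm (n (Suc k) x))\<^sup>2)"
      unfolding exp using Suc sq[of k] inn by auto
    have "(\<integral>x. (norm (n (Suc k) x))\<^sup>2 \<partial>M) = \<beta>\<^sup>2 * (\<integral>x. (norm (n k x))\<^sup>2 \<partial>M) +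
        2 * \<beta> * (1 - \<beta>) * (\<integral>x. n k x \<bullet> \<zeta> k x \<partial>M) + (1 - \<beta>)\<^sup>2 * (\<integral>x. (norm (\<zeta> k x))\<^sup>2 \<partial>M)"
      unfolding exp using Suc sq[of k] inn by simp
    also have "(\<integral>x. n k x \<bullet> \<zeta> k x \<partial>M) = 0" using Suc by (intro orth) auto
    also have "\<beta>\<^sup>2 * (\<integral>x. (norm (n k x))\<^sup>2 \<partial>M) + 2 * \<beta> * (1 - \<beta>) * 0 + (1 - \<beta>)\<^sup>2 * (\<integral>x. (norm (\<zeta> k x))\<^sup>2 \<partial>M) \<le>
        \<beta>\<^sup>2 * ((1 - \<beta>) * V) + (1 - \<beta>)\<^sup>2 * V"
      using Suc V[of k] by (auto intro!: add_mono mult_left_mono)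
    also have "\<dots> = (1 - \<beta>) * V * (\<beta>\<^sup>2 + (1 - \<beta>))" by (simp add: power2_eq_square algebra_simps)
    also have "\<dots> \<le> (1 - \<beta>) * V * 1"
      using \<beta> V0 by (intro mult_left_mono) (auto simp: power2_eq_square mult_left_le)
    finally have "(\<integral>x. (norm (n (Suc k) x))\<^sup>2 \<partial>M) \<le> (1 - \<beta>) * V" by simp
    moreover have "n (Suc k) \<in> borel_measurable (F (Suc k))" unfolding nS using nF meas by auto
    ultimately show ?case using i by blast
  qed
  then show "n k \<in> borel_measurable (F k)" "integrable M (\<lambda>x. (norm (n k x))\<^sup>2)"
    "(\<integral>x. (norm (n k x))\<^sup>2 \<partial>M) \<le> (1 - \<beta>) * V" by auto
qed

end

section \<open>The stochastic process\<close>

context suda_muon_path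
begin

text \<open>A deterministic radius for each step. Its growth in \<open>k\<close> is harmless: it
  never enters the rate and only serves to make continuous functions of \<open>X k\<close> bounded,
  hence integrable.\<close>

definition "X_bound k = dev_bound k + sqrt (real CARD('a)) *
  (norm (mean X0) + k * (\<alpha> * sqrt (real (min CARD('m) CARD('n)))))"

lemma norm_X_le: "norm (X k) \<le> X_bound k"
proof -
  let ?s = "sqrt (real (min CARD('m) CARD('n)))"
  have msgn: "norm (mean (msgn_stack Z)) \<le> ?s" for Z :: "real^'n^'m^'a"
  proof -
    have "(\<Sum>i\<in>UNIV. norm (msgn_stack Z $ i)) \<le> real CARD('a) * ?s"
      by (rule sum_bounded_above) (simp only: msgn_stack_def vec_lambda_beta norm_msgn_le)
    moreover have "real CARD('a) * norm (mean (msgn_stack Z)) \<le> (\<Sum>i\<in>UNIV. norm (msgn_stack Z $ i))"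
      using norm_mean_le[of "msgn_stack Z"] by (simp add: pos_le_divide_eq mult.commute)
    ultimately have "real CARD('a) * norm (mean (msgn_stack Z)) \<le> real CARD('a) * ?s" by linarith
    then show ?thesis by (simp only: mult_le_cancel_left_pos of_nat_0_less_iff zero_less_card_finite)
  qed
  have "norm (mean (X k)) \<le> norm (mean X0) + k * (\<alpha> * ?s)"
  proof (induction k)
    case (Suc k)
    have "norm (mean (X (Suc k))) \<le> norm (mean (X k)) + \<alpha> * norm (mean (msgn_stack (H (Suc k))))"
      unfolding mean_X_Suc using \<alpha> norm_triangle_ineq4[of "mean (X k)" "\<alpha> *\<^sub>R mean (msgn_stack (H (Suc k)))"] by simp
    moreover have "\<alpha> * norm (mean (msgn_stack (H (Suc k)))) \<le> \<alpha> * ?s"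
      using \<alpha> by (intro mult_left_mono msgn) auto
    ultimately show ?case using Suc by (simp add: algebra_simps)
  qed (simp add: X_0)
  then have "sqrt (real CARD('a)) * norm (mean (X k)) \<le> sqrt (real CARD('a)) * (norm (mean X0) + k * (\<alpha> * ?s))"
    by (intro mult_left_mono) auto
  moreover have "X k = dev (X k) + (\<chi> i. mean (X k))" by (simp add: vec_eq_iff dev_nth)
  then have "norm (X k) \<le> norm (dev (X k)) + norm ((\<chi> i. mean (X k)) :: real^'n^'m^'a)"
    by (metis norm_triangle_ineq)
  ultimately show ?thesis using norm_dev_X_le[of k] unfolding X_bound_def norm_const_stack by linarith
qed

end

locale suda_muon_process = smooth_agents f L + prob_space P
  for f :: "'a::finite \<Rightarrow> real^'n^'m \<Rightarrow> real" and L :: real and P :: "'w measure" +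
  fixes W A B C :: "real^'a^'a" and \<alpha> \<beta> lam f_inf \<gamma> v1 v2 la \<sigma> :: real
    and X0 :: "real^'n^'m^'a" and G M H X Y :: "nat \<Rightarrow> 'w \<Rightarrow> real^'n^'m^'a"
  assumes path: "\<And>\<omega>. suda_muon_path f L W A B C \<alpha> \<beta> lam f_inf \<gamma> v1 v2 la X0
      (\<lambda>k. G k \<omega>) (\<lambda>k. M k \<omega>) (\<lambda>k. H k \<omega>) (\<lambda>k. X k \<omega>) (\<lambda>k. Y k \<omega>)"
    and stoch: "stochastic_oracle P f \<sigma> X G" and \<sigma>: "0 \<le> \<sigma>"
begin

abbreviation "F \<equiv> nat_filt P G"

definition "\<xi> k \<omega> = G k \<omega> - grad_stack f (X k \<omega>)"

lemma G_integrable: "integrable P (G k)"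
  using stoch unfolding stochastic_oracle_def by blast

lemma G_measurable [measurable]: "G k \<in> borel_measurable P"
  using G_integrable by auto

section \<open>The natural filtration and adaptedness of the run\<close>

lemma nat_filt_gen: "{G j -` S \<inter> space P |j S. j < k \<and> S \<in> sets borel} \<subseteq> sets P"
  using G_measurable measurable_sets by blast

lemma space_F [simp]: "space (F k) = space P"
  by (simp add: nat_filt_def space_measure_of_conv)

lemma sets_F: "sets (F k) = sigma_sets (space P) {G j -` S \<inter> space P |j S. j < k \<and> S \<in> sets borel}"
  unfolding nat_filt_def by (rule sets_measure_of) auto

lemma subalgebra_F: "subalgebra P (F k)"
  unfolding subalgebra_def sets_F using sets.sigma_sets_subset[OF nat_filt_gen] by simp

lemma subalgebra_F_mono: "j \<le> k \<Longrightarrow> subalgebra (F k) (F j)"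
proof -
  assume "j \<le> k"
  then have "{G i -` S \<inter> space P |i S. i < j \<and> S \<in> sets borel} \<subseteq>
      {G i -` S \<inter> space P |i S. i < k \<and> S \<in> sets borel}" by (auto dest: less_le_trans)
  then show ?thesis unfolding subalgebra_def sets_F by (simp add: sigma_sets_subseteq)
qed

lemma F_mono: "g \<in> borel_measurable (F j) \<Longrightarrow> j \<le> k \<Longrightarrow> g \<in> borel_measurable (F k)"
  using measurable_from_subalg[OF subalgebra_F_mono] .

lemma F_measurable: "g \<in> borel_measurable (F k) \<Longrightarrow> g \<in> borel_measurable P"
  by (rule measurable_from_subalg[OF subalgebra_F])

lemma G_F: "j < k \<Longrightarrow> G j \<in> borel_measurable (F k)"
  by (rule measurableI) (auto simp: sets_F intro!: sigma_sets.Basic)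

lemma F_compose: "T \<in> borel_measurable borel \<Longrightarrow> g \<in> borel_measurable (F k) \<Longrightarrow> (\<lambda>\<omega>. T (g \<omega>)) \<in> borel_measurable (F k)"
  by (rule measurable_compose)

lemmas act_measurable = F_compose[OF borel_measurable_linear[OF linear_act]]

text \<open>The statement puts \<open>M k\<close> and \<open>H k\<close> one stage later than
  \<open>X k\<close> because of the start: \<open>M 0 = G 0\<close> is known only at stage 1.
  Afterwards \<open>M (Suc k)\<close> uses nothing newer than \<open>G k\<close>, so in the
  induction it and \<open>H (Suc k)\<close> are first obtained at stage \<open>Suc k\<close>, as
  \<open>X (Suc k)\<close> requires, and weakened at the end.\<close>

lemma run_measurable:
  "X k \<in> borel_measurable (F k) \<and> Y k \<in> borel_measurable (F k) \<and>
    M k \<in> borel_measurable (F (Suc k)) \<and> H k \<in> borel_measurable (F (Suc k))"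
proof (induction k)
  case 0
  have "X 0 = (\<lambda>\<omega>. X0)" "Y 0 = (\<lambda>\<omega>. 0)" "M 0 = G 0" "H 0 = G 0"
    using suda_muon_path.X_0[OF path] suda_muon_path.Y_0[OF path] suda_muon_path.M_0[OF path]
      suda_muon_path.H_0[OF path] by (auto simp: fun_eq_iff)
  then show ?case by (simp add: G_F)
next
  case (Suc k)
  have M: "M (Suc k) = (\<lambda>\<omega>. \<beta> *\<^sub>R M k \<omega> + (1 - \<beta>) *\<^sub>R G k \<omega>)"
    using suda_muon_path.M_Suc[OF path] by (simp add: fun_eq_iff)
  have H: "H (Suc k) = (\<lambda>\<omega>. act W (H k \<omega> + M (Suc k) \<omega> - M k \<omega>))"
    using suda_muon_path.H_Suc[OF path] by (simp add: fun_eq_iff)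
  have X: "X (Suc k) = (\<lambda>\<omega>. act A (act C (X k \<omega>) - \<alpha> *\<^sub>R msgn_stack (H (Suc k) \<omega>)) - act B (Y k \<omega>))"
    using suda_muon_path.X_Suc[OF path] by (simp add: fun_eq_iff)
  have Y: "Y (Suc k) = (\<lambda>\<omega>. Y k \<omega> + act B (X (Suc k) \<omega>))"
    using suda_muon_path.Y_Suc[OF path] by (simp add: fun_eq_iff)
  have "X k \<in> borel_measurable (F (Suc k))" "Y k \<in> borel_measurable (F (Suc k))"
    using Suc F_mono[of _ k "Suc k"] by auto
  note [measurable] = this conjunct1[OF conjunct2[OF conjunct2[OF Suc.IH]]] conjunct2[OF conjunct2[OF conjunct2[OF Suc.IH]]]
    G_F[of k "Suc k", simplified]
  have 1 [measurable]: "M (Suc k) \<in> borel_measurable (F (Suc k))" unfolding M by simp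
  have 2 [measurable]: "H (Suc k) \<in> borel_measurable (F (Suc k))" unfolding H by (rule act_measurable) simp
  have "(\<lambda>\<omega>. act C (X k \<omega>)) \<in> borel_measurable (F (Suc k))" "(\<lambda>\<omega>. act B (Y k \<omega>)) \<in> borel_measurable (F (Suc k))"
    by (rule act_measurable, simp)+
  note [measurable] = this F_compose[OF borel_measurable_msgn_stack 2]
  have 3 [measurable]: "X (Suc k) \<in> borel_measurable (F (Suc k))"
    unfolding X by (intro borel_measurable_diff act_measurable) simp_all
  have [measurable]: "(\<lambda>\<omega>. act B (X (Suc k) \<omega>)) \<in> borel_measurable (F (Suc k))" by (rule act_measurable) simp
  have "Y (Suc k) \<in> borel_measurable (F (Suc k))" unfolding Y by simp
  then show ?case using 3 F_mono[OF 1 le_SucI[OF order_refl]] F_mono[OF 2 le_SucI[OF order_refl]] by blast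
qed

lemma X_F: "X k \<in> borel_measurable (F k)" using run_measurable by blast

lemma grad_F: "(\<lambda>\<omega>. gradient (f i) (X k \<omega> $ i)) \<in> borel_measurable (F k)"
proof -
  have "(\<lambda>Z. gradient (f i) (Z $ i)) \<in> borel_measurable borel"
    by (rule borel_measurable_continuous_onI, rule continuous_on_compose2[OF continuous_on_gradient[of UNIV]])
      (auto intro: continuous_intros)
  from F_compose[OF this X_F] show ?thesis .
qed

lemma grad_stack_F: "(\<lambda>\<omega>. grad_stack f (X k \<omega>)) \<in> borel_measurable (F k)"
  by (rule borel_measurable_vec_lambda) (simp add: grad_stack_def grad_F)

lemma \<xi>_F: "\<xi> k \<in> borel_measurable (F (Suc k))"
  unfolding \<xi>_def[abs_def]
  by (intro borel_measurable_diff G_F F_mono[OF grad_stack_F]) auto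

lemma \<xi>_measurable [measurable]: "\<xi> k \<in> borel_measurable P"
  by (rule F_measurable[OF \<xi>_F])

definition "xbound k = suda_muon_path.X_bound B \<alpha> \<gamma> v1 v2 la X0 k"

lemma norm_X_le: "norm (X k \<omega>) \<le> xbound k"
  unfolding xbound_def by (rule suda_muon_path.norm_X_le[OF path])

lemma continuous_bounded_X:
  fixes g :: "real^'n^'m^'a \<Rightarrow> 'b::real_normed_vector"
  assumes "continuous_on UNIV g"
  obtains c where "\<And>\<omega>. norm (g (X k \<omega>)) \<le> c"
proof -
  have "compact (g ` cball 0 (xbound k))"
    by (intro compact_continuous_image compact_cball continuous_on_subset[OF assms]) auto
  then have "bounded (g ` cball 0 (xbound k))" by (rule compact_imp_bounded)
  then obtain c where c: "\<forall>y\<in>g ` cball 0 (xbound k). norm y \<le> c" unfolding bounded_iff ..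
  show ?thesis
  proof (rule that)
    show "norm (g (X k \<omega>)) \<le> c" for \<omega>
      by (rule bspec[OF c], rule imageI) (simp add: norm_X_le)
  qed
qed

lemma continuous_integrable_X:
  fixes g :: "real^'n^'m^'a \<Rightarrow> 'b::{banach, second_countable_topology}"
  assumes "continuous_on UNIV g"
  shows "integrable P (\<lambda>\<omega>. g (X k \<omega>))"
proof -
  obtain c where "\<And>\<omega>. norm (g (X k \<omega>)) \<le> c" using continuous_bounded_X[OF assms, where k = k] by metis
  moreover have "(\<lambda>\<omega>. g (X k \<omega>)) \<in> borel_measurable P"
    by (rule measurable_compose[OF F_measurable[OF X_F] borel_measurable_continuous_onI[OF assms]])
  ultimately show ?thesis by (intro integrable_const_bound[of _ c]) auto
qed

lemma continuous_on_grad_entry: "continuous_on UNIV (\<lambda>Z. gradient (f i) (Z $ i) $ a $ b)"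
  by (intro continuous_intros continuous_on_compose2[OF continuous_on_gradient[of UNIV]]) auto

section \<open>Second moments and orthogonality of the gradient noise\<close>

lemma \<xi>_block_sq:
  "integrable P (\<lambda>\<omega>. (norm (\<xi> k \<omega> $ i))\<^sup>2)" "(\<integral>\<omega>. (norm (\<xi> k \<omega> $ i))\<^sup>2 \<partial>P) \<le> \<sigma>\<^sup>2"
proof -
  interpret F: sigma_finite_subalgebra P "F k" by (rule sigma_finite_subalgebra[OF subalgebra_F])
  let ?g = "\<lambda>\<omega>. (norm (\<xi> k \<omega> $ i))\<^sup>2"
  have [measurable]: "?g \<in> borel_measurable P" by measurable
  have eq: "?g \<omega> = (norm (G k \<omega> $ i - gradient (f i) (X k \<omega> $ i)))\<^sup>2" for \<omega>
    by (simp add: \<xi>_def grad_stack_def)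
  \<comment> \<open>Integrating the conditional variance against the constant 1 makes the bound
    unconditional. Working in \<open>ennreal\<close> yields integrability as a consequence instead
    of requiring it first.\<close>
  have "(\<integral>\<^sup>+\<omega>. ennreal (?g \<omega>) \<partial>P) = (\<integral>\<^sup>+\<omega>. 1 * nn_cond_exp P (F k) (\<lambda>\<omega>. ennreal (?g \<omega>)) \<omega> \<partial>P)"
    by (subst F.nn_cond_exp_intg) auto
  also have "\<dots> \<le> (\<integral>\<^sup>+\<omega>. ennreal (\<sigma>\<^sup>2) \<partial>P)"
    using stoch unfolding stochastic_oracle_def eq by (intro nn_integral_mono_AE) auto
  also have "\<dots> = ennreal (\<sigma>\<^sup>2)" by (simp add: emeasure_space_1)
  finally have le: "(\<integral>\<^sup>+\<omega>. ennreal (?g \<omega>) \<partial>P) \<le> ennreal (\<sigma>\<^sup>2)" .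
  then show i: "integrable P ?g"
    by (intro integrableI_bounded) (auto intro: le_less_trans simp: ennreal_less_top)
  show "(\<integral>\<omega>. ?g \<omega> \<partial>P) \<le> \<sigma>\<^sup>2"
    using le unfolding nn_integral_eq_integral[OF i AE_I2[OF zero_le_power2]] by (simp add: ennreal_le_iff)
qed

lemma abs_entry_le: "\<bar>Z $ i $ a $ b\<bar> \<le> norm (Z $ i)" for Z :: "real^'n^'m^'a"
  by (rule order_trans[OF component_le_norm_cart Finite_Cartesian_Product.norm_nth_le])

lemma \<xi>_entry_sq: "integrable P (\<lambda>\<omega>. (\<xi> k \<omega> $ i $ a $ b)\<^sup>2)"
proof (rule Bochner_Integration.integrable_bound[OF \<xi>_block_sq(1)[of k i]])
  show "AE \<omega> in P. norm ((\<xi> k \<omega> $ i $ a $ b)\<^sup>2) \<le> norm ((norm (\<xi> k \<omega> $ i))\<^sup>2)"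
    using abs_entry_le[of "\<xi> k _" i a b] by (auto intro!: AE_I2 simp: abs_le_square_iff[symmetric])
qed measurable

lemma \<xi>_entry_integrable: "integrable P (\<lambda>\<omega>. \<xi> k \<omega> $ i $ a $ b)"
proof (rule integral_norm_le_sqrt(1))
  show "integrable P (\<lambda>\<omega>. (norm (\<xi> k \<omega> $ i $ a $ b))\<^sup>2)" using \<xi>_entry_sq by simp
qed (measurable, rule order_refl)

lemma cond_exp_G:
  "AE \<omega> in P. real_cond_exp P (F k) (\<lambda>\<omega>. G k \<omega> $ i $ a $ b) \<omega> = gradient (f i) (X k \<omega> $ i) $ a $ b"
  using stoch unfolding stochastic_oracle_def by blast

lemma G_entry_integrable: "integrable P (\<lambda>\<omega>. G k \<omega> $ i $ a $ b)"
  using Bochner_Integration.integrable_add[OF \<xi>_entry_integrable[of k i a b] continuous_integrable_X[OF continuous_on_grad_entry[of i a b], of k]]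
  by (simp add: \<xi>_def grad_stack_def)

lemma grad_entry_F: "(\<lambda>\<omega>. gradient (f i) (X k \<omega> $ i) $ a $ b) \<in> borel_measurable (F k)"
  by (rule F_compose[OF borel_measurable_continuous_onI[OF continuous_on_grad_entry] X_F])

lemma \<xi>_entry_orth:
  assumes u: "u \<in> borel_measurable (F k)" and i: "integrable P (\<lambda>\<omega>. u \<omega> * \<xi> k \<omega> $ i $ a $ b)"
  shows "(\<integral>\<omega>. u \<omega> * \<xi> k \<omega> $ i $ a $ b \<partial>P) = 0"
proof -
  interpret F: sigma_finite_subalgebra P "F k" by (rule sigma_finite_subalgebra[OF subalgebra_F])
  note [measurable] = F_measurable[OF u]
  let ?g = "\<lambda>\<omega>. gradient (f i) (X k \<omega> $ i) $ a $ b"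
  have g: "integrable P ?g" by (rule continuous_integrable_X[OF continuous_on_grad_entry])
  have eq: "(\<lambda>\<omega>. \<xi> k \<omega> $ i $ a $ b) = (\<lambda>\<omega>. G k \<omega> $ i $ a $ b - ?g \<omega>)"
    by (simp add: \<xi>_def grad_stack_def)
  have "AE \<omega> in P. real_cond_exp P (F k) (\<lambda>\<omega>. \<xi> k \<omega> $ i $ a $ b) \<omega> = 0"
    using F.real_cond_exp_diff[OF G_entry_integrable[of k i a b] g] cond_exp_G[of k i a b]
      F.real_cond_exp_F_meas[OF g grad_entry_F]
    unfolding eq by eventually_elim simp
  then have "(\<integral>\<omega>. u \<omega> * real_cond_exp P (F k) (\<lambda>\<omega>. \<xi> k \<omega> $ i $ a $ b) \<omega> \<partial>P) = (\<integral>\<omega>. 0 \<partial>P)"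
    by (intro integral_cong_AE) auto
  moreover have "(\<integral>\<omega>. u \<omega> * real_cond_exp P (F k) (\<lambda>\<omega>. \<xi> k \<omega> $ i $ a $ b) \<omega> \<partial>P) =
      (\<integral>\<omega>. u \<omega> * \<xi> k \<omega> $ i $ a $ b \<partial>P)"
    by (rule F.real_cond_exp_intg(2)[OF i u]) measurable
  ultimately show ?thesis by simp
qed

lemma \<xi>_orth:
  assumes n: "n \<in> borel_measurable (F k)" and sq: "integrable P (\<lambda>\<omega>. (norm (n \<omega>))\<^sup>2)"
  shows "(\<integral>\<omega>. n \<omega> \<bullet> \<xi> k \<omega> \<partial>P) = 0"
proof -
  note [measurable] = F_measurable[OF n]
  have nF: "(\<lambda>\<omega>. n \<omega> $ i $ a $ b) \<in> borel_measurable (F k)" for i a b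
    using F_compose[OF _ n, of "\<lambda>Z. Z $ i $ a $ b"] by simp
  have nsq: "integrable P (\<lambda>\<omega>. (n \<omega> $ i $ a $ b)\<^sup>2)" for i a b
  proof (rule Bochner_Integration.integrable_bound[OF sq])
    have "\<bar>n \<omega> $ i $ a $ b\<bar> \<le> norm (n \<omega>)" for \<omega>
      by (rule order_trans[OF abs_entry_le Finite_Cartesian_Product.norm_nth_le])
    then show "AE \<omega> in P. norm ((n \<omega> $ i $ a $ b)\<^sup>2) \<le> norm ((norm (n \<omega>))\<^sup>2)"
      by (auto intro!: AE_I2 simp: abs_le_square_iff[symmetric])
  qed measurable
  have int: "integrable P (\<lambda>\<omega>. n \<omega> $ i $ a $ b * \<xi> k \<omega> $ i $ a $ b)" for i a b
    by (rule integrable_mult_L2) (use nsq \<xi>_entry_sq in auto)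
  have "(\<integral>\<omega>. n \<omega> \<bullet> \<xi> k \<omega> \<partial>P) =
      (\<Sum>i\<in>UNIV. \<Sum>a\<in>UNIV. \<Sum>b\<in>UNIV. (\<integral>\<omega>. n \<omega> $ i $ a $ b * \<xi> k \<omega> $ i $ a $ b \<partial>P))"
    using int by (simp add: inner_vec_def)
  also have "\<dots> = 0" by (intro sum.neutral ballI \<xi>_entry_orth nF int)
  finally show ?thesis .
qed

text \<open>The oracle hypothesis is applied to a rectangle restricting entry \<open>(a, b)\<close>
  of the blocks of \<open>i\<close> and \<open>j\<close> at time \<open>k\<close> and leaving all
  other blocks and times free. The free factors are conditional probabilities of the whole space,
  hence 1 almost everywhere.\<close>

lemma \<xi>_cond_indep:
  assumes ij: "i \<noteq> j" and S [measurable]: "S \<in> sets borel" "T \<in> sets borel"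
  shows "AE \<omega> in P.
      real_cond_exp P (F k) (indicator {\<omega> \<in> space P. G k \<omega> $ i $ a $ b \<in> S \<and> G k \<omega> $ j $ a $ b \<in> T}) \<omega> =
        real_cond_exp P (F k) (indicator {\<omega> \<in> space P. G k \<omega> $ i $ a $ b \<in> S}) \<omega> *
        real_cond_exp P (F k) (indicator {\<omega> \<in> space P. G k \<omega> $ j $ a $ b \<in> T}) \<omega>"
proof -
  interpret F: sigma_finite_subalgebra P "F k" by (rule sigma_finite_subalgebra[OF subalgebra_F])
  let ?I = "(UNIV :: 'a set) \<times> {..k}"
  define R :: "'a \<times> nat \<Rightarrow> (real^'n^'m) set" where
    "R = (\<lambda>p. if p = (i, k) then {Z. Z $ a $ b \<in> S} else if p = (j, k) then {Z. Z $ a $ b \<in> T} else UNIV)"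
  define E :: "'a \<times> nat \<Rightarrow> 'w set" where
    "E p = {\<omega> \<in> space P. (case p of (i, t) \<Rightarrow> \<lambda>\<omega>. G t \<omega> $ i) \<omega> \<in> R p}" for p
  have entry: "(\<lambda>Z :: real^'n^'m. Z $ a $ b) \<in> borel_measurable borel" by measurable
  have "{Z :: real^'n^'m. Z $ a $ b \<in> U} \<in> sets borel" if "U \<in> sets borel" for U
    using measurable_sets[OF entry that] by (simp add: vimage_def)
  then have "\<forall>p\<in>?I. R p \<in> sets borel" using S by (auto simp: R_def)
  then have prod: "AE \<omega> in P. real_cond_exp P (F k)
      (indicator {\<omega> \<in> space P. \<forall>p\<in>?I. (case p of (i, t) \<Rightarrow> \<lambda>\<omega>. G t \<omega> $ i) \<omega> \<in> R p}) \<omega> =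
      (\<Prod>p\<in>?I. real_cond_exp P (F k) (indicator (E p)) \<omega>)"
    using stoch unfolding stochastic_oracle_def cond_indep_vars_def E_def by blast
  have joint: "{\<omega> \<in> space P. \<forall>p\<in>?I. (case p of (i, t) \<Rightarrow> \<lambda>\<omega>. G t \<omega> $ i) \<omega> \<in> R p} =
      {\<omega> \<in> space P. G k \<omega> $ i $ a $ b \<in> S \<and> G k \<omega> $ j $ a $ b \<in> T}"
    using ij by (auto simp: R_def)
  have Ei: "E (i, k) = {\<omega> \<in> space P. G k \<omega> $ i $ a $ b \<in> S}"
    and Ej: "E (j, k) = {\<omega> \<in> space P. G k \<omega> $ j $ a $ b \<in> T}"
    and E: "\<And>p. p \<noteq> (i, k) \<Longrightarrow> p \<noteq> (j, k) \<Longrightarrow> E p = space P"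
    using ij by (auto simp: E_def R_def)
  have one: "AE \<omega> in P. real_cond_exp P (F k) (indicator (space P)) \<omega> = indicator (space P) \<omega>"
  proof (rule F.real_cond_exp_F_meas)
    have "space P \<in> sets (F k)" using sets.top[of "F k"] by simp
    then show "indicator (space P) \<in> borel_measurable (F k)" by simp
  qed (simp add: emeasure_space_1)
  from prod one AE_space show ?thesis
  proof eventually_elim
    case (elim \<omega>)
    let ?e = "\<lambda>p. real_cond_exp P (F k) (indicator (E p)) \<omega>"
    have "(\<Prod>p\<in>?I. ?e p) = ?e (i, k) * (\<Prod>p\<in>?I - {(i, k)}. ?e p)" by (rule prod.remove) auto
    also have "(\<Prod>p\<in>?I - {(i, k)}. ?e p) = ?e (j, k) * (\<Prod>p\<in>?I - {(i, k)} - {(j, k)}. ?e p)"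
      by (rule prod.remove) (use ij in auto)
    also have "(\<Prod>p\<in>?I - {(i, k)} - {(j, k)}. ?e p) = 1"
      by (rule prod.neutral) (use elim E in auto)
    finally show ?case using elim(1) unfolding joint Ei Ej by simp
  qed
qed

text \<open>\<open>cond_indep_uncorrelated\<close> pairs a raw variable, here an entry of agent
  \<open>j\<close>, with the centred entry of agent \<open>i\<close>. The raw entry is its noise
  plus a gradient entry; the latter is known at stage \<open>k\<close>, hence orthogonal to the
  noise of \<open>i\<close>, and subtracting it leaves the product of the two noises.\<close>

lemma \<xi>_block_uncorrelated:
  assumes ij: "i \<noteq> j"
  shows "integrable P (\<lambda>\<omega>. \<xi> k \<omega> $ i \<bullet> \<xi> k \<omega> $ j)" "(\<integral>\<omega>. \<xi> k \<omega> $ i \<bullet> \<xi> k \<omega> $ j \<partial>P) = 0"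
proof -
  have int: "integrable P (\<lambda>\<omega>. \<xi> k \<omega> $ i $ a $ b * \<xi> k \<omega> $ j $ a $ b)" for a b
    by (rule integrable_mult_L2) (use \<xi>_entry_sq in auto)
  have "(\<integral>\<omega>. \<xi> k \<omega> $ i $ a $ b * \<xi> k \<omega> $ j $ a $ b \<partial>P) = 0" for a b
  proof -
    let ?g = "\<lambda>\<omega>. G k \<omega> $ i $ a $ b" and ?h = "\<lambda>\<omega>. G k \<omega> $ j $ a $ b"
    let ?gj = "\<lambda>\<omega>. gradient (f j) (X k \<omega> $ j) $ a $ b"
    have h: "?h \<omega> = \<xi> k \<omega> $ j $ a $ b + ?gj \<omega>" for \<omega> by (simp add: \<xi>_def grad_stack_def)
    have [measurable]: "?gj \<in> borel_measurable P" by (rule F_measurable[OF grad_entry_F])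
    have gsq: "integrable P (\<lambda>\<omega>. (?gj \<omega>)\<^sup>2)"
      by (rule continuous_integrable_X) (intro continuous_intros continuous_on_grad_entry)
    have gint: "integrable P (\<lambda>\<omega>. ?gj \<omega> * \<xi> k \<omega> $ i $ a $ b)"
      by (rule integrable_mult_L2) (use gsq \<xi>_entry_sq in auto)
    have hint: "integrable P (\<lambda>\<omega>. ?h \<omega> * \<xi> k \<omega> $ i $ a $ b)"
      using Bochner_Integration.integrable_add[OF int[of a b] gint] unfolding h by (simp add: algebra_simps)
    have ae: "AE \<omega> in P. ?h \<omega> * (?g \<omega> - real_cond_exp P (F k) ?g \<omega>) = ?h \<omega> * \<xi> k \<omega> $ i $ a $ b"
      using cond_exp_G[of k i a b] by eventually_elim (simp add: \<xi>_def grad_stack_def)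
    have [measurable]: "real_cond_exp P (F k) ?g \<in> borel_measurable P" by simp
    have "(\<integral>\<omega>. ?h \<omega> * (?g \<omega> - real_cond_exp P (F k) ?g \<omega>) \<partial>P) = 0"
    proof (rule cond_indep_uncorrelated[OF subalgebra_F G_entry_integrable])
      show "integrable P (\<lambda>\<omega>. ?h \<omega> * (?g \<omega> - real_cond_exp P (F k) ?g \<omega>))"
        by (subst integrable_cong_AE[OF _ _ ae]) (use hint in auto)
    qed (use \<xi>_cond_indep[OF ij] in auto)
    then have "(\<integral>\<omega>. ?h \<omega> * \<xi> k \<omega> $ i $ a $ b \<partial>P) = 0"
      by (subst (asm) integral_cong_AE[OF _ _ ae]) auto
    moreover have "(\<integral>\<omega>. ?gj \<omega> * \<xi> k \<omega> $ i $ a $ b \<partial>P) = 0"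
      by (rule \<xi>_entry_orth[OF grad_entry_F gint])
    moreover have "(\<integral>\<omega>. ?h \<omega> * \<xi> k \<omega> $ i $ a $ b \<partial>P) =
        (\<integral>\<omega>. \<xi> k \<omega> $ i $ a $ b * \<xi> k \<omega> $ j $ a $ b + ?gj \<omega> * \<xi> k \<omega> $ i $ a $ b \<partial>P)"
      unfolding h by (simp add: algebra_simps)
    moreover have "\<dots> = (\<integral>\<omega>. \<xi> k \<omega> $ i $ a $ b * \<xi> k \<omega> $ j $ a $ b \<partial>P) +
        (\<integral>\<omega>. ?gj \<omega> * \<xi> k \<omega> $ i $ a $ b \<partial>P)"
      by (rule Bochner_Integration.integral_add[OF int gint])
    ultimately show ?thesis by simp
  qed
  then show "(\<integral>\<omega>. \<xi> k \<omega> $ i \<bullet> \<xi> k \<omega> $ j \<partial>P) = 0" "integrable P (\<lambda>\<omega>. \<xi> k \<omega> $ i \<bullet> \<xi> k \<omega> $ j)"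
    using int by (simp_all add: inner_vec_def)
qed

lemma \<xi>_sq: "integrable P (\<lambda>\<omega>. (norm (\<xi> k \<omega>))\<^sup>2)" "(\<integral>\<omega>. (norm (\<xi> k \<omega>))\<^sup>2 \<partial>P) \<le> real CARD('a) * \<sigma>\<^sup>2"
proof -
  have eq: "(norm (\<xi> k \<omega>))\<^sup>2 = (\<Sum>i\<in>UNIV. (norm (\<xi> k \<omega> $ i))\<^sup>2)" for \<omega>
    by (rule norm_stack)
  have "(\<integral>\<omega>. (norm (\<xi> k \<omega>))\<^sup>2 \<partial>P) = (\<Sum>i\<in>UNIV. (\<integral>\<omega>. (norm (\<xi> k \<omega> $ i))\<^sup>2 \<partial>P))"
    unfolding eq by (rule Bochner_Integration.integral_sum) (rule \<xi>_block_sq(1))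
  also have "\<dots> \<le> (\<Sum>i\<in>(UNIV :: 'a set). \<sigma>\<^sup>2)" by (intro sum_mono \<xi>_block_sq(2))
  finally show "(\<integral>\<omega>. (norm (\<xi> k \<omega>))\<^sup>2 \<partial>P) \<le> real CARD('a) * \<sigma>\<^sup>2" by simp
  show "integrable P (\<lambda>\<omega>. (norm (\<xi> k \<omega>))\<^sup>2)"
    unfolding eq by (rule Bochner_Integration.integrable_sum) (rule \<xi>_block_sq(1))
qed

lemma mean_measurable [measurable]: "(mean :: real^'n^'m^'a \<Rightarrow> real^'n^'m) \<in> borel_measurable borel"
  by (rule borel_measurable_linear[OF linear_mean])

text \<open>Of the N^2 pairs in the expanded square only the N diagonal ones survive the
  expectation. This is the source of \<open>1 / sqrt N\<close> in the leading noise term.\<close>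

lemma mean_\<xi>_sq:
  "integrable P (\<lambda>\<omega>. (norm (mean (\<xi> k \<omega>)))\<^sup>2)" "(\<integral>\<omega>. (norm (mean (\<xi> k \<omega>)))\<^sup>2 \<partial>P) \<le> \<sigma>\<^sup>2 / real CARD('a)"
proof -
  let ?c = "real CARD('a)"
  have eq: "(norm (mean (\<xi> k \<omega>)))\<^sup>2 = (\<Sum>i\<in>UNIV. \<Sum>j\<in>UNIV. \<xi> k \<omega> $ i \<bullet> \<xi> k \<omega> $ j) / ?c\<^sup>2" for \<omega>
  proof -
    let ?S = "\<Sum>i\<in>UNIV. \<xi> k \<omega> $ i"
    have "?S \<bullet> ?S = (\<Sum>i\<in>UNIV. \<Sum>j\<in>UNIV. \<xi> k \<omega> $ i \<bullet> \<xi> k \<omega> $ j)"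
      unfolding inner_sum_left unfolding inner_sum_right by (rule refl)
    moreover have "(norm (mean (\<xi> k \<omega>)))\<^sup>2 = (?S \<bullet> ?S) / ?c\<^sup>2"
      by (simp add: mean_def power2_norm_eq_inner[symmetric] power_divide)
    ultimately show ?thesis by simp
  qed
  have int: "integrable P (\<lambda>\<omega>. \<xi> k \<omega> $ i \<bullet> \<xi> k \<omega> $ j)" for i j
    using \<xi>_block_uncorrelated(1)[of i j k] \<xi>_block_sq(1)[of k i]
    by (cases "i = j") (auto simp: power2_norm_eq_inner)
  show "integrable P (\<lambda>\<omega>. (norm (mean (\<xi> k \<omega>)))\<^sup>2)" unfolding eq using int by simp
  have val: "(\<integral>\<omega>. \<xi> k \<omega> $ i \<bullet> \<xi> k \<omega> $ j \<partial>P) = (if i = j then (\<integral>\<omega>. (norm (\<xi> k \<omega> $ i))\<^sup>2 \<partial>P) else 0)" for i j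
    using \<xi>_block_uncorrelated(2)[of i j k] by (simp add: power2_norm_eq_inner)
  have "(\<integral>\<omega>. (norm (mean (\<xi> k \<omega>)))\<^sup>2 \<partial>P) = (\<Sum>i\<in>UNIV. (\<integral>\<omega>. (norm (\<xi> k \<omega> $ i))\<^sup>2 \<partial>P)) / ?c\<^sup>2"
    unfolding eq using int by (simp add: val)
  also have "\<dots> \<le> (\<Sum>i\<in>(UNIV :: 'a set). \<sigma>\<^sup>2) / ?c\<^sup>2"
    by (intro divide_right_mono sum_mono \<xi>_block_sq(2)) auto
  finally show "(\<integral>\<omega>. (norm (mean (\<xi> k \<omega>)))\<^sup>2 \<partial>P) \<le> \<sigma>\<^sup>2 / ?c" by (simp add: power2_eq_square)
qed

lemma mean_\<xi>_orth:
  assumes n: "n \<in> borel_measurable (F k)" and sq: "integrable P (\<lambda>\<omega>. (norm (n \<omega>))\<^sup>2)"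
  shows "(\<integral>\<omega>. n \<omega> \<bullet> mean (\<xi> k \<omega>) \<partial>P) = 0"
proof -
  \<comment> \<open>Spreading \<open>n / N\<close> over all blocks turns the inner product with the
    mean into one with the whole stack, so that \<open>\<xi>_orth\<close> applies.\<close>
  let ?n = "\<lambda>\<omega>. (\<chi> i. (1 / real CARD('a)) *\<^sub>R n \<omega>) :: real^'n^'m^'a"
  have "(\<integral>\<omega>. ?n \<omega> \<bullet> \<xi> k \<omega> \<partial>P) = 0"
  proof (rule \<xi>_orth)
    show "?n \<in> borel_measurable (F k)" by (rule borel_measurable_vec_lambda) (use n in simp)
    show "integrable P (\<lambda>\<omega>. (norm (?n \<omega>))\<^sup>2)"
      unfolding norm_const_stack by (simp add: power_mult_distrib sq power_divide)
  qed
  moreover have "?n \<omega> \<bullet> \<xi> k \<omega> = n \<omega> \<bullet> mean (\<xi> k \<omega>)" for \<omega>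
    by (simp add: inner_vec_def[of "?n \<omega>"] mean_def inner_sum_right sum_divide_distrib)
  ultimately show ?thesis by simp
qed

lemma \<beta>: "0 \<le> \<beta>" "\<beta> < 1"
  using suda_muon_path.\<beta>[OF path] by auto

definition "S k \<omega> = ema \<beta> (\<lambda>k. \<xi> k \<omega>) k"

lemma subalgebra_F_Suc: "subalgebra (F (Suc k)) (F k)"
  by (rule subalgebra_F_mono) simp

lemma S_F: "S k \<in> borel_measurable (F k)"
  and S_sq: "integrable P (\<lambda>\<omega>. (norm (S k \<omega>))\<^sup>2)"
    "(\<integral>\<omega>. (norm (S k \<omega>))\<^sup>2 \<partial>P) \<le> (1 - \<beta>) * (real CARD('a) * \<sigma>\<^sup>2)"
  unfolding S_def[abs_def]
proof -
  note e = ema_second_moment[where F = F and \<zeta> = \<xi> and k = k, OF \<beta> subalgebra_F subalgebra_F_Suc \<xi>_F \<xi>_sq]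
  show "(\<lambda>\<omega>. ema \<beta> (\<lambda>k. \<xi> k \<omega>) k) \<in> borel_measurable (F k)" by (rule e(1)) (rule \<xi>_orth)
  show "integrable P (\<lambda>\<omega>. (norm (ema \<beta> (\<lambda>k. \<xi> k \<omega>) k))\<^sup>2)" by (rule e(2)) (rule \<xi>_orth)
  show "(\<integral>\<omega>. (norm (ema \<beta> (\<lambda>k. \<xi> k \<omega>) k))\<^sup>2 \<partial>P) \<le> (1 - \<beta>) * (real CARD('a) * \<sigma>\<^sup>2)"
    by (rule e(3)) (rule \<xi>_orth)
qed

lemma mean_\<xi>_F: "(\<lambda>\<omega>. mean (\<xi> k \<omega>)) \<in> borel_measurable (F (Suc k))"
  by (rule F_compose[OF mean_measurable \<xi>_F])

lemma mean_S_sq: "integrable P (\<lambda>\<omega>. (norm (mean (S k \<omega>)))\<^sup>2)"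
    "(\<integral>\<omega>. (norm (mean (S k \<omega>)))\<^sup>2 \<partial>P) \<le> (1 - \<beta>) * (\<sigma>\<^sup>2 / real CARD('a))"
  unfolding S_def[abs_def] linear_ema[OF linear_mean]
proof -
  note e = ema_second_moment[where F = F and \<zeta> = "\<lambda>k \<omega>. mean (\<xi> k \<omega>)" and k = k,
      OF \<beta> subalgebra_F subalgebra_F_Suc mean_\<xi>_F mean_\<xi>_sq]
  show "integrable P (\<lambda>\<omega>. (norm (ema \<beta> (\<lambda>k. mean (\<xi> k \<omega>)) k))\<^sup>2)" by (rule e(2)) (rule mean_\<xi>_orth)
  show "(\<integral>\<omega>. (norm (ema \<beta> (\<lambda>k. mean (\<xi> k \<omega>)) k))\<^sup>2 \<partial>P) \<le> (1 - \<beta>) * (\<sigma>\<^sup>2 / real CARD('a))"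
    by (rule e(3)) (rule mean_\<xi>_orth)
qed

section \<open>From the pathwise to the expected bound\<close>

definition "dev_sum K = v1 * v2 * (1 + op_norm (B ** B)) * norm (dev X0) / (1 - \<gamma>) +
  real K * (\<alpha> * (v1 * v2 * la / (1 - \<gamma>)) * (sqrt (real CARD('a)) * sqrt (real (min CARD('m) CARD('n)))))"

text \<open>The random quantities are arguments and enter affinely, the noise sums with nonnegative
  coefficients: the expectation passes inside, and each noise sum may then be replaced by an upper
  bound.\<close>

definition "bound_path K e0 eh ed n x y =
  (avg_fun f (mean X0) - f_inf) / \<alpha> + real K * (L * \<alpha> / 2) +
  2 * sqrt (real (min CARD('m) CARD('n))) *
    (n + L / sqrt (real CARD('a)) * dev_sum K + (e0 + real K * (L * \<alpha>)) / (1 - \<beta>)) +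
  2 * sqrt (real (min CARD('m) CARD('n))) / sqrt (real CARD('a)) * (lam / (1 - lam) *
    (eh + ed + (1 - \<beta>) * (x + y) + L * (2 * dev_sum K + real K * (sqrt (real CARD('a)) * \<alpha>))))"

lemma pathwise_bound:
  "(\<Sum>k<K. nuclear_norm (gradient (avg_fun f) (mean (X k \<omega>)))) \<le>
    bound_path K (norm (mean (H 0 \<omega>) - gradient (avg_fun f) (mean (X 0 \<omega>))))
      (norm (dev (H 0 \<omega>))) (norm (dev (grad_stack f (X 0 \<omega>)) - dev (M 0 \<omega>)))
      (\<Sum>k<K. norm (mean (S (Suc k) \<omega>))) (\<Sum>k<K. norm (\<xi> k \<omega>)) (\<Sum>k<K. norm (S k \<omega>))"
proof -
  interpret p: suda_muon_path f L W A B C \<alpha> \<beta> lam f_inf \<gamma> v1 v2 la X0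
    "\<lambda>k. G k \<omega>" "\<lambda>k. M k \<omega>" "\<lambda>k. H k \<omega>" "\<lambda>k. X k \<omega>" "\<lambda>k. Y k \<omega>" by (rule path)
  have noise: "p.noise = (\<lambda>k. \<xi> k \<omega>)" by (simp add: fun_eq_iff p.noise_def \<xi>_def)
  have noise_ema: "p.noise_ema = (\<lambda>k. S k \<omega>)" by (simp add: fun_eq_iff p.noise_ema_def noise S_def)
  have db: "(\<Sum>k<K. p.dev_bound k) \<le> dev_sum K" unfolding dev_sum_def by (rule p.sum_dev_bound_le)
  have q: "0 \<le> lam / (1 - lam)" using p.lam by simp
  have "(\<Sum>k<K. norm (mean (M (Suc k) \<omega>) - gradient (avg_fun f) (mean (X k \<omega>)))) \<le>
      (\<Sum>k<K. norm (mean (S (Suc k) \<omega>))) + L / sqrt (real CARD('a)) * (\<Sum>k<K. p.dev_bound k) +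
      (norm (mean (H 0 \<omega>) - gradient (avg_fun f) (mean (X 0 \<omega>))) + real K * (L * \<alpha>)) / (1 - \<beta>)"
    using p.sum_tracking_le[of K] unfolding noise_ema .
  also have "\<dots> \<le> (\<Sum>k<K. norm (mean (S (Suc k) \<omega>))) + L / sqrt (real CARD('a)) * dev_sum K +
      (norm (mean (H 0 \<omega>) - gradient (avg_fun f) (mean (X 0 \<omega>))) + real K * (L * \<alpha>)) / (1 - \<beta>)"
    by (intro add_mono mult_left_mono db) (use L_nonneg in auto)
  finally have t: "2 * sqrt (real (min CARD('m) CARD('n))) *
      (\<Sum>k<K. norm (mean (M (Suc k) \<omega>) - gradient (avg_fun f) (mean (X k \<omega>)))) \<le>
      2 * sqrt (real (min CARD('m) CARD('n))) * \<dots>" by (rule mult_left_mono) simp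
  have "(\<Sum>k<K. norm (dev (H (Suc k) \<omega>))) \<le> lam / (1 - lam) * (norm (dev (H 0 \<omega>)) +
      norm (dev (grad_stack f (X 0 \<omega>)) - dev (M 0 \<omega>)) +
      (1 - \<beta>) * ((\<Sum>k<K. norm (\<xi> k \<omega>)) + (\<Sum>k<K. norm (S k \<omega>))) +
      L * (2 * (\<Sum>k<K. p.dev_bound k) + real K * (sqrt (real CARD('a)) * \<alpha>)))"
    using p.sum_dev_H_le[of K] unfolding noise_ema noise .
  also have "\<dots> \<le> lam / (1 - lam) * (norm (dev (H 0 \<omega>)) +
      norm (dev (grad_stack f (X 0 \<omega>)) - dev (M 0 \<omega>)) +
      (1 - \<beta>) * ((\<Sum>k<K. norm (\<xi> k \<omega>)) + (\<Sum>k<K. norm (S k \<omega>))) +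
      L * (2 * dev_sum K + real K * (sqrt (real CARD('a)) * \<alpha>)))"
    by (intro mult_left_mono[OF _ q] add_left_mono mult_left_mono[OF _ L_nonneg] add_right_mono) (use db in auto)
  finally have d: "2 * sqrt (real (min CARD('m) CARD('n))) / sqrt (real CARD('a)) * (\<Sum>k<K. norm (dev (H (Suc k) \<omega>))) \<le>
      2 * sqrt (real (min CARD('m) CARD('n))) / sqrt (real CARD('a)) * \<dots>" by (rule mult_left_mono) simp
  show ?thesis unfolding bound_path_def using p.sum_nuclear_norm_le[of K] t d by linarith
qed

lemma integrable_norm_L2:
  assumes "integrable P (\<lambda>\<omega>. (norm (n \<omega>))\<^sup>2)" "n \<in> borel_measurable P"
  shows "integrable P (\<lambda>\<omega>. norm (n \<omega> :: 'c::euclidean_space))"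
  using integral_norm_le_sqrt(1)[OF assms(2,1) order_refl] by simp

lemma S_measurable [measurable]: "S k \<in> borel_measurable P"
  by (rule F_measurable[OF S_F])

lemma X_0: "X 0 \<omega> = X0" and M_0: "M 0 \<omega> = G 0 \<omega>" and H_0: "H 0 \<omega> = G 0 \<omega>"
  using suda_muon_path.X_0[OF path] suda_muon_path.M_0[OF path] suda_muon_path.H_0[OF path] by auto

lemma linear_G0_integrable:
  fixes T :: "real^'n^'m^'a \<Rightarrow> 'c::euclidean_space"
  assumes "linear T" shows "integrable P (\<lambda>\<omega>. T (G 0 \<omega>))"
  using integrable_bounded_linear[OF _ G_integrable[of 0], of T] assms
  by (simp add: linear_conv_bounded_linear)

lemma initial_integrable:
  "integrable P (\<lambda>\<omega>. norm (mean (H 0 \<omega>) - gradient (avg_fun f) (mean (X 0 \<omega>))))"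
  "integrable P (\<lambda>\<omega>. norm (dev (H 0 \<omega>)))"
  "integrable P (\<lambda>\<omega>. norm (dev (grad_stack f (X 0 \<omega>)) - dev (M 0 \<omega>)))"
  unfolding X_0 M_0 H_0 using linear_G0_integrable[OF linear_mean] linear_G0_integrable[OF linear_dev]
  by (simp_all add: integrable_norm)

lemma expected_norms_le:
  "(\<integral>\<omega>. norm (mean (S k \<omega>)) \<partial>P) \<le> sqrt (1 - \<beta>) * (\<sigma> / sqrt (real CARD('a)))"
  "(\<integral>\<omega>. norm (\<xi> k \<omega>) \<partial>P) \<le> sqrt (real CARD('a)) * \<sigma>"
  "(\<integral>\<omega>. norm (S k \<omega>) \<partial>P) \<le> sqrt (real CARD('a)) * \<sigma>"
  "(\<integral>\<omega>. norm (mean (\<xi> k \<omega>)) \<partial>P) \<le> \<sigma> / sqrt (real CARD('a))"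
proof -
  have "(\<integral>\<omega>. norm (mean (S k \<omega>)) \<partial>P) \<le> sqrt ((1 - \<beta>) * (\<sigma>\<^sup>2 / real CARD('a)))"
    by (rule integral_norm_le_sqrt(2)[OF _ mean_S_sq]) simp
  then show "(\<integral>\<omega>. norm (mean (S k \<omega>)) \<partial>P) \<le> sqrt (1 - \<beta>) * (\<sigma> / sqrt (real CARD('a)))"
    using \<sigma> by (simp add: real_sqrt_mult real_sqrt_divide)
  have "(\<integral>\<omega>. norm (\<xi> k \<omega>) \<partial>P) \<le> sqrt (real CARD('a) * \<sigma>\<^sup>2)"
    by (rule integral_norm_le_sqrt(2)[OF _ \<xi>_sq]) simp
  then show "(\<integral>\<omega>. norm (\<xi> k \<omega>) \<partial>P) \<le> sqrt (real CARD('a)) * \<sigma>"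
    using \<sigma> by (simp add: real_sqrt_mult)
  \<comment> \<open>The gain \<open>1 - \<beta>\<close> is given up here: in
    \<open>bound_path\<close> this average is added to the raw noise, which has no gain, and their
    sum is already multiplied by \<open>1 - \<beta>\<close>.\<close>
  have "(1 - \<beta>) * (real CARD('a) * \<sigma>\<^sup>2) \<le> 1 * (real CARD('a) * \<sigma>\<^sup>2)"
    using \<beta> by (intro mult_right_mono) auto
  with S_sq(2)[of k] have "(\<integral>\<omega>. (norm (S k \<omega>))\<^sup>2 \<partial>P) \<le> real CARD('a) * \<sigma>\<^sup>2" by linarith
  from integral_norm_le_sqrt(2)[OF S_measurable S_sq(1) this]
  show "(\<integral>\<omega>. norm (S k \<omega>) \<partial>P) \<le> sqrt (real CARD('a)) * \<sigma>"
    using \<sigma> by (simp add: real_sqrt_mult)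
  have "(\<integral>\<omega>. norm (mean (\<xi> k \<omega>)) \<partial>P) \<le> sqrt (\<sigma>\<^sup>2 / real CARD('a))"
    by (rule integral_norm_le_sqrt(2)[OF _ mean_\<xi>_sq]) simp
  then show "(\<integral>\<omega>. norm (mean (\<xi> k \<omega>)) \<partial>P) \<le> \<sigma> / sqrt (real CARD('a))"
    using \<sigma> by (simp add: real_sqrt_divide)
qed

lemma bound_path_mono:
  assumes "n \<le> n'" "x \<le> x'" "y \<le> y'"
  shows "bound_path K e0 eh ed n x y \<le> bound_path K e0 eh ed n' x' y'"
proof -
  have lam: "0 \<le> lam / (1 - lam)" using suda_muon_path.lam[OF path] by simp
  have "(1 - \<beta>) * (x + y) \<le> (1 - \<beta>) * (x' + y')" using assms \<beta> by (intro mult_left_mono) auto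
  then show ?thesis
    unfolding bound_path_def using assms
    by (intro add_mono mult_left_mono[OF _ lam] mult_left_mono) (use L_nonneg \<beta> in auto)
qed

lemma expected_bound:
  "(\<Sum>k<K. (\<integral>\<omega>. nuclear_norm (gradient (avg_fun f) (mean (X k \<omega>))) \<partial>P)) \<le>
    bound_path K (\<integral>\<omega>. norm (mean (H 0 \<omega>) - gradient (avg_fun f) (mean (X 0 \<omega>))) \<partial>P)
      (\<integral>\<omega>. norm (dev (H 0 \<omega>)) \<partial>P) (\<integral>\<omega>. norm (dev (grad_stack f (X 0 \<omega>)) - dev (M 0 \<omega>)) \<partial>P)
      (real K * (sqrt (1 - \<beta>) * (\<sigma> / sqrt (real CARD('a)))))
      (real K * (sqrt (real CARD('a)) * \<sigma>)) (real K * (sqrt (real CARD('a)) * \<sigma>))"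
proof -
  have int: "integrable P (\<lambda>\<omega>. nuclear_norm (gradient (avg_fun f) (mean (X k \<omega>))))" for k
  proof (rule continuous_integrable_X)
    have "continuous_on UNIV (mean :: real^'n^'m^'a \<Rightarrow> real^'n^'m)"
      by (simp add: linear_continuous_on linear_conv_bounded_linear[symmetric] linear_mean)
    then show "continuous_on UNIV (\<lambda>Z :: real^'n^'m^'a. nuclear_norm (gradient (avg_fun f) (mean Z)))"
      by (intro continuous_on_compose2[OF continuous_on_nuclear_norm]
          continuous_on_compose2[OF continuous_on_gradient_avg[of UNIV]]) auto
  qed
  have ints: "integrable P (\<lambda>\<omega>. norm (mean (S k \<omega>)))" "integrable P (\<lambda>\<omega>. norm (\<xi> k \<omega>))"
    "integrable P (\<lambda>\<omega>. norm (S k \<omega>))" for k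
    by (intro integrable_norm_L2 mean_S_sq \<xi>_sq S_sq; measurable)+
  let ?R = "\<lambda>\<omega>. bound_path K (norm (mean (H 0 \<omega>) - gradient (avg_fun f) (mean (X 0 \<omega>))))
      (norm (dev (H 0 \<omega>))) (norm (dev (grad_stack f (X 0 \<omega>)) - dev (M 0 \<omega>)))
      (\<Sum>k<K. norm (mean (S (Suc k) \<omega>))) (\<Sum>k<K. norm (\<xi> k \<omega>)) (\<Sum>k<K. norm (S k \<omega>))"
  have "(\<Sum>k<K. (\<integral>\<omega>. nuclear_norm (gradient (avg_fun f) (mean (X k \<omega>))) \<partial>P)) =
      (\<integral>\<omega>. (\<Sum>k<K. nuclear_norm (gradient (avg_fun f) (mean (X k \<omega>)))) \<partial>P)"
    by (rule Bochner_Integration.integral_sum[symmetric]) (rule int)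
  also have "\<dots> \<le> (\<integral>\<omega>. ?R \<omega> \<partial>P)"
  proof (rule integral_mono)
    show "integrable P ?R" unfolding bound_path_def
      using ints initial_integrable
      by (intro Bochner_Integration.integrable_add integrable_mult_right integrable_divide_zero
          Bochner_Integration.integrable_sum integrable_const) auto
  qed (use int pathwise_bound in auto)
  also have "\<dots> = bound_path K (\<integral>\<omega>. norm (mean (H 0 \<omega>) - gradient (avg_fun f) (mean (X 0 \<omega>))) \<partial>P)
      (\<integral>\<omega>. norm (dev (H 0 \<omega>)) \<partial>P) (\<integral>\<omega>. norm (dev (grad_stack f (X 0 \<omega>)) - dev (M 0 \<omega>)) \<partial>P)
      (\<Sum>k<K. (\<integral>\<omega>. norm (mean (S (Suc k) \<omega>)) \<partial>P)) (\<Sum>k<K. (\<integral>\<omega>. norm (\<xi> k \<omega>) \<partial>P))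
      (\<Sum>k<K. (\<integral>\<omega>. norm (S k \<omega>) \<partial>P))"
    unfolding bound_path_def using ints initial_integrable by (simp add: prob_space)
  also have "\<dots> \<le> bound_path K (\<integral>\<omega>. norm (mean (H 0 \<omega>) - gradient (avg_fun f) (mean (X 0 \<omega>))) \<partial>P)
      (\<integral>\<omega>. norm (dev (H 0 \<omega>)) \<partial>P) (\<integral>\<omega>. norm (dev (grad_stack f (X 0 \<omega>)) - dev (M 0 \<omega>)) \<partial>P)
      (real K * (sqrt (1 - \<beta>) * (\<sigma> / sqrt (real CARD('a)))))
      (real K * (sqrt (real CARD('a)) * \<sigma>)) (real K * (sqrt (real CARD('a)) * \<sigma>))"
    by (intro bound_path_mono order_trans[OF sum_bounded_above[OF expected_norms_le(1)]]
        order_trans[OF sum_bounded_above[OF expected_norms_le(2)]]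
        order_trans[OF sum_bounded_above[OF expected_norms_le(3)]]) simp_all
  finally show ?thesis .
qed

text \<open>In the limit statement the probability space and the run change with the horizon, so the
  initial expectations may change too. These bounds involve only data shared by all runs.\<close>

lemma initial_bounds:
  "(\<integral>\<omega>. norm (mean (H 0 \<omega>) - gradient (avg_fun f) (mean (X 0 \<omega>))) \<partial>P) \<le>
    \<sigma> / sqrt (real CARD('a)) + norm (mean (grad_stack f X0) - gradient (avg_fun f) (mean X0))"
  "(\<integral>\<omega>. norm (dev (H 0 \<omega>)) \<partial>P) \<le> sqrt (real CARD('a)) * \<sigma> + norm (grad_stack f X0)"
  "(\<integral>\<omega>. norm (dev (grad_stack f (X 0 \<omega>)) - dev (M 0 \<omega>)) \<partial>P) \<le> sqrt (real CARD('a)) * \<sigma>"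
proof -
  have G0: "G 0 \<omega> = \<xi> 0 \<omega> + grad_stack f X0" for \<omega> by (simp add: \<xi>_def X_0)
  have i1: "integrable P (\<lambda>\<omega>. norm (mean (\<xi> 0 \<omega>)))" and i2: "integrable P (\<lambda>\<omega>. norm (\<xi> 0 \<omega>))"
    by (intro integrable_norm_L2 mean_\<xi>_sq \<xi>_sq; measurable)+
  have "(\<integral>\<omega>. norm (mean (H 0 \<omega>) - gradient (avg_fun f) (mean (X 0 \<omega>))) \<partial>P) \<le>
      (\<integral>\<omega>. norm (mean (\<xi> 0 \<omega>)) + norm (mean (grad_stack f X0) - gradient (avg_fun f) (mean X0)) \<partial>P)"
  proof (rule integral_mono[OF initial_integrable(1)])
    show "norm (mean (H 0 \<omega>) - gradient (avg_fun f) (mean (X 0 \<omega>))) \<le>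
        norm (mean (\<xi> 0 \<omega>)) + norm (mean (grad_stack f X0) - gradient (avg_fun f) (mean X0))" for \<omega>
      using norm_triangle_ineq[of "mean (\<xi> 0 \<omega>)" "mean (grad_stack f X0) - gradient (avg_fun f) (mean X0)"]
      by (simp add: H_0 G0 X_0 mean_add algebra_simps)
  qed (use i1 in simp)
  also have "\<dots> \<le> \<sigma> / sqrt (real CARD('a)) + norm (mean (grad_stack f X0) - gradient (avg_fun f) (mean X0))"
    using i1 expected_norms_le(4)[of 0] by (simp add: prob_space)
  finally show "(\<integral>\<omega>. norm (mean (H 0 \<omega>) - gradient (avg_fun f) (mean (X 0 \<omega>))) \<partial>P) \<le> \<dots>" .
  have "(\<integral>\<omega>. norm (dev (H 0 \<omega>)) \<partial>P) \<le> (\<integral>\<omega>. norm (\<xi> 0 \<omega>) + norm (grad_stack f X0) \<partial>P)"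
  proof (rule integral_mono[OF initial_integrable(2)])
    show "norm (dev (H 0 \<omega>)) \<le> norm (\<xi> 0 \<omega>) + norm (grad_stack f X0)" for \<omega>
      unfolding H_0 G0 by (rule order_trans[OF norm_dev_le norm_triangle_ineq])
  qed (use i2 in simp)
  also have "\<dots> \<le> sqrt (real CARD('a)) * \<sigma> + norm (grad_stack f X0)"
    using i2 expected_norms_le(2)[of 0] by (simp add: prob_space)
  finally show "(\<integral>\<omega>. norm (dev (H 0 \<omega>)) \<partial>P) \<le> \<dots>" .
  have "(\<integral>\<omega>. norm (dev (grad_stack f (X 0 \<omega>)) - dev (M 0 \<omega>)) \<partial>P) \<le> (\<integral>\<omega>. norm (\<xi> 0 \<omega>) \<partial>P)"
  proof (rule integral_mono[OF initial_integrable(3) i2])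
    show "norm (dev (grad_stack f (X 0 \<omega>)) - dev (M 0 \<omega>)) \<le> norm (\<xi> 0 \<omega>)" for \<omega>
      using norm_dev_le[of "\<xi> 0 \<omega>"] by (simp add: M_0 X_0 \<xi>_def dev_diff norm_minus_commute)
  qed
  also have "\<dots> \<le> sqrt (real CARD('a)) * \<sigma>" by (rule expected_norms_le(2))
  finally show "(\<integral>\<omega>. norm (dev (grad_stack f (X 0 \<omega>)) - dev (M 0 \<omega>)) \<partial>P) \<le> \<dots>" .
qed

end

section \<open>Convergence rate\<close>

text \<open>
  With \<open>s = K\<^bsup>1/4\<^esup>\<close> one has \<open>\<alpha> = a / s\<^sup>3\<close> and \<open>1 - \<beta> = b / s\<^sup>2\<close>; \<open>\<rho>\<close> and \<open>\<nu>\<close> stand for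
  \<open>\<surd>r\<^sub>m\<^sub>a\<^sub>x\<close> and \<open>\<surd>N\<close>.
\<close>

lemma rate_bound:
  fixes s \<rho> \<nu> L a b lam \<sigma> v1 v2 la \<gamma> w d e0 eh ed \<Delta> D :: real
  assumes pos: "0 < s" "1 \<le> \<rho>" "0 < \<nu>" "0 \<le> L" "0 < a" "0 < b" "0 \<le> lam" "lam < 1" "0 \<le> \<sigma>"
    "0 \<le> v1" "0 \<le> v2" "0 \<le> la" "\<gamma> < 1" "0 \<le> w" "0 \<le> d"
  assumes D: "D = v1 * v2 * w * d / (1 - \<gamma>) + s ^ 4 * (a / s ^ 3 * (v1 * v2 * la / (1 - \<gamma>)) * (\<nu> * \<rho>))"
  shows "1 / s ^ 4 * (\<Delta> / (a / s ^ 3) + s ^ 4 * (L * (a / s ^ 3) / 2) +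
      2 * \<rho> * (s ^ 4 * (sqrt b / s * (\<sigma> / \<nu>)) + L / \<nu> * D + (e0 + s ^ 4 * (L * (a / s ^ 3))) / (b / s\<^sup>2)) +
      2 * \<rho> / \<nu> * (lam / (1 - lam) * (eh + ed + b / s\<^sup>2 * (s ^ 4 * (\<nu> * \<sigma>) + s ^ 4 * (\<nu> * \<sigma>)) +
        L * (2 * D + s ^ 4 * (\<nu> * (a / s ^ 3))))))
    \<le> (\<Delta> / a + 2 * \<sigma> * \<rho> / \<nu> * sqrt b + 2 * L * a * \<rho>\<^sup>2 / b) * (1 / s)
      + (5/2 * L * a + 4 * L * a * v1 * v2 * la / (1 - \<gamma>) * \<rho>\<^sup>2 + 2 * lam / (1 - lam) * L * a * \<rho>\<^sup>2
          + 8 * lam / (1 - lam) * (L * a * v1 * v2 * la / (1 - \<gamma>)) * \<rho>\<^sup>2) * (1 / s ^ 3)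
      + (2 * \<rho> / b * e0 + 4 * lam / (1 - lam) * b * \<sigma> * \<rho>) * (1 / s\<^sup>2)
      + (2 * L * v1 * v2 * w / ((1 - \<gamma>) * \<nu>) * \<rho> * d
          + 4 * lam / (1 - lam) * (L * v1 * v2 * w / ((1 - \<gamma>) * \<nu>)) * \<rho> * d
          + 2 * lam / (1 - lam) * (L * v1 * v2 * w / \<nu>) * \<rho> * d
          + 2 * lam / (1 - lam) * (\<rho> / \<nu>) * ed + 2 * lam / (1 - lam) * (\<rho> / \<nu>) * eh) * (1 / s ^ 4)
      + 4 * lam / (1 - lam) * (L * a * v1 * v2 * la / (1 - \<gamma>)) * \<rho>\<^sup>2 * (1 / s ^ 7)"
    (is "?lhs \<le> ?rhs")
proof -
  define q where "q = lam / (1 - lam)"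
  define c where "c = v1 * v2 * la / (1 - \<gamma>)"
  define h where "h = v1 * v2 * w * d"
  define g where "g = 1 - \<gamma>"
  have nn: "0 \<le> q" "0 \<le> c" "0 \<le> h" "0 < g" using pos by (simp_all add: q_def c_def h_def g_def)
  have \<rho>: "\<rho> \<le> \<rho>\<^sup>2" using pos by (simp add: power2_eq_square)
  have p0: "D = h / g + s * a * c * \<nu> * \<rho>"
    unfolding D h_def g_def c_def[symmetric] using pos by (simp add: eval_nat_numeral)
  have p1: "\<Delta> / (a / s ^ 3) = \<Delta> / a * s ^ 3" by simp
  have p2: "s ^ 4 * (L * (a / s ^ 3)) = L * a * s" "s ^ 4 * (L * (a / s ^ 3) / 2) = L * a / 2 * s"
    using pos by (simp_all add: eval_nat_numeral)
  have p3: "s ^ 4 * (sqrt b / s * (\<sigma> / \<nu>)) = sqrt b * \<sigma> / \<nu> * s ^ 3"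
    using pos by (simp add: eval_nat_numeral)
  have p4: "(e0 + L * a * s) / (b / s\<^sup>2) = e0 / b * s\<^sup>2 + L * a / b * s ^ 3"
    using pos by (simp add: field_simps eval_nat_numeral)
  have p5: "b / s\<^sup>2 * (s ^ 4 * (\<nu> * \<sigma>) + s ^ 4 * (\<nu> * \<sigma>)) = \<nu> * (2 * b * \<sigma> * s\<^sup>2)"
    using pos by (simp add: eval_nat_numeral)
  have p6: "s ^ 4 * (\<nu> * (a / s ^ 3)) = \<nu> * (a * s)" using pos by (simp add: eval_nat_numeral)
  have p7: "L / \<nu> * D = L * h / (g * \<nu>) + L * s * a * c * \<rho>"
    unfolding p0 using pos nn by (simp add: distrib_left)
  have p8: "2 * \<rho> / \<nu> * (q * (eh + ed + \<nu> * (2 * b * \<sigma> * s\<^sup>2) + L * (2 * D + \<nu> * (a * s)))) =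
      2 * \<rho> * q * (eh + ed) / \<nu> + 2 * \<rho> * q * (2 * b * \<sigma> * s\<^sup>2) + 4 * \<rho> * q * (L / \<nu> * D) + 2 * \<rho> * q * L * (a * s)"
    using pos by (simp add: field_simps)
  \<comment> \<open>The coefficients that the estimates actually yield, after multiplication by
    \<open>s^4\<close>: \<open>?X1\<close> belongs to K^(-1/4), \<open>?X3\<close> to K^(-3/4),
    \<open>?X2\<close> to K^(-1/2) and \<open>?X4\<close> to K^(-1).\<close>
  let ?X1 = "\<Delta> / a + 2 * \<sigma> * \<rho> / \<nu> * sqrt b + 2 * L * a * \<rho> / b"
  let ?X3 = "1/2 * L * a + 2 * L * a * c * \<rho>\<^sup>2 + 2 * q * L * a * \<rho> + 4 * q * L * a * c * \<rho>\<^sup>2"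
  let ?X2 = "2 * \<rho> / b * e0 + 4 * q * b * \<sigma> * \<rho>"
  let ?X4 = "2 * L * h / (g * \<nu>) * \<rho> + 4 * q * L * h / (g * \<nu>) * \<rho> + 2 * q * (\<rho> / \<nu>) * ed + 2 * q * (\<rho> / \<nu>) * eh"
  have combine: "\<Delta> / a * s ^ 3 + L * a / 2 * s +
      2 * \<rho> * (sqrt b * \<sigma> / \<nu> * s ^ 3 + (L * h / (g * \<nu>) + L * s * a * c * \<rho>) + (e0 / b * s\<^sup>2 + L * a / b * s ^ 3)) +
      (2 * \<rho> * q * (eh + ed) / \<nu> + 2 * \<rho> * q * (2 * b * \<sigma> * s\<^sup>2) +
        4 * \<rho> * q * (L * h / (g * \<nu>) + L * s * a * c * \<rho>) + 2 * \<rho> * q * L * (a * s)) =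
      ?X1 * s ^ 3 + ?X3 * s + ?X2 * s\<^sup>2 + ?X4"
    by (simp add: distrib_left distrib_right power2_eq_square add_divide_distrib mult_ac)
  \<comment> \<open>The stated coefficients are weaker. Some factors \<open>\<rho>\<close> are
    raised to \<open>\<rho>^2\<close>, which uses \<open>1 \<le> \<rho>\<close>; in
    \<open>?X3\<close> the constants 1/2, 2 and 4 of the terms already free of such a change become
    5/2, 4 and 8; \<open>?Y4\<close> gains a nonnegative term. The K^(-7/4) term is likewise
    nonnegative slack.\<close>
  let ?Y1 = "\<Delta> / a + 2 * \<sigma> * \<rho> / \<nu> * sqrt b + 2 * L * a * \<rho>\<^sup>2 / b"
  let ?Y3 = "5/2 * L * a + 4 * L * a * c * \<rho>\<^sup>2 + 2 * q * L * a * \<rho>\<^sup>2 + 8 * q * L * a * c * \<rho>\<^sup>2"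
  let ?Y4 = "2 * L * h / (g * \<nu>) * \<rho> + 4 * q * L * h / (g * \<nu>) * \<rho> + 2 * q * L * h / \<nu> * \<rho> +
    2 * q * (\<rho> / \<nu>) * ed + 2 * q * (\<rho> / \<nu>) * eh"
  have expand: "1 / s ^ 4 * (x1 * s ^ 3 + x3 * s + x2 * s\<^sup>2 + x4) = x1 / s + x3 / s ^ 3 + x2 / s\<^sup>2 + x4 / s ^ 4"
    for x1 x2 x3 x4 using pos by (simp add: distrib_left add_divide_distrib eval_nat_numeral)
  have "2 * L * a / b * \<rho> \<le> 2 * L * a / b * \<rho>\<^sup>2" using pos by (intro mult_left_mono \<rho>) auto
  then have y1: "?X1 \<le> ?Y1" by simp
  have "2 * q * L * a * \<rho> \<le> 2 * q * L * a * \<rho>\<^sup>2" using pos nn by (intro mult_left_mono \<rho>) auto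
  moreover have "0 \<le> L * a" "0 \<le> L * a * c * \<rho>\<^sup>2" "0 \<le> q * L * a * c * \<rho>\<^sup>2" using pos nn by auto
  ultimately have y3: "?X3 \<le> ?Y3" by linarith
  have "0 \<le> 2 * q * L * h / \<nu> * \<rho>" using pos nn by simp
  then have y4: "?X4 \<le> ?Y4" by linarith
  have "?lhs = 1 / s ^ 4 * (?X1 * s ^ 3 + ?X3 * s + ?X2 * s\<^sup>2 + ?X4)"
    unfolding q_def[symmetric] p1 p2 p3 p4 p5 p6 p8 p7 combine ..
  also have "\<dots> = ?X1 / s + ?X3 / s ^ 3 + ?X2 / s\<^sup>2 + ?X4 / s ^ 4" by (rule expand)
  also have "\<dots> \<le> ?Y1 / s + ?Y3 / s ^ 3 + ?X2 / s\<^sup>2 + ?Y4 / s ^ 4"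
    using divide_right_mono[OF y1, of s] divide_right_mono[OF y3, of "s ^ 3"]
      divide_right_mono[OF y4, of "s ^ 4"] pos by simp
  also have "\<dots> \<le> ?Y1 / s + ?Y3 / s ^ 3 + ?X2 / s\<^sup>2 + ?Y4 / s ^ 4 + 4 * q * L * a * c * \<rho>\<^sup>2 / s ^ 7"
    using pos nn by simp
  also have "\<dots> = ?rhs" by (simp add: q_def c_def h_def g_def mult_ac)
  finally show ?thesis .
qed

theorem proposition4:
  fixes W A B C :: "real^'a^'a"
    and f :: "'a \<Rightarrow> real^'n^'m \<Rightarrow> real"
    and X0 :: "real^'n^'m^'a"
    and L f_inf \<sigma> \<gamma> v1 v2 la \<alpha>0 b0 lam N rmax :: real
  assumes W: "transpose W = W" "doubly_stochastic W" "primitive_matrix W"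
    and lam: "lam = spectral_radius (W - avg_mat)" "0 < lam" "lam < 1"
    and A_C_stoch: "doubly_stochastic A" "doubly_stochastic C"
    and B_consensus: "\<forall>Z :: real^'n^'m^'a. act B Z = 0 \<longleftrightarrow> (\<forall>i j. Z $ i = Z $ j)"
    and poly_W: "polynomial_in W A" "polynomial_in W (B ** B)" "polynomial_in W C"
    and diff: "\<forall>i Z. f i differentiable (at Z)"
    and smooth: "\<forall>i Z Z'. nuclear_norm (gradient (f i) Z - gradient (f i) Z') \<le> L * op_norm (Z - Z')"
    and lower: "\<forall>Z. f_inf \<le> avg_fun f Z"
    and stable: "suda_stable W A B C"
    and suda_const: "suda_constants TYPE(real^'n^'m) A B C \<gamma> v1 v2 la"
    and params: "0 \<le> \<sigma>" "0 < \<alpha>0" "0 < b0" "b0 \<le> 1"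
    and N: "N = real CARD('a)"
    and rmax: "rmax = real (min CARD('m) CARD('n))"
  shows "(\<forall>K\<ge>1. \<forall>(P :: 'w measure) G M H X Y.
            suda_muon_run W A B C f \<sigma> \<alpha>0 b0 X0 K P G M H X Y \<longrightarrow>
            avg_grad_norm f K P X \<le>
              (((\<integral>\<omega>. avg_fun f (mean (X 0 \<omega>)) \<partial>P) - f_inf) / \<alpha>0
                + 2 * \<sigma> * sqrt rmax / sqrt N * sqrt b0
                + 2 * L * \<alpha>0 * rmax / b0) * real K powr (- 1/4)
            + (5/2 * L * \<alpha>0
                + 4 * L * \<alpha>0 * v1 * v2 * la / (1 - \<gamma>) * rmax
                + 2 * lam / (1 - lam) * L * \<alpha>0 * rmax
                + 8 * lam / (1 - lam) * (L * \<alpha>0 * v1 * v2 * la / (1 - \<gamma>)) * rmax) * real K powr (- 3/4)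
            + (2 * sqrt rmax / b0
                  * (\<integral>\<omega>. norm (mean (H 0 \<omega>) - gradient (avg_fun f) (mean (X 0 \<omega>))) \<partial>P)
                + 4 * lam / (1 - lam) * b0 * \<sigma> * sqrt rmax) * real K powr (- 1/2)
            + (2 * L * v1 * v2 * (1 + op_norm (B ** B)) / ((1 - \<gamma>) * sqrt N) * sqrt rmax * norm (dev X0)
                + 4 * lam / (1 - lam) * (L * v1 * v2 * (1 + op_norm (B ** B)) / ((1 - \<gamma>) * sqrt N))
                    * sqrt rmax * norm (dev X0)
                + 2 * lam / (1 - lam) * (L * v1 * v2 * (1 + op_norm (B ** B)) / sqrt N)
                    * sqrt rmax * norm (dev X0)
                + 2 * lam / (1 - lam) * sqrt (rmax / N)
                    * (\<integral>\<omega>. norm (dev (grad_stack f (X 0 \<omega>)) - dev (M 0 \<omega>)) \<partial>P)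
                + 2 * lam / (1 - lam) * sqrt (rmax / N) * (\<integral>\<omega>. norm (dev (H 0 \<omega>)) \<partial>P)) * real K powr (- 1)
            + 4 * lam / (1 - lam) * (L * \<alpha>0 * v1 * v2 * la / (1 - \<gamma>)) * rmax * real K powr (- 7/4))
       \<and> (\<forall>(P :: nat \<Rightarrow> 'w measure) G M H X Y.
            (\<forall>K\<ge>1. suda_muon_run W A B C f \<sigma> \<alpha>0 b0 X0 K (P K) (G K) (M K) (H K) (X K) (Y K)) \<longrightarrow>
            (\<lambda>K. avg_grad_norm f K (P K) (X K)) \<longlonglongrightarrow> 0)"
proof -
  \<comment> \<open>The three initial expectations are kept as arguments: the bound for a single run
    inserts their values, the limit inserts bounds uniform in the horizon. The function gap is
    written with \<open>X0\<close> because \<open>X 0\<close> is deterministic.\<close>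
  define U where "U e0 eh ed K =
              ((avg_fun f (mean X0) - f_inf) / \<alpha>0
                + 2 * \<sigma> * sqrt rmax / sqrt N * sqrt b0
                + 2 * L * \<alpha>0 * rmax / b0) * real K powr (- 1/4)
            + (5/2 * L * \<alpha>0
                + 4 * L * \<alpha>0 * v1 * v2 * la / (1 - \<gamma>) * rmax
                + 2 * lam / (1 - lam) * L * \<alpha>0 * rmax
                + 8 * lam / (1 - lam) * (L * \<alpha>0 * v1 * v2 * la / (1 - \<gamma>)) * rmax) * real K powr (- 3/4)
            + (2 * sqrt rmax / b0 * e0
                + 4 * lam / (1 - lam) * b0 * \<sigma> * sqrt rmax) * real K powr (- 1/2)
            + (2 * L * v1 * v2 * (1 + op_norm (B ** B)) / ((1 - \<gamma>) * sqrt N) * sqrt rmax * norm (dev X0)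
                + 4 * lam / (1 - lam) * (L * v1 * v2 * (1 + op_norm (B ** B)) / ((1 - \<gamma>) * sqrt N))
                    * sqrt rmax * norm (dev X0)
                + 2 * lam / (1 - lam) * (L * v1 * v2 * (1 + op_norm (B ** B)) / sqrt N)
                    * sqrt rmax * norm (dev X0)
                + 2 * lam / (1 - lam) * sqrt (rmax / N) * ed
                + 2 * lam / (1 - lam) * sqrt (rmax / N) * eh) * real K powr (- 1)
            + 4 * lam / (1 - lam) * (L * \<alpha>0 * v1 * v2 * la / (1 - \<gamma>)) * rmax * real K powr (- 7/4)"
    for e0 eh ed :: real and K :: nat
  interpret agents: smooth_agents f L
    by unfold_locales (use diff smooth in auto)
  have sc: "0 < \<gamma>" "\<gamma> < 1" "1 \<le> v1" "1 \<le> v2" "0 \<le> la"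
    using suda_const unfolding suda_constants_def by auto
  have contr: "norm (dev (act W Z)) \<le> lam * norm (dev Z)" for Z :: "real^'n^'m^'a"
  proof -
    obtain Q o1 l where "orthogonal_matrix Q" "\<forall>i. Q $ i $ o1 = 1 / sqrt (real CARD('a))" "l o1 = 1"
      "W = Q ** diag_mat l ** transpose Q"
      using stable unfolding suda_stable_def by blast
    then show ?thesis unfolding lam(1) using norm_dev_act_le[OF W(2), of Q o1 l Z] by blast
  qed
  have proc: "suda_muon_process f L P W A B C (\<alpha>0 / real K powr (3/4)) (1 - b0 / sqrt (real K))
      lam f_inf \<gamma> v1 v2 la \<sigma> X0 G M H X Y"
    if K: "1 \<le> K" and run: "suda_muon_run W A B C f \<sigma> \<alpha>0 b0 X0 K P G M H X Y"
    for K and P :: "'w measure" and G M H X Y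
  proof -
    have so: "stochastic_oracle P f \<sigma> X G" and
      sm: "\<And>\<omega>. suda_muon W A B C (\<alpha>0 / real K powr (3/4)) (1 - b0 / sqrt (real K)) X0
        (\<lambda>k. G k \<omega>) (\<lambda>k. M k \<omega>) (\<lambda>k. H k \<omega>) (\<lambda>k. X k \<omega>) (\<lambda>k. Y k \<omega>)"
      using run unfolding suda_muon_run_def by auto
    interpret prob_space P using so unfolding stochastic_oracle_def by blast
    have "b0 \<le> sqrt (real K)" using params K real_sqrt_ge_one[of "real K"] by linarith
    then have \<beta>: "0 \<le> 1 - b0 / sqrt (real K)" "1 - b0 / sqrt (real K) < 1"
      using params K by auto
    have \<alpha>: "0 < \<alpha>0 / real K powr (3/4)" using params K by simp
    show ?thesis
    proof (rule suda_muon_process.intro[OF agents.smooth_agents_axioms prob_space_axioms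
          suda_muon_process_axioms.intro])
      fix \<omega>
      show "suda_muon_path f L W A B C (\<alpha>0 / real K powr (3/4)) (1 - b0 / sqrt (real K)) lam f_inf \<gamma> v1 v2 la X0
        (\<lambda>k. G k \<omega>) (\<lambda>k. M k \<omega>) (\<lambda>k. H k \<omega>) (\<lambda>k. X k \<omega>) (\<lambda>k. Y k \<omega>)"
      proof (rule suda_muon_path.intro[OF agents.smooth_agents_axioms suda_muon_path_axioms.intro])
        show "(\<Sum>i\<in>UNIV. B $ i $ j) = 0" for j
          by (rule suda_stable_column_sums[OF stable B_consensus])
      qed (use sm \<alpha> \<beta> W A_C_stoch lam contr suda_const lower in auto)
    qed (use so params in auto)
  qed
  have rate: "avg_grad_norm f K P X \<le> U (\<integral>\<omega>. norm (mean (H 0 \<omega>) - gradient (avg_fun f) (mean (X 0 \<omega>))) \<partial>P)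
      (\<integral>\<omega>. norm (dev (H 0 \<omega>)) \<partial>P) (\<integral>\<omega>. norm (dev (grad_stack f (X 0 \<omega>)) - dev (M 0 \<omega>)) \<partial>P) K"
    if K: "1 \<le> K" and run: "suda_muon_run W A B C f \<sigma> \<alpha>0 b0 X0 K P G M H X Y"
    for K and P :: "'w measure" and G M H X Y
  proof -
    let ?\<alpha> = "\<alpha>0 / real K powr (3/4)" and ?\<beta> = "1 - b0 / sqrt (real K)"
    interpret process: suda_muon_process f L P W A B C ?\<alpha> ?\<beta> lam f_inf \<gamma> v1 v2 la \<sigma> X0 G M H X Y
      by (rule proc[OF K run])
    define s where "s = real K powr (1/4)"
    have s: "0 < s" using K by (simp add: s_def)
    have pow: "s ^ n = real K powr (real n / 4)" for n
      using K by (simp add: s_def powr_power)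
    have K4: "real K = s ^ 4" using K by (simp add: pow)
    have \<alpha>: "?\<alpha> = \<alpha>0 / s ^ 3" by (simp add: pow)
    have sq: "sqrt (real K) = s\<^sup>2" using K by (simp add: pow powr_half_sqrt)
    then have \<beta>: "1 - ?\<beta> = b0 / s\<^sup>2" by simp
    have s\<beta>: "sqrt (1 - ?\<beta>) = sqrt b0 / s" using s by (simp add: \<beta> real_sqrt_divide)
    have neg: "real K powr (- 1/4) = 1 / s" "real K powr (- 3/4) = 1 / s ^ 3" "real K powr (- 1/2) = 1 / s\<^sup>2"
      "real K powr (- 1) = 1 / s ^ 4" "real K powr (- 7/4) = 1 / s ^ 7"
      unfolding pow by (simp_all add: s_def powr_minus_divide[symmetric])
    have r1: "1 \<le> sqrt rmax" "(sqrt rmax)\<^sup>2 = rmax" and N0: "0 < sqrt N"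
      by (simp_all add: rmax N Suc_le_eq)
    define D where "D = process.dev_sum K"
    have nonneg: "0 \<le> v1" "0 \<le> v2" "0 \<le> 1 + op_norm (B ** B)"
      using sc(3,4) op_norm_nonneg[of "B ** B"] by simp_all
    have "D = v1 * v2 * (1 + op_norm (B ** B)) * norm (dev X0) / (1 - \<gamma>) +
        s ^ 4 * (\<alpha>0 / s ^ 3 * (v1 * v2 * la / (1 - \<gamma>)) * (sqrt N * sqrt rmax))"
      unfolding D_def unfolding process.dev_sum_def unfolding N[symmetric] rmax[symmetric] \<alpha> K4[symmetric] ..
    note arith = rate_bound[OF s r1(1) N0 agents.L_nonneg params(2,3) less_imp_le[OF lam(2)] lam(3) params(1)
        nonneg(1,2) sc(5,2) nonneg(3) norm_ge_zero this, unfolded r1(2)]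
    have rb: "1 / real K * process.bound_path K e0 eh ed (real K * (sqrt (1 - ?\<beta>) * (\<sigma> / sqrt N)))
        (real K * (sqrt N * \<sigma>)) (real K * (sqrt N * \<sigma>)) \<le> U e0 eh ed K" for e0 eh ed
      \<comment> \<open>The order matters: the square root of \<open>1 - \<beta>\<close> has to be
        rewritten before \<open>1 - \<beta>\<close> itself disappears, and \<open>K4\<close> comes
        last because the left-hand sides of \<open>\<alpha>\<close> and \<open>neg\<close> still
        mention \<open>K\<close>.\<close>
      unfolding process.bound_path_def unfolding D_def[symmetric] unfolding s\<beta> unfolding \<beta>
      unfolding U_def unfolding \<alpha> neg rmax[symmetric] N[symmetric] real_sqrt_divide unfolding K4
      by (rule arith)
    have "avg_grad_norm f K P X \<le> 1 / real K * process.bound_path K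
      (\<integral>\<omega>. norm (mean (H 0 \<omega>) - gradient (avg_fun f) (mean (X 0 \<omega>))) \<partial>P)
      (\<integral>\<omega>. norm (dev (H 0 \<omega>)) \<partial>P) (\<integral>\<omega>. norm (dev (grad_stack f (X 0 \<omega>)) - dev (M 0 \<omega>)) \<partial>P)
      (real K * (sqrt (1 - ?\<beta>) * (\<sigma> / sqrt N))) (real K * (sqrt N * \<sigma>)) (real K * (sqrt N * \<sigma>))"
      unfolding avg_grad_norm_def N by (rule mult_left_mono[OF process.expected_bound]) simp
    also note rb
    finally show ?thesis .
  qed
  show ?thesis
  proof (rule conjI; intro allI impI)
    fix K :: nat and P :: "'w measure" and G M H X Y
    assume K: "1 \<le> K" and run: "suda_muon_run W A B C f \<sigma> \<alpha>0 b0 X0 K P G M H X Y"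
    interpret process: suda_muon_process f L P W A B C "\<alpha>0 / real K powr (3/4)" "1 - b0 / sqrt (real K)"
        lam f_inf \<gamma> v1 v2 la \<sigma> X0 G M H X Y
      by (rule proc[OF K run])
    have "(\<integral>\<omega>. avg_fun f (mean (X 0 \<omega>)) \<partial>P) = avg_fun f (mean X0)"
      by (simp add: process.X_0 process.prob_space)
    with rate[OF K run] show "avg_grad_norm f K P X \<le> (((\<integral>\<omega>. avg_fun f (mean (X 0 \<omega>)) \<partial>P) - f_inf) / \<alpha>0
                + 2 * \<sigma> * sqrt rmax / sqrt N * sqrt b0
                + 2 * L * \<alpha>0 * rmax / b0) * real K powr (- 1/4)
            + (5/2 * L * \<alpha>0
                + 4 * L * \<alpha>0 * v1 * v2 * la / (1 - \<gamma>) * rmax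
                + 2 * lam / (1 - lam) * L * \<alpha>0 * rmax
                + 8 * lam / (1 - lam) * (L * \<alpha>0 * v1 * v2 * la / (1 - \<gamma>)) * rmax) * real K powr (- 3/4)
            + (2 * sqrt rmax / b0
                  * (\<integral>\<omega>. norm (mean (H 0 \<omega>) - gradient (avg_fun f) (mean (X 0 \<omega>))) \<partial>P)
                + 4 * lam / (1 - lam) * b0 * \<sigma> * sqrt rmax) * real K powr (- 1/2)
            + (2 * L * v1 * v2 * (1 + op_norm (B ** B)) / ((1 - \<gamma>) * sqrt N) * sqrt rmax * norm (dev X0)
                + 4 * lam / (1 - lam) * (L * v1 * v2 * (1 + op_norm (B ** B)) / ((1 - \<gamma>) * sqrt N))
                    * sqrt rmax * norm (dev X0)
                + 2 * lam / (1 - lam) * (L * v1 * v2 * (1 + op_norm (B ** B)) / sqrt N)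
                    * sqrt rmax * norm (dev X0)
                + 2 * lam / (1 - lam) * sqrt (rmax / N)
                    * (\<integral>\<omega>. norm (dev (grad_stack f (X 0 \<omega>)) - dev (M 0 \<omega>)) \<partial>P)
                + 2 * lam / (1 - lam) * sqrt (rmax / N) * (\<integral>\<omega>. norm (dev (H 0 \<omega>)) \<partial>P)) * real K powr (- 1)
            + 4 * lam / (1 - lam) * (L * \<alpha>0 * v1 * v2 * la / (1 - \<gamma>)) * rmax * real K powr (- 7/4)"
      unfolding U_def by simp
  next
    fix P :: "nat \<Rightarrow> 'w measure" and G M H X Y
    assume run: "\<forall>K\<ge>1. suda_muon_run W A B C f \<sigma> \<alpha>0 b0 X0 K (P K) (G K) (M K) (H K) (X K) (Y K)"
    let ?e0 = "\<sigma> / sqrt N + norm (mean (grad_stack f X0) - gradient (avg_fun f) (mean X0))"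
    let ?eh = "sqrt N * \<sigma> + norm (grad_stack f X0)" and ?ed = "sqrt N * \<sigma>"
    have U_mono: "U e0 eh ed K \<le> U e0' eh' ed' K" if "e0 \<le> e0'" "eh \<le> eh'" "ed \<le> ed'" for e0 e0' eh eh' ed ed' K
    proof -
      have "2 * sqrt rmax / b0 * e0 \<le> 2 * sqrt rmax / b0 * e0'"
        using that params by (intro mult_left_mono) (auto simp: rmax)
      moreover have "2 * lam / (1 - lam) * sqrt (rmax / N) * x \<le> 2 * lam / (1 - lam) * sqrt (rmax / N) * x'"
        if "x \<le> x'" for x x' using that lam by (intro mult_left_mono) (auto simp: rmax N)
      ultimately show ?thesis unfolding U_def using that
        by (intro add_mono[OF add_mono[OF add_mono[OF order_refl mult_right_mono[OF add_right_mono powr_ge_zero]]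
                mult_right_mono[OF add_mono[OF add_mono[OF order_refl]] powr_ge_zero]] order_refl])
    qed
    have le: "avg_grad_norm f K (P K) (X K) \<le> U ?e0 ?eh ?ed K" if K: "1 \<le> K" for K
    proof -
      have r: "suda_muon_run W A B C f \<sigma> \<alpha>0 b0 X0 K (P K) (G K) (M K) (H K) (X K) (Y K)"
        using run K by blast
      note init = suda_muon_process.initial_bounds[OF proc[OF K r], folded N]
      show ?thesis by (rule order_trans[OF rate[OF K r] U_mono[OF init]])
    qed
    have nonneg: "0 \<le> avg_grad_norm f K (P K) (X K)" for K
      unfolding avg_grad_norm_def by (intro mult_nonneg_nonneg sum_nonneg Bochner_Integration.integral_nonneg)
        (simp_all add: nuclear_norm_nonneg)
    \<comment> \<open>With uniform initial bounds, every summand of \<open>U\<close> is a constant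
      times a negative power of \<open>K\<close>.\<close>
    have "(\<lambda>K. real K powr (- p)) \<longlonglongrightarrow> 0" if "0 < p" for p
      using tendsto_neg_powr[OF _ filterlim_real_sequentially, of "- p"] that by simp
    from this[of "1/4"] this[of "3/4"] this[of "1/2"] this[of 1] this[of "7/4"]
    have lim: "U ?e0 ?eh ?ed \<longlonglongrightarrow> 0"
      unfolding U_def by (intro tendsto_add_zero tendsto_mult_right_zero) simp_all
    show "(\<lambda>K. avg_grad_norm f K (P K) (X K)) \<longlonglongrightarrow> 0"
    proof (rule tendsto_sandwich[OF _ _ tendsto_const lim])
      show "\<forall>\<^sub>F K in sequentially. avg_grad_norm f K (P K) (X K) \<le> U ?e0 ?eh ?ed K"
        using le by (rule eventually_sequentiallyI)
    qed (simp add: nonneg)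
  qed
qed

end
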